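(* Let $\alpha_n$ be the positive real solution of $ue^u=n+1$ (so $\alpha_n=\log n-\log\log n+o(1)$). With $\lambda$ uniformly distributed on $\Pi(n)$, $$E(d(\lambda))=\Big(\frac{\alpha_n-2}{\alpha_n^2}\Big)n^2+O(n\alpha_n^{-1}).$$ Let $S_k(d;n):=\frac{1}{B_n}\sum_{\lambda\in\Pi(n)}\big(d(\lambda)-M(d;n)/B_n\big)^k$, where $M(d;n)=\sum_{\lambda\in\Pi(n)}d(\lambda)$. Then $$S_2(d;n)=\Big(\frac{\alpha_n^2-7\alpha_n+17}{\alpha_n^3(\alpha_n+1)}\Big)n^3+O(n^2\alpha_n^{-1}),$$ $$S_3(d;n)=\Big(-\frac{881}{3}-244\alpha_n+145\alpha_n^2-\frac{83}{3}\alpha_n^3+2\alpha_n^4\Big)\frac{n^4}{\alpha_n^4(\alpha_n+1)^3}+O(n^3\alpha_n^{-1}).$$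
   Context: $\Pi(n)$ is the set of set partitions of $[n]=\{1,\dots,n\}$ and $B_n=|\Pi(n)|$ is the $n$th Bell number. For $\lambda\in\Pi(n)$ with blocks $\mathbf{B}_1,\dots,\mathbf{B}_\ell$, the dimension exponent is $d(\lambda)=\sum_{i=1}^{\ell}(\max\mathbf{B}_i-\min\mathbf{B}_i+1)-n$. Asymptotics are as $n\to\infty$. *)

theory Defs
  imports "HOL-Probability.Probability" "HOL-Library.Landau_Symbols"
begin

definition set_partitions :: "nat \<Rightarrow> nat set set set" where
  "set_partitions n = {P. partition_on {1..n} P}"

definition Bell :: "nat \<Rightarrow> nat" where
  "Bell n = card (set_partitions n)"

definition dim_exponent :: "nat \<Rightarrow> nat set set \<Rightarrow> int" where
  "dim_exponent n P = (\<Sum>B\<in>P. int (Max B) - int (Min B) + 1) - int n"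

definition expect_partitions :: "nat \<Rightarrow> (nat set set \<Rightarrow> real) \<Rightarrow> real" where
  "expect_partitions n f = measure_pmf.expectation (pmf_of_set (set_partitions n)) f"

definition total_stat :: "(nat \<Rightarrow> nat set set \<Rightarrow> int) \<Rightarrow> nat \<Rightarrow> int" where
  "total_stat f n = (\<Sum>P\<in>set_partitions n. f n P)"

definition central_moment :: "nat \<Rightarrow> (nat \<Rightarrow> nat set set \<Rightarrow> int) \<Rightarrow> nat \<Rightarrow> real" where
  "central_moment k f n =
     1 / real (Bell n) *
     (\<Sum>P\<in>set_partitions n.
        (real_of_int (f n P) - real_of_int (total_stat f n) / real (Bell n)) ^ k)"

definition alpha :: "nat \<Rightarrow> real" where
  "alpha n = (THE u. u > 0 \<and> u * exp u = real n + 1)"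

lemma alpha_ex1: "\<exists>!u::real. u > 0 \<and> u * exp u = real n + 1"
proof (rule ex_ex1I)
  have "\<exists>u::real. 0 \<le> u \<and> u \<le> real n + 1 \<and> u * exp u = real n + 1"
  proof (rule IVT')
    have "(real n + 1) * 1 \<le> (real n + 1) * exp (real n + 1)"
      by (intro mult_left_mono) auto
    then show "real n + 1 \<le> (real n + 1) * exp (real n + 1)" by simp
  qed (auto intro!: continuous_intros)
  then show "\<exists>u::real. u > 0 \<and> u * exp u = real n + 1"
    by (metis add_nonneg_pos less_eq_real_def mult_zero_left of_nat_0_le_iff
        order_less_irrefl zero_less_one)
next
  fix u v :: real
  assume u: "u > 0 \<and> u * exp u = real n + 1" and v: "v > 0 \<and> v * exp v = real n + 1"
  have strict: "x * exp x < y * exp y" if "0 < x" "x < y" for x y :: real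
    using that by (intro mult_strict_mono) auto
  show "u = v"
    using strict[of u v] strict[of v u] u v by (cases u v rule: linorder_cases) auto
qed

lemma finite_set_partitions: "finite (set_partitions n)"
  unfolding set_partitions_def by (rule finitely_many_partition_on) simp

end

theory Submission
  imports Defs "HOL-Real_Asymp.Real_Asymp"
begin

text \<open>
  Building a partition element by element and recording only which blocks will be continued, the
  dimension exponent changes by a function of the number of open blocks. Diagonalising this process
  with Charlier polynomials yields, for \<open>i \<le> 3\<close>, polynomials \<open>F\<^sub>i\<close> in \<open>n\<close> and \<open>k\<close> such that the \<open>i\<close>-th
  moment of the dimension exponent is the expectation of \<open>F\<^sub>i n K\<close>, where by Dobinski's formula \<open>K\<close> has
  probabilities proportional to \<open>k ^ n / k!\<close>.

  The law of \<open>K\<close> satisfies the exact identity \<open>E (g K) = E (\<rho> K * g (K - 1))\<close> with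
  \<open>\<rho> k = k * (1 - 1 / k) ^ n\<close>. Monotonicity of \<open>(1 - 1 / k) ^ n\<close> turns it into bounds for all moments of
  \<open>(K - c) / sqrt c\<close> around the centre \<open>c = exp (alpha n) = (n + 1) / alpha n\<close>. Expanding \<open>\<rho>\<close> around \<open>c\<close>
  and testing the identity with powers of \<open>K - c\<close> gives a triangular linear system for these moments,
  which determines two terms of their expansion in powers of \<open>1 / c\<close>. In the central moments of
  \<open>F\<^sub>1 n K\<close> the leading powers of \<open>c\<close> cancel, and what is left is the main term together with a rational function of \<open>alpha n\<close> of the order claimed for the error.
\<close>

section \<open>Extending set partitions\<close>

text \<open>The centre is where consecutive Dobinski weights agree: \<open>\<rho> k = 1\<close>
  reads approximately \<open>ln k = n / k\<close>, and \<open>alpha\<close> is defined so that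
  \<open>k = exp (alpha n)\<close> solves this with \<open>n + 1\<close> in place of
  \<open>n\<close>. The third central moment dictates the depth of the expansion. So two terms of
  the moments of the deviation are needed, and isolating the second term of an odd moment costs a
  division by \<open>eps n ^ 4\<close>, where \<open>eps n ^ 2 = 1 / cen n\<close>. If the weight
  ratio is known up to order \<open>eps n ^ 5\<close>, one factor \<open>eps n\<close> survives; it
  beats every power of \<open>alpha n\<close>, so logarithms need not be tracked before the last
  step. The ratio is close to a Taylor polynomial only near the centre, whereas expectations run
  over all \<open>k\<close>. The error bound is therefore allowed to grow polynomially in the
  deviation, which costs nothing once the moments of every order are bounded.\<close>

lemma partition_on_insert_point:
  assumes "a \<notin> A"
  shows "{P. partition_on (insert a A) P} =
    insert {a} ` {P. partition_on A P} \<union>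
    (\<lambda>(P, B). insert (insert a B) (P - {B})) ` (SIGMA P:{P. partition_on A P}. P)"
    (is "?L = ?R1 \<union> ?R2")
proof (intro equalityI subsetI)
  fix Q assume "Q \<in> ?L"
  then have Q: "partition_on (insert a A) Q" by simp
  then obtain C where C: "C \<in> Q" "a \<in> C"
    by (metis UnionE insertI1 partition_onD1)
  have others: "a \<notin> D" if "D \<in> Q" "D \<noteq> C" for D
    using partition_onD2[OF Q] that C by (auto simp: disjoint_def)
  have C_other: "D \<inter> C = {}" if "D \<in> Q - {C}" for D
    using partition_onD2[OF Q] that C by (auto simp: disjoint_def)
  have un: "\<Union>Q = insert a A" using partition_onD1[OF Q] by simp
  show "Q \<in> ?R1 \<union> ?R2"
  proof (cases "C = {a}")
    case True
    have "partition_on A (Q - {{a}})"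
    proof (rule partition_onI)
      show "\<Union>(Q - {{a}}) = A"
      proof -
        have "\<Union>(Q - {{a}}) = \<Union>Q - {a}" using others True C by (auto simp: True)
        then show ?thesis using un assms by simp
      qed
      show "disjnt p q" if "p \<in> Q - {{a}}" "q \<in> Q - {{a}}" "p \<noteq> q" for p q
        using partition_onD2[OF Q] that by (auto simp: disjoint_def disjnt_def)
      show "{} \<notin> Q - {{a}}" using partition_onD3[OF Q] by auto
    qed
    moreover have "Q = insert {a} (Q - {{a}})" using C True by auto
    ultimately show ?thesis by blast
  next
    case False
    let ?B = "C - {a}" let ?P = "insert ?B (Q - {C})"
    have B: "?B \<noteq> {}" using False C by auto
    have notin: "?B \<notin> Q - {C}" using C_other[of ?B] B by auto
    have "partition_on A ?P"
    proof (rule partition_onI)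
      have "\<Union>?P = \<Union>Q - {a}" using others C by auto
      then show "\<Union>?P = A" using un assms by simp
      show "disjnt p q" if "p \<in> ?P" "q \<in> ?P" "p \<noteq> q" for p q
        using partition_onD2[OF Q] that C_other by (auto simp: disjoint_def disjnt_def)
      show "{} \<notin> ?P" using partition_onD3[OF Q] B by auto
    qed
    moreover have "Q = insert (insert a ?B) (?P - {?B})"
      using C notin by (auto simp: insert_absorb)
    ultimately show ?thesis by (intro UnI2 image_eqI[of _ _ "(?P, ?B)"]) auto
  qed
next
  fix Q assume "Q \<in> ?R1 \<union> ?R2"
  then show "Q \<in> ?L"
  proof
    assume "Q \<in> ?R1"
    then obtain P where P: "partition_on A P" "Q = insert {a} P" by auto
    show ?thesis
      using P assms by (auto simp: partition_on_def disjoint_def)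
  next
    assume "Q \<in> ?R2"
    then obtain P B where P: "partition_on A P" "B \<in> P" "Q = insert (insert a B) (P - {B})" by auto
    have "\<Union>Q = insert a A" using partition_onD1[OF P(1)] P(2,3) by auto
    moreover have "disjoint Q"
      using partition_onD1[OF P(1)] partition_onD2[OF P(1)] P(2,3) assms
      by (auto simp: disjoint_def)
    moreover have "{} \<notin> Q" using partition_onD3[OF P(1)] P(3) by auto
    ultimately show ?thesis by (simp add: partition_on_def)
  qed
qed

text \<open>Deleting \<open>a\<close> recovers \<open>P\<close> and \<open>B\<close>, so both maps
  are injective; their images are disjoint because blocks are nonempty.\<close>

lemma sum_partition_on_insert_point:
  fixes F :: "'a set set \<Rightarrow> real"
  assumes fin: "finite A" and a: "a \<notin> A"
  shows "(\<Sum>Q | partition_on (insert a A) Q. F Q) =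
    (\<Sum>P | partition_on A P. F (insert {a} P) + (\<Sum>B\<in>P. F (insert (insert a B) (P - {B}))))"
proof -
  let ?X = "{P. partition_on A P}" and ?g = "\<lambda>(P, B). insert (insert a B) (P - {B})"
  have finX: "finite ?X" by (rule finitely_many_partition_on[OF fin])
  have finP: "finite P" if "P \<in> ?X" for P using that fin finite_elements by auto
  have na: "a \<notin> B" if "P \<in> ?X" "B \<in> P" for P B
    using that a partition_onD1 by fastforce
  have inj1: "inj_on (insert {a}) ?X"
  proof (rule inj_onI)
    fix P P' assume "P \<in> ?X" "P' \<in> ?X" "insert {a} P = insert {a} P'"
    moreover have "{a} \<notin> P" "{a} \<notin> P'" using na calculation by blast+
    ultimately show "P = P'" by (metis insert_ident)
  qed
  have inj2: "inj_on ?g (Sigma ?X (\<lambda>P. P))"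
  proof (rule inj_onI, clarify)
    fix P B P' B'
    assume P: "partition_on A P" "B \<in> P" and P': "partition_on A P'" "B' \<in> P'"
      and eq: "insert (insert a B) (P - {B}) = insert (insert a B') (P' - {B'})"
    have nP: "a \<notin> D" if "D \<in> P" for D using na[of P D] P that by auto
    have nP': "a \<notin> D" if "D \<in> P'" for D using na[of P' D] P' that by auto
    have "insert a B \<in> insert (insert a B') (P' - {B'})" unfolding eq[symmetric] by simp
    then have "insert a B = insert a B'" using nP'[of "insert a B"] by auto
    then have B: "B = B'" using nP nP' P(2) P'(2) by (metis insert_ident)
    have "P - {B} = P' - {B'}"
      using eq nP[of "insert a B"] nP'[of "insert a B"] B by (metis Diff_iff insertI1 insert_ident)
    then show "P = P' \<and> B = B'" using B P(2) P'(2) by (metis insert_Diff)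
  qed
  have disj: "insert {a} ` ?X \<inter> ?g ` (Sigma ?X (\<lambda>P. P)) = {}"
  proof (rule ccontr)
    assume "\<not> ?thesis"
    then obtain P P' B where h: "P \<in> ?X" "P' \<in> ?X" "B \<in> P'"
      "insert {a} P = insert (insert a B) (P' - {B})"
      by (force simp: disjoint_iff)
    have "insert a B \<in> insert {a} P" unfolding h(4) by simp
    then have "insert a B = {a}" using na[of P "insert a B"] h by auto
    then have "B = {}" using na[of P' B] h by auto
    then show False using h(2,3) partition_onD3[of A P'] by simp
  qed
  have "(\<Sum>Q | partition_on (insert a A) Q. F Q) =
     (\<Sum>Q\<in>insert {a} ` ?X. F Q) + (\<Sum>Q\<in>?g ` (Sigma ?X (\<lambda>P. P)). F Q)"
    unfolding partition_on_insert_point[OF a]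
    by (rule sum.union_disjoint) (use finX finP disj in auto)
  also have "(\<Sum>Q\<in>insert {a} ` ?X. F Q) = (\<Sum>P\<in>?X. F (insert {a} P))"
    using inj1 by (simp add: sum.reindex)
  also have "(\<Sum>Q\<in>?g ` (Sigma ?X (\<lambda>P. P)). F Q) =
      (\<Sum>P\<in>?X. \<Sum>B\<in>P. F (insert (insert a B) (P - {B})))"
    using inj2 finX finP
    by (subst sum.Sigma) (auto simp: sum.reindex case_prod_unfold)
  finally show ?thesis by (simp add: sum.distrib)
qed

text \<open>Blocks in the set \<open>U\<close> are open: they will receive further elements, so they are counted as
  if they extended to \<open>n\<close>. This makes the statistic grow by a function of \<open>card U\<close> alone when \<open>n + 1\<close>
  is inserted.\<close>

definition partial_dim :: "nat \<Rightarrow> nat set set \<Rightarrow> nat set set \<Rightarrow> real" where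
  "partial_dim n P U =
     (\<Sum>B\<in>P. (if B \<in> U then real n else real (Max B)) - real (Min B) + 1) - real n"

definition open_sum :: "nat \<Rightarrow> (real \<Rightarrow> nat \<Rightarrow> real) \<Rightarrow> real" where
  "open_sum n f = (\<Sum>P\<in>set_partitions n. \<Sum>U\<in>Pow P. f (partial_dim n P U) (card U))"

lemma sum_Pow_insert:
  assumes "finite A" "a \<notin> A"
  shows "(\<Sum>U\<in>Pow (insert a A). f U) = (\<Sum>U\<in>Pow A. f U + f (insert a U) :: real)"
proof -
  have "(\<Sum>U\<in>Pow (insert a A). f U) = sum f (Pow A) + sum f (insert a ` Pow A)"
    unfolding Pow_insert by (rule sum.union_disjoint) (use assms in auto)
  also have "sum f (insert a ` Pow A) = (\<Sum>U\<in>Pow A. f (insert a U))"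
    by (rule sum.reindex_cong[OF _ refl refl]) (use assms in \<open>auto intro!: inj_onI\<close>)
  finally show ?thesis by (simp add: sum.distrib)
qed

text \<open>The pair \<open>(B, U)\<close> is encoded as the set \<open>insert B U\<close> with the
  distinguished member \<open>B\<close>. In the transition, \<open>B\<close> is the block being
  extended, which was open before; the sum over it thus turns into a factor
  \<open>card U\<close>.\<close>

lemma sum_Pow_remove:
  assumes "finite P"
  shows "(\<Sum>B\<in>P. \<Sum>U\<in>Pow (P - {B}). f B U) = (\<Sum>U\<in>Pow P. \<Sum>B\<in>U. f B (U - {B}) :: real)"
proof -
  have "(\<Sum>B\<in>P. \<Sum>U\<in>Pow (P - {B}). f B U) = (\<Sum>(B, U)\<in>(SIGMA B:P. Pow (P - {B})). f B U)"
    by (rule sum.Sigma) (use assms in auto)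
  also have "\<dots> = (\<Sum>(U, B)\<in>(SIGMA U:Pow P. U). f B (U - {B}))"
    by (rule sum.reindex_bij_witness[of _ "\<lambda>(U, B). (B, U - {B})" "\<lambda>(B, U). (insert B U, B)"])
       (auto simp: Diff_insert_absorb subset_Diff_insert)
  also have "\<dots> = (\<Sum>U\<in>Pow P. \<Sum>B\<in>U. f B (U - {B}))"
    by (rule sum.Sigma[symmetric]) (use assms finite_subset in auto)
  finally show ?thesis .
qed

lemma set_partitionsD:
  assumes "P \<in> set_partitions n"
  shows "finite P" "\<And>B. B \<in> P \<Longrightarrow> B \<noteq> {} \<and> finite B \<and> B \<subseteq> {1..n}"
proof -
  have p: "partition_on {1..n} P" using assms by (simp add: set_partitions_def)
  show "finite P" using finite_elements[OF _ p] by simp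
  show "B \<noteq> {} \<and> finite B \<and> B \<subseteq> {1..n}" if "B \<in> P" for B
    using partition_onD1[OF p] partition_onD3[OF p] that
    by (metis Union_upper finite_atLeastAtMost finite_subset)
qed

text \<open>Each open block is now counted up to \<open>n + 1\<close> instead of \<open>n\<close>.
  The new block adds 1, open or not, and the subtracted \<open>n + 1\<close> takes this
  back.\<close>

lemma partial_dim_singleton:
  assumes P: "P \<in> set_partitions n" and U: "U \<subseteq> P"
  shows "partial_dim (Suc n) (insert {Suc n} P) U = partial_dim n P U + card U"
    and "partial_dim (Suc n) (insert {Suc n} P) (insert {Suc n} U) = partial_dim n P U + card U"
proof -
  note D = set_partitionsD[OF P]
  have nin: "{Suc n} \<notin> P" using D(2)[of "{Suc n}"] by auto
  have nU: "{Suc n} \<notin> U" using nin U by auto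
  have "(\<Sum>B\<in>P. (if B \<in> U then real (Suc n) else real (Max B)) - real (Min B) + 1)
      = (\<Sum>B\<in>P. ((if B \<in> U then real n else real (Max B)) - real (Min B) + 1) + (if B \<in> U then 1 else 0))"
    by (intro sum.cong) auto
  also have "\<dots> = (\<Sum>B\<in>P. (if B \<in> U then real n else real (Max B)) - real (Min B) + 1) + card U"
    unfolding sum.distrib using U D(1) by (simp add: sum.If_cases Int_absorb1)
  finally have s: "(\<Sum>B\<in>P. (if B \<in> U then real (Suc n) else real (Max B)) - real (Min B) + 1) =
     (\<Sum>B\<in>P. (if B \<in> U then real n else real (Max B)) - real (Min B) + 1) + card U" .
  have s': "(\<Sum>B\<in>P. (if B \<in> insert {Suc n} U then real (Suc n) else real (Max B)) - real (Min B) + 1)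
     = (\<Sum>B\<in>P. (if B \<in> U then real (Suc n) else real (Max B)) - real (Min B) + 1)"
    using nin by (intro sum.cong) auto
  show "partial_dim (Suc n) (insert {Suc n} P) U = partial_dim n P U + card U"
    unfolding partial_dim_def using nin nU D(1) s by simp
  show "partial_dim (Suc n) (insert {Suc n} P) (insert {Suc n} U) = partial_dim n P U + card U"
    unfolding partial_dim_def using nin D(1) s s' by simp
qed

text \<open>A block that receives an element must have been open, hence \<open>insert B U\<close> on
  the right. Its own gain of 1 cancels against the subtracted \<open>n + 1\<close>; the other
  \<open>card U\<close> open blocks gain 1 each.\<close>

lemma partial_dim_extend:
  assumes P: "P \<in> set_partitions n" and B: "B \<in> P" and U: "U \<subseteq> P - {B}"
  defines "C \<equiv> insert (Suc n) B"
  shows "partial_dim (Suc n) (insert C (P - {B})) U = partial_dim n P (insert B U) + card U"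
    and "partial_dim (Suc n) (insert C (P - {B})) (insert C U) = partial_dim n P (insert B U) + card U"
proof -
  note D = set_partitionsD[OF P]
  let ?Q = "P - {B}"
  have BD: "B \<noteq> {}" "finite B" "B \<subseteq> {1..n}" using D(2)[OF B] by auto
  have "C \<notin> P" using D(2)[of C] by (auto simp: C_def)
  then have nin: "C \<notin> ?Q" and nU: "C \<notin> U" using U by auto
  have Min: "Min C = Min B"
  proof -
    have "Min B \<in> B" using BD by simp
    then have "Min B \<le> Suc n" using subsetD[OF BD(3)] by fastforce
    then show ?thesis unfolding C_def using BD by (simp add: Min_insert min_absorb2)
  qed
  have Max: "Max C = Suc n"
  proof -
    have "Max B \<in> B" using BD by simp
    then have "Max B \<le> Suc n" using subsetD[OF BD(3)] by fastforce
    then show ?thesis unfolding C_def using BD by (simp add: Max_insert max_absorb1)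
  qed
  have "(\<Sum>D\<in>?Q. (if D \<in> U then real (Suc n) else real (Max D)) - real (Min D) + 1)
      = (\<Sum>D\<in>?Q. ((if D \<in> insert B U then real n else real (Max D)) - real (Min D) + 1) + (if D \<in> U then 1 else 0))"
    by (intro sum.cong) auto
  also have "\<dots> = (\<Sum>D\<in>?Q. (if D \<in> insert B U then real n else real (Max D)) - real (Min D) + 1) + card U"
    unfolding sum.distrib using U D(1) by (simp add: sum.If_cases Int_absorb1)
  finally have s: "(\<Sum>D\<in>?Q. (if D \<in> U then real (Suc n) else real (Max D)) - real (Min D) + 1) =
     (\<Sum>D\<in>?Q. (if D \<in> insert B U then real n else real (Max D)) - real (Min D) + 1) + card U" .
  have s': "(\<Sum>D\<in>?Q. (if D \<in> insert C U then real (Suc n) else real (Max D)) - real (Min D) + 1)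
     = (\<Sum>D\<in>?Q. (if D \<in> U then real (Suc n) else real (Max D)) - real (Min D) + 1)"
    using nin by (intro sum.cong) auto
  have p: "partial_dim n P (insert B U) = real n - real (Min B) + 1 +
     (\<Sum>D\<in>?Q. (if D \<in> insert B U then real n else real (Max D)) - real (Min D) + 1) - real n"
    unfolding partial_dim_def using B D(1) by (subst sum.remove[of P B]) auto
  show "partial_dim (Suc n) (insert C ?Q) U = partial_dim n P (insert B U) + card U"
    unfolding p unfolding partial_dim_def using nin nU D(1) s Min Max by simp
  show "partial_dim (Suc n) (insert C ?Q) (insert C U) = partial_dim n P (insert B U) + card U"
    unfolding p unfolding partial_dim_def using nin nU D(1) s s' Min Max
    by simp
qed

lemma open_sum_0: "open_sum 0 f = f 0 0"
  by (simp add: open_sum_def set_partitions_def partition_on_empty partial_dim_def)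

text \<open>The new element starts a block, closed at once or left open, or it extends one of the
  \<open>j\<close> open blocks, which is then closed or stays open. At \<open>j = 0\<close> the
  factor \<open>real j\<close> makes the truncated \<open>j - 1\<close> harmless.\<close>

lemma open_sum_Suc:
  "open_sum (Suc n) f = open_sum n (\<lambda>d j. f (d + j) j + f (d + j) (Suc j)
      + real j * (f (d + j - 1) (j - 1) + f (d + j - 1) j))"
proof -
  let ?a = "Suc n"
  let ?F = "\<lambda>Q. \<Sum>U\<in>Pow Q. f (partial_dim ?a Q U) (card U)"
  have eq: "{1..?a} = insert ?a {1..n}" by auto
  have "open_sum ?a f = (\<Sum>Q | partition_on (insert ?a {1..n}) Q. ?F Q)"
    unfolding open_sum_def set_partitions_def eq ..
  also have "\<dots> = (\<Sum>P | partition_on {1..n} P. ?F (insert {?a} P) +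
      (\<Sum>B\<in>P. ?F (insert (insert ?a B) (P - {B}))))"
    by (rule sum_partition_on_insert_point) auto
  also have "\<dots> = (\<Sum>P\<in>set_partitions n. ?F (insert {?a} P) +
      (\<Sum>B\<in>P. ?F (insert (insert ?a B) (P - {B}))))"
    by (simp add: set_partitions_def)
  also have "\<dots> = open_sum n (\<lambda>d j. f (d + j) j + f (d + j) (Suc j)
      + real j * (f (d + j - 1) (j - 1) + f (d + j - 1) j))"
    unfolding open_sum_def
  proof (rule sum.cong[OF refl])
    fix P assume P: "P \<in> set_partitions n"
    note D = set_partitionsD[OF P]
    have nin: "{?a} \<notin> P" using D(2)[of "{?a}"] by auto
    have finU: "finite U" if "U \<subseteq> P" for U using that D(1) finite_subset by blast
    have 1: "?F (insert {?a} P) = (\<Sum>U\<in>Pow P. f (partial_dim n P U + card U) (card U)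
        + f (partial_dim n P U + card U) (Suc (card U)))"
      using D(1) nin finU
      by (subst sum_Pow_insert) (auto intro!: sum.cong simp: partial_dim_singleton[OF P] card_insert_if)
    have 2: "?F (insert (insert ?a B) (P - {B})) =
      (\<Sum>U\<in>Pow (P - {B}). f (partial_dim n P (insert B U) + card U) (card U)
        + f (partial_dim n P (insert B U) + card U) (Suc (card U)))" if B: "B \<in> P" for B
    proof -
      have C: "insert ?a B \<notin> P" using D(2)[of "insert ?a B"] by auto
      have "insert ?a B \<notin> U \<and> finite U" if "U \<subseteq> P - {B}" for U using that C finU by blast
      then show ?thesis using D(1) C
        by (subst sum_Pow_insert)
           (auto intro!: sum.cong simp: partial_dim_extend[OF P B] card_insert_if)
    qed
    have "(\<Sum>B\<in>P. ?F (insert (insert ?a B) (P - {B}))) =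
      (\<Sum>U\<in>Pow P. \<Sum>B\<in>U. f (partial_dim n P (insert B (U - {B})) + card (U - {B})) (card (U - {B}))
        + f (partial_dim n P (insert B (U - {B})) + card (U - {B})) (Suc (card (U - {B}))))"
      using sum_Pow_remove[OF D(1), of "\<lambda>B U. f (partial_dim n P (insert B U) + card U) (card U)
        + f (partial_dim n P (insert B U) + card U) (Suc (card U))"] by (simp add: 2)
    also have "\<dots> = (\<Sum>U\<in>Pow P. real (card U) *
        (f (partial_dim n P U + card U - 1) (card U - 1) + f (partial_dim n P U + card U - 1) (card U)))"
    proof (rule sum.cong[OF refl])
      fix U assume "U \<in> Pow P"
      then have fU: "finite U" using finU by auto
      have "(\<Sum>B\<in>U. f (partial_dim n P (insert B (U - {B})) + card (U - {B})) (card (U - {B}))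
        + f (partial_dim n P (insert B (U - {B})) + card (U - {B})) (Suc (card (U - {B})))) =
        (\<Sum>B\<in>U. f (partial_dim n P U + card U - 1) (card U - 1) + f (partial_dim n P U + card U - 1) (card U))"
      proof (rule sum.cong[OF refl])
        fix B assume B: "B \<in> U"
        then have "card U \<ge> 1" using fU by (metis One_nat_def Suc_leI card_gt_0_iff empty_iff)
        then have "real (card (U - {B})) = real (card U) - 1" "Suc (card (U - {B})) = card U"
          "card (U - {B}) = card U - 1" using B fU by (auto simp: of_nat_diff)
        moreover have "insert B (U - {B}) = U" using B by auto
        ultimately show "f (partial_dim n P (insert B (U - {B})) + card (U - {B})) (card (U - {B}))
        + f (partial_dim n P (insert B (U - {B})) + card (U - {B})) (Suc (card (U - {B}))) =
          f (partial_dim n P U + card U - 1) (card U - 1) + f (partial_dim n P U + card U - 1) (card U)"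
          by (simp add: algebra_simps)
      qed
      then show "(\<Sum>B\<in>U. f (partial_dim n P (insert B (U - {B})) + card (U - {B})) (card (U - {B}))
        + f (partial_dim n P (insert B (U - {B})) + card (U - {B})) (Suc (card (U - {B})))) =
        real (card U) *
        (f (partial_dim n P U + card U - 1) (card U - 1) + f (partial_dim n P U + card U - 1) (card U))"
        by simp
    qed
    finally show "?F (insert {?a} P) + (\<Sum>B\<in>P. ?F (insert (insert ?a B) (P - {B}))) =
      (\<Sum>U\<in>Pow P. f (partial_dim n P U + card U) (card U) + f (partial_dim n P U + card U) (Suc (card U))
      + real (card U) * (f (partial_dim n P U + card U - 1) (card U - 1)
        + f (partial_dim n P U + card U - 1) (card U)))"
      unfolding 1 by (simp add: sum.distrib)
  qed
  finally show ?thesis .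
qed

lemma sum_dim_exponent:
  "(\<Sum>P\<in>set_partitions n. g (real_of_int (dim_exponent n P))) =
    open_sum n (\<lambda>d j. if j = 0 then g d else 0)"
  unfolding open_sum_def
proof (rule sum.cong[OF refl])
  fix P assume P: "P \<in> set_partitions n"
  note D = set_partitionsD[OF P]
  have "(\<Sum>U\<in>Pow P. if card U = 0 then g (partial_dim n P U) else 0) =
     (\<Sum>U\<in>Pow P. if U = {} then g (partial_dim n P {}) else 0)"
    using D(1) by (intro sum.cong) (auto dest: finite_subset)
  also have "\<dots> = g (partial_dim n P {})" using D(1) by (simp add: sum.delta)
  also have "partial_dim n P {} = real_of_int (dim_exponent n P)"
    by (simp add: partial_dim_def dim_exponent_def)
  finally show "g (real_of_int (dim_exponent n P)) =
    (\<Sum>U\<in>Pow P. if card U = 0 then g (partial_dim n P U) else 0)" by simp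
qed

section \<open>Charlier transforms of the moments\<close>

text \<open>Charlier polynomials of parameter 1. Replacing the number \<open>j\<close> of open blocks by
  \<open>charlier j k\<close> turns the transition rule of \<open>open_sum\<close> into a difference equation in \<open>k\<close>, because
  multiplication by \<open>j\<close> becomes \<open>charlier_op\<close>; summing against \<open>1 / k!\<close> then selects \<open>j = 0\<close>.\<close>

fun charlier :: "nat \<Rightarrow> real \<Rightarrow> real" where
  "charlier 0 k = 1"
| "charlier (Suc j) k = k * charlier j (k - 1) - charlier j k"

lemma charlier_plus1: "charlier j (k + 1) = charlier j k + real j * charlier (j - 1) k"
proof (induction j arbitrary: k)
  case (Suc j)
  have "k * (charlier j k - charlier j (k - 1)) = real j * (charlier j k + charlier (j - 1) k)"
    using Suc[of "k - 1"] by (cases j) (simp_all add: algebra_simps)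
  then show ?case using Suc[of k] by (simp add: algebra_simps)
qed simp

text \<open>The negative generator of the birth and death process with birth rate 1 and death rate
  \<open>x\<close>; its stationary law is the Poisson law with mean 1, for which the Charlier
  polynomials are orthogonal.\<close>

definition charlier_op :: "(real \<Rightarrow> real) \<Rightarrow> real \<Rightarrow> real" where
  "charlier_op f x = x * (f x - f (x - 1)) - (f (x + 1) - f x)"

lemma charlier_op_charlier: "charlier_op (charlier j) k = real j * charlier j k"
  using charlier_plus1[of j k] charlier_plus1[of j "k - 1"]
  by (cases j) (simp_all add: charlier_op_def algebra_simps)

lemma charlier_op_cmult: "charlier_op (\<lambda>x. a * f x) k = a * charlier_op f k"
  by (simp add: charlier_op_def algebra_simps)

lemma charlier_op_add: "charlier_op (\<lambda>x. f x + g x) k = charlier_op f k + charlier_op g k"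
  by (simp add: charlier_op_def algebra_simps)

lemma open_sum_add: "open_sum n (\<lambda>d j. f d j + g d j) = open_sum n f + open_sum n g"
  by (simp add: open_sum_def sum.distrib)

lemma open_sum_cmult: "open_sum n (\<lambda>d j. a * f d j) = a * open_sum n f"
  by (simp add: open_sum_def sum_distrib_left)

lemma open_sum_diff: "open_sum n (\<lambda>d j. f d j - g d j) = open_sum n f - open_sum n g"
  by (simp add: open_sum_def sum_subtractf)

lemma open_sum_sum: "open_sum n (\<lambda>d j. \<Sum>i\<in>I. f i d j) = (\<Sum>i\<in>I. open_sum n (f i))"
  by (induction I rule: infinite_finite_induct) (simp_all add: open_sum_add, simp_all add: open_sum_def)

lemma charlier_op_open_sum:
  "charlier_op (\<lambda>x. open_sum n (\<lambda>d j. f d j x)) k = open_sum n (\<lambda>d j. charlier_op (f d j) k)"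
  by (simp add: charlier_op_def open_sum_diff open_sum_cmult)

definition charlier_moment :: "nat \<Rightarrow> nat \<Rightarrow> real \<Rightarrow> real" where
  "charlier_moment i n k = open_sum n (\<lambda>d j. d ^ i * charlier j k)"

text \<open>By \<open>charlier_plus1\<close> the shifted argument splits \<open>charlier j\<close>
  into eigenfunctions with eigenvalues \<open>j\<close> and \<open>j - 1\<close>, which each
  application of the operator multiplies by these numbers.\<close>

lemma charlier_op_pow_moment:
  "(charlier_op ^^ m) (\<lambda>x. charlier_moment i n (x + 1)) k =
    open_sum n (\<lambda>d j. d ^ i * (real j ^ m * charlier j k + real j * (real j - 1) ^ m * charlier (j - 1) k))"
proof (induction m arbitrary: k)
  case 0
  then show ?case by (simp add: charlier_moment_def charlier_plus1)
next
  case (Suc m)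
  have *: "real j * ((real j - 1) ^ m * (real (j - 1) * charlier (j - 1) k)) =
      real j * (real j - 1) ^ Suc m * charlier (j - 1) k" for j
    by (cases j) simp_all
  have "(charlier_op ^^ Suc m) (\<lambda>x. charlier_moment i n (x + 1)) k =
    charlier_op (\<lambda>k. open_sum n (\<lambda>d j. d ^ i *
      (real j ^ m * charlier j k + real j * (real j - 1) ^ m * charlier (j - 1) k))) k"
    by (simp only: Suc[THEN ext] funpow.simps o_apply)
  also have "\<dots> = open_sum n (\<lambda>d j. d ^ i * (real j ^ m * (real j * charlier j k) +
      real j * ((real j - 1) ^ m * (real (j - 1) * charlier (j - 1) k))))"
    unfolding charlier_op_open_sum
    by (simp only: charlier_op_cmult charlier_op_add charlier_op_charlier mult.assoc)
  also have "\<dots> = open_sum n (\<lambda>d j. d ^ i *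
      (real j ^ Suc m * charlier j k + real j * (real j - 1) ^ Suc m * charlier (j - 1) k))"
    unfolding * by (simp add: mult_ac)
  finally show ?case .
qed

text \<open>The recursion \<open>charlier j k + charlier (Suc j) k = k * charlier j (k - 1)\<close>
  merges the closed and the open alternative of each transition. The powers of \<open>j\<close> in
  the binomial expansion of the new statistic become powers of \<open>charlier_op\<close>.\<close>

lemma charlier_moment_Suc:
  "charlier_moment i (Suc n) k =
    k * (\<Sum>m\<le>i. real (i choose m) *
      (charlier_op ^^ m) (\<lambda>x. charlier_moment (i - m) n (x + 1)) (k - 1))"
proof -
  have *: "(d + real j) ^ i * charlier j k + (d + real j) ^ i * charlier (Suc j) k
      + real j * ((d + real j - 1) ^ i * charlier (j - 1) k + (d + real j - 1) ^ i * charlier j k)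
    = k * (\<Sum>m\<le>i. real (i choose m) * (d ^ (i - m) *
        (real j ^ m * charlier j (k - 1) + real j * (real j - 1) ^ m * charlier (j - 1) (k - 1))))"
    for d j
  proof -
    have "(d + real j) ^ i * charlier j k + (d + real j) ^ i * charlier (Suc j) k
      + real j * ((d + real j - 1) ^ i * charlier (j - 1) k + (d + real j - 1) ^ i * charlier j k)
      = (d + real j) ^ i * (k * charlier j (k - 1)) +
        real j * (d + (real j - 1)) ^ i * (k * charlier (j - 1) (k - 1))"
      by (cases j) (simp_all add: algebra_simps)
    moreover have b1: "(d + real j) ^ i = (\<Sum>m\<le>i. real (i choose m) * real j ^ m * d ^ (i - m))"
      using binomial_ring[of "real j" d i] by (simp add: add.commute)
    moreover have b2: "(d + (real j - 1)) ^ i = (\<Sum>m\<le>i. real (i choose m) * (real j - 1) ^ m * d ^ (i - m))"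
      using binomial_ring[of "real j - 1" d i] by (simp only: add.commute)
    moreover have "(\<Sum>m\<le>i. real (i choose m) * real j ^ m * d ^ (i - m)) * (k * charlier j (k - 1)) +
        real j * (\<Sum>m\<le>i. real (i choose m) * (real j - 1) ^ m * d ^ (i - m)) * (k * charlier (j - 1) (k - 1))
      = k * (\<Sum>m\<le>i. real (i choose m) * (d ^ (i - m) *
        (real j ^ m * charlier j (k - 1) + real j * (real j - 1) ^ m * charlier (j - 1) (k - 1))))"
      unfolding sum_distrib_left sum_distrib_right sum.distrib[symmetric]
      by (intro sum.cong refl) (simp only: algebra_simps)
    ultimately show ?thesis by (simp only:)
  qed
  show ?thesis
    unfolding charlier_moment_def[of i "Suc n"] open_sum_Suc * open_sum_cmult open_sum_sum
      charlier_op_pow_moment ..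
qed

lemma charlier_moment_0_index: "charlier_moment i 0 k = 0 ^ i"
  by (simp add: charlier_moment_def open_sum_0)

lemma charlier_op_shift_1:
  "charlier_op (\<lambda>x. f (x + 1)) (k - 1) = (k - 1) * (f k - f (k - 1)) - (f (k + 1) - f k)"
  by (simp add: charlier_op_def)

lemma charlier_op_shift_2:
  "charlier_op (charlier_op (\<lambda>x. f (x + 1))) (k - 1) =
     (k - 1) * ((k - 1) * (f k - f (k - 1)) - (f (k + 1) - f k)
        - ((k - 2) * (f (k - 1) - f (k - 2)) - (f k - f (k - 1))))
     - (k * (f (k + 1) - f k) - (f (k + 2) - f (k + 1))
        - ((k - 1) * (f k - f (k - 1)) - (f (k + 1) - f k)))"
  by (simp add: charlier_op_def add.commute)

lemma charlier_op_shift_3: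
  "charlier_op (charlier_op (charlier_op (\<lambda>x. f (x + 1)))) (k - 1) =
     (k - 1) * (charlier_op (charlier_op (\<lambda>x. f (x + 1))) (k - 1)
        - charlier_op (charlier_op (\<lambda>x. f (x + 1))) (k - 1 - 1))
     - (charlier_op (charlier_op (\<lambda>x. f (x + 1))) (k + 1 - 1)
        - charlier_op (charlier_op (\<lambda>x. f (x + 1))) (k - 1))"
  by (subst charlier_op_def) simp

lemma charlier_moment_0: "charlier_moment 0 n k = k ^ n"
  by (induction n) (simp_all add: charlier_moment_0_index charlier_moment_Suc)

text \<open>The closed forms solve the recurrence \<open>charlier_moment_Suc\<close>: its inhomogeneity is a combination
  of powers \<open>(k + a) ^ n\<close> with coefficients polynomial in \<open>n\<close> and \<open>k\<close>.\<close>

lemma charlier_moment_1: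
  "charlier_moment 1 n k =
     (k^2 - k) * (k - 1) ^ n
     + (real n*k - k^2 + 2*k) * k ^ n
     + (- 1*k) * (k + 1) ^ n"
proof (induction n arbitrary: k)
  case 0
  show ?case by (simp add: charlier_moment_0_index)
next
  case (Suc n)
  have "charlier_moment 1 (Suc n) k = k * (charlier_moment 1 n k
     + charlier_op (\<lambda>x. (x + 1) ^ n) (k - 1))"
    by (subst charlier_moment_Suc) (simp add: charlier_moment_0 atMost_Suc)
  also have "charlier_op (\<lambda>x. (x + 1) ^ n) (k - 1) =
    (k - 1) * (k ^ n - (k - 1) ^ n) - ((k + 1) ^ n - k ^ n)"
    by (rule charlier_op_shift_1)
  finally show ?case unfolding Suc by (simp add: algebra_simps power2_eq_square)
qed

lemma charlier_moment_2:
  "charlier_moment 2 n k =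
     (k^4 - 9/2*k^3 + 13/2*k^2 - 3*k) * (k - 2) ^ n
     + (2*real n*k^3 - 4*real n*k^2 + 2*real n*k - 2*k^4 + 8*k^3 - 11*k^2 + 5*k) * (k - 1) ^ n
     + (real n^2*k^2 - 2*real n*k^3 + 4*real n*k^2 - 4*real n*k + real n + k^4 - 11/2*k^3 + 3/2*k^2
     - 5/2*k) * k ^ n
     + (- 2*real n*k^2 - 2*real n*k + 2*k^3 + 2*k^2 - k) * (k + 1) ^ n
     + (k^2 + 3/2*k) * (k + 2) ^ n"
proof (induction n arbitrary: k)
  case 0
  show ?case by (simp add: charlier_moment_0_index algebra_simps)
next
  case (Suc n)
  have shifts: "k - 1 + 1 = k" "k - 1 - 1 = k - 2" "k + 1 - 1 = k" "k + 1 + 1 = k + 2" by simp_all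
  \<comment> \<open>With the shifts normalised, the powers act as indeterminates and the induction
    step is a polynomial identity in \<open>k\<close>, \<open>N\<close> and them.\<close>
  define p0 p1 p2 q1 q2 N where p_defs: "p0 = k ^ n" "p1 = (k + 1) ^ n" "p2 = (k + 2) ^ n"
    "q1 = (k - 1) ^ n" "q2 = (k - 2) ^ n" "N = real n"
  have "charlier_moment 2 (Suc n) k = k * (charlier_moment 2 n k
     + 2 * charlier_op (\<lambda>x. charlier_moment 1 n (x + 1)) (k - 1)
     + charlier_op (charlier_op (\<lambda>x. (x + 1) ^ n)) (k - 1))"
    by (subst charlier_moment_Suc) (simp add: charlier_moment_0 atMost_Suc numeral_2_eq_2)
  also have "charlier_op (charlier_op (\<lambda>x. (x + 1) ^ n)) (k - 1) =
     (k - 1) * ((k - 1) * (k ^ n - (k - 1) ^ n) - ((k + 1) ^ n - k ^ n)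
        - ((k - 2) * ((k - 1) ^ n - (k - 2) ^ n) - (k ^ n - (k - 1) ^ n)))
     - (k * ((k + 1) ^ n - k ^ n) - ((k + 2) ^ n - (k + 1) ^ n)
        - ((k - 1) * (k ^ n - (k - 1) ^ n) - ((k + 1) ^ n - k ^ n)))"
    by (rule charlier_op_shift_2)
  also have "charlier_op (\<lambda>x. charlier_moment 1 n (x + 1)) (k - 1) =
    (k - 1) * (charlier_moment 1 n k - charlier_moment 1 n (k - 1))
      - (charlier_moment 1 n (k + 1) - charlier_moment 1 n k)"
    by (rule charlier_op_shift_1)
  finally show ?case
    unfolding Suc charlier_moment_1 power_Suc of_nat_Suc shifts p_defs[symmetric] by algebra
qed

lemma charlier_moment_3:
  "charlier_moment 3 n k =
     (k^6 - 21/2*k^5 + 257/6*k^4 - 169/2*k^3 + 481/6*k^2 - 29*k) * (k - 3) ^ n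
     + (3*real n*k^5 - 39/2*real n*k^4 + 93/2*real n*k^3 - 48*real n*k^2 + 18*real n*k - 3*k^6 +
     51/2*k^5 - 90*k^4 + 162*k^3 - 291/2*k^2 + 51*k) * (k - 2) ^ n
     + (3*real n^2*k^4 - 9*real n^2*k^3 + 9*real n^2*k^2 - 3*real n^2*k - 6*real n*k^5 + 30*real
     n*k^4 - 69*real n*k^3 + 75*real n*k^2 - 30*real n*k + 3*k^6 - 45/2*k^5 + 57*k^4 - 72*k^3 +
     52*k^2 - 35/2*k) * (k - 1) ^ n
     + (real n^3*k^3 - 3*real n^2*k^4 + 6*real n^2*k^3 - 12*real n^2*k^2 + 3*real n^2*k + 3*real
     n*k^5 - 33/2*real n*k^4 + 33/2*real n*k^3 - 33/2*real n*k^2 + real n - k^6 + 21/2*k^5 -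
     7/3*k^4 + 9/2*k^3 + 58/3*k^2 - 19/6*k) * k ^ n
     + (- 3*real n^2*k^3 - 6*real n^2*k^2 - 3*real n^2*k + 6*real n*k^4 + 12*real n*k^3 + 15*real
     n*k^2 + 6*real n*k - 3*k^5 - 9/2*k^4 + 15/2*k^3 + 24*k^2 + 14*k) * (k + 1) ^ n
     + (3*real n*k^3 + 21/2*real n*k^2 + 9*real n*k - 3*k^4 - 33/2*k^3 - 51/2*k^2 - 21/2*k) * (k + 2) ^ n
     + (- 1*k^3 - 9/2*k^2 - 29/6*k) * (k + 3) ^ n"
proof (induction n arbitrary: k)
  case 0
  show ?case by (simp add: charlier_moment_0_index algebra_simps)
next
  case (Suc n)
  have shifts: "k - 1 + 1 = k" "k - 1 - 1 = k - 2" "k + 1 - 1 = k" "k + 1 + 1 = k + 2"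
     "k - 2 - 1 = k - 3" "k - 2 + 1 = k - 1" "k + 2 + 1 = k + 3" "k + 2 - 1 = k + 1"
     "k - 1 - 2 = k - 3" "k - 1 + 2 = k + 1" "k + 1 - 2 = k - 1" "k + 1 + 2 = k + 3"  by simp_all
  define p0 p1 p2 q1 q2 p3 q3 N where p_defs: "p0 = k ^ n" "p1 = (k + 1) ^ n" "p2 = (k + 2) ^ n"
    "q1 = (k - 1) ^ n" "q2 = (k - 2) ^ n" "p3 = (k + 3) ^ n" "q3 = (k - 3) ^ n" "N = real n"
  have "charlier_moment 3 (Suc n) k = k * (charlier_moment 3 n k
     + 3 * charlier_op (\<lambda>x. charlier_moment 2 n (x + 1)) (k - 1)
     + 3 * charlier_op (charlier_op (\<lambda>x. charlier_moment 1 n (x + 1))) (k - 1)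
     + charlier_op (charlier_op (charlier_op (\<lambda>x. charlier_moment 0 n (x + 1)))) (k - 1))"
    by (subst charlier_moment_Suc) (simp add: atMost_Suc numeral_3_eq_3 numeral_2_eq_2)
  \<comment> \<open>Each contribution is first collected by the powers with bases
    \<open>k - 3\<close> to \<open>k + 3\<close>, so that the final comparison is linear in these
    powers.\<close>
  also have "charlier_op (\<lambda>x. charlier_moment 2 n (x + 1)) (k - 1) =
     (- 1*k^5 + 19/2*k^4 - 69/2*k^3 + 119/2*k^2 - 97/2*k + 15) * q3
     + (- 2*N*k^4 + 12*N*k^3 - 26*N*k^2 + 24*N*k - 8*N + 3*k^5 - 45/2*k^4 + 139/2*k^3 - 109*k^2 +
     85*k - 26) * q2
     + (- 1*N^2*k^3 + 3*N^2*k^2 - 3*N^2*k + N^2 + 4*N*k^4 - 16*N*k^3 + 30*N*k^2 - 29*N*k + 11*N -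
     3*k^5 + 35/2*k^4 - 44*k^3 + 56*k^2 - 37*k + 21/2) * q1
     + (N^2*k^3 - 2*N*k^4 + 4*N*k^3 - 10*N*k^2 + 3*N*k + k^5 - 11/2*k^4 + 15/2*k^3 - 17/2*k^2 + k +
     1) * p0
     + (- 1*N^2*k^2 - 2*N^2*k - N^2 + 2*N*k + N + k^4 + 5/2*k^3 + 19/2*k^2 + 12*k + 5) * p1
     + (2*N*k^2 + 6*N*k + 4*N - k^3 - 13/2*k^2 - 9*k - 3) * p2
     + (- 1*k^2 - 7/2*k - 5/2) * p3"
    unfolding charlier_op_shift_1 unfolding charlier_moment_2 shifts p_defs[symmetric] by algebra
  also have "charlier_op (charlier_op (\<lambda>x. charlier_moment 1 n (x + 1))) (k - 1) =
     (k^4 - 8*k^3 + 23*k^2 - 28*k + 12) * q3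
     + (N*k^3 - 5*N*k^2 + 8*N*k - 4*N - 3*k^4 + 18*k^3 - 42*k^2 + 45*k - 18) * q2
     + (- 2*N*k^3 + 5*N*k^2 - 4*N*k + N + 3*k^4 - 11*k^3 + 21*k^2 - 20*k + 7) * q1
     + (N*k^3 + 2*N*k^2 - N*k - k^4 - 3*k^2 + k - 1) * p0
     + (- 2*N*k^2 - 3*N*k - N + k^3 + 2*k + 1) * p1
     + (N*k + 2*N + k^2 + k + 1) * p2
     + (- 1*k - 2) * p3"
    unfolding charlier_op_shift_2 unfolding charlier_moment_1 shifts p_defs[symmetric] by algebra
  also have "charlier_op (charlier_op (charlier_op (\<lambda>x. charlier_moment 0 n (x + 1)))) (k - 1) =
     (- 1*k^3 + 6*k^2 - 11*k + 6) * q3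
     + (3*k^3 - 12*k^2 + 15*k - 6) * q2
     + (- 3*k^3 + 3*k^2 + 2*k - 2) * q1
     + (k^3 + 6*k^2 - 3*k + 1) * p0
     + (- 3*k^2 - 6*k - 1) * p1
     + (3*k + 3) * p2
     + (- 1) * p3"
    unfolding charlier_op_shift_3 unfolding charlier_op_shift_2 unfolding charlier_moment_0 shifts p_defs[symmetric] by algebra
  finally show ?case
    unfolding Suc power_Suc of_nat_Suc p_defs[symmetric] by algebra
qed

section \<open>The Dobinski functional and exact moments\<close>

definition poly_bounded :: "(real \<Rightarrow> real) \<Rightarrow> bool" where
  "poly_bounded f \<longleftrightarrow> (\<exists>C p. \<forall>x. \<bar>f x\<bar> \<le> C * (1 + \<bar>x\<bar>) ^ p)"

lemma poly_boundedI: "(\<And>x. \<bar>f x\<bar> \<le> C * (1 + \<bar>x\<bar>) ^ p) \<Longrightarrow> poly_bounded f"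
  by (auto simp: poly_bounded_def)

lemma poly_bounded_le:
  assumes "poly_bounded g" "\<And>x. \<bar>f x\<bar> \<le> \<bar>g x\<bar>"
  shows "poly_bounded f"
  using assms unfolding poly_bounded_def by (meson order_trans)

lemma poly_bounded_const: "poly_bounded (\<lambda>_. c)"
  by (rule poly_boundedI[of _ "\<bar>c\<bar>" 0]) simp

lemma poly_bounded_ident: "poly_bounded (\<lambda>x. x)"
  by (rule poly_boundedI[of _ 1 1]) simp

lemma poly_boundedE:
  assumes "poly_bounded f"
  obtains C p where "C \<ge> 0" "\<And>x. \<bar>f x\<bar> \<le> C * (1 + \<bar>x\<bar>) ^ p"
proof -
  from assms obtain C p where C: "\<And>x. \<bar>f x\<bar> \<le> C * (1 + \<bar>x\<bar>) ^ p" by (auto simp: poly_bounded_def)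
  have "0 \<le> C" using C[of 0] by simp
  with C that show ?thesis by blast
qed

lemma poly_bounded_add:
  assumes "poly_bounded f" "poly_bounded g" shows "poly_bounded (\<lambda>x. f x + g x)"
proof -
  obtain C p where C: "C \<ge> 0" "\<And>x. \<bar>f x\<bar> \<le> C * (1 + \<bar>x\<bar>) ^ p" using poly_boundedE[OF assms(1)] by blast
  obtain D q where D: "D \<ge> 0" "\<And>x. \<bar>g x\<bar> \<le> D * (1 + \<bar>x\<bar>) ^ q" using poly_boundedE[OF assms(2)] by blast
  show ?thesis
  proof (rule poly_boundedI)
    fix x :: real
    have "C * (1 + \<bar>x\<bar>) ^ p \<le> C * (1 + \<bar>x\<bar>) ^ (p + q)" "D * (1 + \<bar>x\<bar>) ^ q \<le> D * (1 + \<bar>x\<bar>) ^ (p + q)"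
      using C(1) D(1) by (auto intro!: mult_left_mono power_increasing)
    then show "\<bar>f x + g x\<bar> \<le> (C + D) * (1 + \<bar>x\<bar>) ^ (p + q)"
      using C(2)[of x] D(2)[of x] abs_triangle_ineq[of "f x" "g x"] by (simp add: distrib_right)
  qed
qed

lemma poly_bounded_mult:
  assumes "poly_bounded f" "poly_bounded g" shows "poly_bounded (\<lambda>x. f x * g x)"
proof -
  obtain C p where C: "C \<ge> 0" "\<And>x. \<bar>f x\<bar> \<le> C * (1 + \<bar>x\<bar>) ^ p" using poly_boundedE[OF assms(1)] by blast
  obtain D q where D: "D \<ge> 0" "\<And>x. \<bar>g x\<bar> \<le> D * (1 + \<bar>x\<bar>) ^ q" using poly_boundedE[OF assms(2)] by blast
  show ?thesis
  proof (rule poly_boundedI)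
    fix x :: real
    have "\<bar>f x\<bar> * \<bar>g x\<bar> \<le> (C * (1 + \<bar>x\<bar>) ^ p) * (D * (1 + \<bar>x\<bar>) ^ q)"
      using C D by (intro mult_mono) auto
    then show "\<bar>f x * g x\<bar> \<le> (C * D) * (1 + \<bar>x\<bar>) ^ (p + q)"
      by (simp add: abs_mult power_add mult_ac)
  qed
qed

lemma poly_bounded_power: "poly_bounded f \<Longrightarrow> poly_bounded (\<lambda>x. f x ^ m)"
  by (induction m) (auto intro: poly_bounded_const poly_bounded_mult)

lemma poly_bounded_minus: "poly_bounded f \<Longrightarrow> poly_bounded (\<lambda>x. - f x)"
  by (simp add: poly_bounded_def)

lemma poly_bounded_diff: "poly_bounded f \<Longrightarrow> poly_bounded g \<Longrightarrow> poly_bounded (\<lambda>x. f x - g x)"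
  using poly_bounded_add[of f "\<lambda>x. - g x"] by (simp add: poly_bounded_minus)

lemma poly_bounded_abs: "poly_bounded f \<Longrightarrow> poly_bounded (\<lambda>x. \<bar>f x\<bar>)"
  by (simp add: poly_bounded_def)

lemma poly_bounded_divide: "poly_bounded f \<Longrightarrow> poly_bounded (\<lambda>x. f x / c)"
  using poly_bounded_mult[OF _ poly_bounded_const, of f "1 / c"] by simp

lemma poly_bounded_sum: "(\<And>i. i \<in> I \<Longrightarrow> poly_bounded (f i)) \<Longrightarrow> poly_bounded (\<lambda>x. \<Sum>i\<in>I. f i x)"
  by (induction I rule: infinite_finite_induct) (auto intro: poly_bounded_const poly_bounded_add)

lemmas poly_bounded_intros = poly_bounded_const poly_bounded_ident poly_bounded_add poly_bounded_mult poly_bounded_power poly_bounded_minus poly_bounded_diff poly_bounded_abs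
  poly_bounded_divide poly_bounded_sum

lemma poly_bounded_shift:
  assumes "poly_bounded f" shows "poly_bounded (\<lambda>x. f (x + a))"
proof -
  obtain C p where C: "C \<ge> 0" "\<And>x. \<bar>f x\<bar> \<le> C * (1 + \<bar>x\<bar>) ^ p" using poly_boundedE[OF assms] by blast
  have "\<bar>f (x + a)\<bar> \<le> \<bar>C * (1 + (\<bar>x\<bar> + \<bar>a\<bar>)) ^ p\<bar>" for x
  proof -
    have "C * (1 + \<bar>x + a\<bar>) ^ p \<le> C * (1 + (\<bar>x\<bar> + \<bar>a\<bar>)) ^ p"
      using C(1) by (intro mult_left_mono power_mono) auto
    then show ?thesis using C(2)[of "x + a"] by linarith
  qed
  then show ?thesis by (rule poly_bounded_le[rotated]) (intro poly_bounded_intros)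
qed

lemma poly_bounded_shift_minus: "poly_bounded f \<Longrightarrow> poly_bounded (\<lambda>x. f (x - a))"
  using poly_bounded_shift[of f "- a"] by simp

definition dobinski_sum :: "(real \<Rightarrow> real) \<Rightarrow> real" where
  "dobinski_sum f = (\<Sum>k. f (real k) / fact k)"

text \<open>As a single term of the exponential series, \<open>(1 + k) ^ p / fact p\<close> is below
  \<open>exp (1 + k)\<close>; the terms are thus dominated by a multiple of
  \<open>exp 1 ^ k / fact k\<close>.\<close>

lemma summable_dobinski_sum:
  assumes "poly_bounded f" shows "summable (\<lambda>k. f (real k) / fact k)"
proof -
  obtain C p where C: "C \<ge> 0" "\<And>x. \<bar>f x\<bar> \<le> C * (1 + \<bar>x\<bar>) ^ p" using poly_boundedE[OF assms] by blast
  have exp_bound: "(1 + real k) ^ p \<le> fact p * exp (1 + real k)" for k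
  proof -
    have "(\<lambda>m. (1 + real k) ^ m / fact m) sums exp (1 + real k)"
      using exp_converges[of "1 + real k"] by (simp add: divide_inverse mult.commute)
    then have "(1 + real k) ^ p / fact p \<le> exp (1 + real k)"
      by (metis (no_types, lifting) sum_le_suminf[of _ "{p}"] sums_iff finite.emptyI finite_insert
          divide_nonneg_nonneg zero_le_power add_nonneg_nonneg of_nat_0_le_iff zero_le_one
          fact_ge_zero sum.empty sum.insert empty_iff add_0_right)
    then show ?thesis by (simp add: divide_le_eq mult.commute)
  qed
  have "summable (\<lambda>k. C * fact p * exp 1 * (exp 1 ^ k / fact k) :: real)"
    using summable_exp[of "exp 1 :: real"] by (intro summable_mult) (simp add: divide_inverse mult.commute)
  then show ?thesis
  proof (rule summable_comparison_test')
    fix k :: nat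
    have "\<bar>f (real k)\<bar> \<le> C * (fact p * exp (1 + real k))"
      using C(2)[of "real k"] exp_bound[of k] C(1)
      by (smt (verit) mult_left_mono of_nat_0_le_iff abs_of_nonneg)
    then have "\<bar>f (real k)\<bar> / fact k \<le> C * (fact p * exp (1 + real k)) / fact k"
      by (intro divide_right_mono) auto
    also have "\<dots> = C * fact p * exp 1 * (exp 1 ^ k / fact k)"
      by (simp add: exp_add exp_of_nat_mult[symmetric])
    finally show "norm (f (real k) / fact k) \<le> C * fact p * exp 1 * (exp 1 ^ k / fact k)"
      by simp
  qed
qed

lemma dobinski_sum_cong: "(\<And>x. f x = g x) \<Longrightarrow> dobinski_sum f = dobinski_sum g"
  by (simp add: dobinski_sum_def)

lemma dobinski_sum_add: "poly_bounded f \<Longrightarrow> poly_bounded g \<Longrightarrow> dobinski_sum (\<lambda>x. f x + g x) = dobinski_sum f + dobinski_sum g"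
  unfolding dobinski_sum_def by (simp add: add_divide_distrib suminf_add summable_dobinski_sum)

lemma dobinski_sum_diff: "poly_bounded f \<Longrightarrow> poly_bounded g \<Longrightarrow> dobinski_sum (\<lambda>x. f x - g x) = dobinski_sum f - dobinski_sum g"
  unfolding dobinski_sum_def by (simp add: diff_divide_distrib suminf_diff summable_dobinski_sum)

lemma dobinski_sum_cmult: "poly_bounded f \<Longrightarrow> dobinski_sum (\<lambda>x. c * f x) = c * dobinski_sum f"
  unfolding dobinski_sum_def using suminf_mult[OF summable_dobinski_sum, of f c] by simp

lemma dobinski_sum_mono:
  assumes "poly_bounded f" "poly_bounded g" "\<And>k. f (real k) \<le> g (real k)"
  shows "dobinski_sum f \<le> dobinski_sum g"
  unfolding dobinski_sum_def using assms
  by (intro suminf_le summable_dobinski_sum divide_right_mono) auto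

lemma dobinski_sum_sum: "(\<And>i. i \<in> I \<Longrightarrow> poly_bounded (f i)) \<Longrightarrow> dobinski_sum (\<lambda>x. \<Sum>i\<in>I. f i x) = (\<Sum>i\<in>I. dobinski_sum (f i))"
proof (induction I rule: infinite_finite_induct)
  case (insert i I)
  then show ?case by (simp add: dobinski_sum_add poly_bounded_sum)
qed (simp_all add: dobinski_sum_def)

text \<open>Since \<open>k / k! = 1 / (k - 1)!\<close>, the index moves by one, and the term at
  \<open>k = 0\<close> vanishes. This is the Stein-Chen identity of the Poisson law with mean
  1.\<close>

lemma dobinski_sum_step:
  assumes "poly_bounded f" shows "dobinski_sum (\<lambda>x. x * f (x - 1)) = dobinski_sum f"
proof -
  have "poly_bounded (\<lambda>x. x * f (x - 1))" by (intro poly_bounded_intros poly_bounded_shift_minus assms)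
  from suminf_split_head[OF summable_dobinski_sum[OF this]]
  have "dobinski_sum (\<lambda>x. x * f (x - 1)) = (\<Sum>k. real (Suc k) * f (real (Suc k) - 1) / fact (Suc k))"
    by (simp add: dobinski_sum_def)
  also have "\<dots> = dobinski_sum f"
    unfolding dobinski_sum_def
  proof (rule suminf_cong)
    fix k :: nat
    have eq: "real (Suc k) - 1 = real k" by simp
    show "real (Suc k) * f (real (Suc k) - 1) / fact (Suc k) = f (real k) / fact k"
      unfolding eq by (simp del: of_nat_Suc)
  qed
  finally show ?thesis .
qed

text \<open>Index shifts bring every \<open>(x + a) ^ n\<close> to \<open>x ^ n\<close>. For
  negative \<open>a\<close> the coefficient has to contain the falling factorial that the shift
  consumes; for positive \<open>a\<close> the shift produces one.\<close>

lemma dobinski_sum_down1: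
  assumes "poly_bounded q" "\<And>x. p x = x * q (x - 1)"
  shows "dobinski_sum (\<lambda>x. p x * (x - 1) ^ n) = dobinski_sum (\<lambda>x. q x * x ^ n)"
  using dobinski_sum_step[of "\<lambda>x. q x * x ^ n"] assms by (simp add: poly_bounded_intros mult.assoc)

lemma dobinski_sum_down2:
  assumes "poly_bounded q" "\<And>x. p x = x * (x - 1) * q (x - 2)"
  shows "dobinski_sum (\<lambda>x. p x * (x - 2) ^ n) = dobinski_sum (\<lambda>x. q x * x ^ n)"
  using dobinski_sum_step[of "\<lambda>x. q x * x ^ n"] dobinski_sum_step[of "\<lambda>x. x * (q (x - 1) * (x - 1) ^ n)"] assms
  by (simp add: poly_bounded_intros poly_bounded_shift_minus mult.assoc)

lemma dobinski_sum_down3: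
  assumes "poly_bounded q" "\<And>x. p x = x * (x - 1) * (x - 2) * q (x - 3)"
  shows "dobinski_sum (\<lambda>x. p x * (x - 3) ^ n) = dobinski_sum (\<lambda>x. q x * x ^ n)"
  using dobinski_sum_step[of "\<lambda>x. q x * x ^ n"] dobinski_sum_step[of "\<lambda>x. x * (q (x - 1) * (x - 1) ^ n)"]
    dobinski_sum_step[of "\<lambda>x. x * ((x - 1) * (q (x - 2) * (x - 2) ^ n))"] assms
  by (simp add: poly_bounded_intros poly_bounded_shift_minus mult.assoc)

lemma dobinski_sum_up1:
  assumes "poly_bounded p" "\<And>x. q x = x * p (x - 1)"
  shows "dobinski_sum (\<lambda>x. p x * (x + 1) ^ n) = dobinski_sum (\<lambda>x. q x * x ^ n)"
  using dobinski_sum_step[of "\<lambda>x. p x * (x + 1) ^ n"] assms by (simp add: poly_bounded_intros mult.assoc)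

lemma dobinski_sum_up2:
  assumes "poly_bounded p" "\<And>x. q x = x * (x - 1) * p (x - 2)"
  shows "dobinski_sum (\<lambda>x. p x * (x + 2) ^ n) = dobinski_sum (\<lambda>x. q x * x ^ n)"
proof -
  have "dobinski_sum (\<lambda>x. p x * (x + 2) ^ n) = dobinski_sum (\<lambda>x. (x * p (x - 1)) * (x + 1) ^ n)"
    using dobinski_sum_step[of "\<lambda>x. p x * (x + 2) ^ n"] assms(1) by (simp add: poly_bounded_intros mult.assoc add.commute)
  also have "\<dots> = dobinski_sum (\<lambda>x. q x * x ^ n)"
    by (rule dobinski_sum_up1) (use assms in \<open>auto intro!: poly_bounded_intros poly_bounded_shift_minus\<close>)
  finally show ?thesis .
qed

lemma dobinski_sum_up3:
  assumes "poly_bounded p" "\<And>x. q x = x * (x - 1) * (x - 2) * p (x - 3)"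
  shows "dobinski_sum (\<lambda>x. p x * (x + 3) ^ n) = dobinski_sum (\<lambda>x. q x * x ^ n)"
proof -
  have "dobinski_sum (\<lambda>x. p x * (x + 3) ^ n) = dobinski_sum (\<lambda>x. (x * p (x - 1)) * (x + 2) ^ n)"
    using dobinski_sum_step[of "\<lambda>x. p x * (x + 3) ^ n"] assms(1) by (simp add: poly_bounded_intros mult.assoc add.commute)
  also have "\<dots> = dobinski_sum (\<lambda>x. q x * x ^ n)"
    by (rule dobinski_sum_up2) (use assms in \<open>auto intro!: poly_bounded_intros poly_bounded_shift_minus\<close>)
  finally show ?thesis .
qed

lemma poly_bounded_charlier: "poly_bounded (\<lambda>x. charlier j (x - a))"
proof (induction j arbitrary: a)
  case (Suc j)
  have "poly_bounded (\<lambda>x. charlier j (x - a - 1))" using Suc[of "a + 1"] by (simp add: algebra_simps)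
  then show ?case by (auto intro!: poly_bounded_intros Suc)
qed (simp add: poly_bounded_const)

text \<open>By \<open>dobinski_sum_step\<close> the two terms of the recursion have the same sum:
  Charlier polynomials of positive degree are orthogonal to constants.\<close>

lemma dobinski_sum_charlier: "dobinski_sum (charlier j) = (if j = 0 then exp 1 else 0)"
proof (cases j)
  case 0
  have "dobinski_sum (\<lambda>_. 1) = exp 1"
    unfolding dobinski_sum_def exp_def by (simp add: divide_inverse)
  moreover have "charlier 0 = (\<lambda>_. 1)" by auto
  ultimately show ?thesis using 0 by simp
next
  case (Suc m)
  have m: "poly_bounded (charlier m)" using poly_bounded_charlier[of m 0] by simp
  have "dobinski_sum (charlier j) = dobinski_sum (\<lambda>x. x * charlier m (x - 1) - charlier m x)"
    unfolding Suc by (rule dobinski_sum_cong) simp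
  also have "\<dots> = 0"
    using dobinski_sum_step[OF m] m by (subst dobinski_sum_diff) (auto intro!: poly_bounded_intros poly_bounded_charlier)
  finally show ?thesis using Suc by simp
qed

lemma sum_dim_exponent_power:
  "(\<Sum>P\<in>set_partitions n. real_of_int (dim_exponent n P) ^ i) = dobinski_sum (charlier_moment i n) / exp 1"
proof -
  have pb: "poly_bounded (charlier j)" for j using poly_bounded_charlier[of j 0] by simp
  have finP: "finite P" if "P \<in> set_partitions n" for P using set_partitionsD(1)[OF that] .
  have "dobinski_sum (charlier_moment i n) =
    (\<Sum>P\<in>set_partitions n. \<Sum>U\<in>Pow P. dobinski_sum (\<lambda>x. partial_dim n P U ^ i * charlier (card U) x))"
    unfolding charlier_moment_def[abs_def] open_sum_def
    by (subst dobinski_sum_sum, (intro poly_bounded_intros pb)[1], subst dobinski_sum_sum, (intro poly_bounded_intros pb)[1], rule refl)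
  also have "\<dots> = open_sum n (\<lambda>d j. exp 1 * (if j = 0 then d ^ i else 0))"
    unfolding open_sum_def by (intro sum.cong refl) (simp add: dobinski_sum_cmult pb dobinski_sum_charlier)
  also have "\<dots> = exp 1 * (\<Sum>P\<in>set_partitions n. real_of_int (dim_exponent n P) ^ i)"
    unfolding open_sum_cmult by (simp only: sum_dim_exponent[where g = "\<lambda>d. d ^ i"])
  finally show ?thesis by simp
qed

section \<open>Moments of the dimension exponent as expectations under the Dobinski weights\<close>

definition dim_poly_1 :: "nat \<Rightarrow> real \<Rightarrow> real" where
  "dim_poly_1 n x = real n*x - 2*x^2 + 4*x"

definition dim_poly_2 :: "nat \<Rightarrow> real \<Rightarrow> real" where
  "dim_poly_2 n x = real n^2*x^2 - 4*real n*x^3 + 8*real n*x^2 - 4*real n*x + real n + 4*x^4 - 15*x^3 + 9*x^2 -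
     3*x"

definition dim_poly_3 :: "nat \<Rightarrow> real \<Rightarrow> real" where
  "dim_poly_3 n x = real n^3*x^3 - 6*real n^2*x^4 + 12*real n^2*x^3 - 12*real n^2*x^2 + 3*real n^2*x + 12*real
     n*x^5 - 45*real n*x^4 + 51*real n*x^3 - 45*real n*x^2 + 6*real n*x + real n - 8*x^6 + 42*x^5
     - 131/3*x^4 + 18*x^3 + 8/3*x^2 - 1/3*x"

lemma dobinski_sum_charlier_moment_1:
  "dobinski_sum (charlier_moment 1 n) = dobinski_sum (\<lambda>x. x ^ n * dim_poly_1 n x)"
proof -
  have td1: "dobinski_sum (\<lambda>x. (x^2 - x) * (x - 1) ^ n) =
     dobinski_sum (\<lambda>x. (x) * x ^ n)"
    by (rule dobinski_sum_down1) ((intro poly_bounded_intros)[1], algebra)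
  have tu1: "dobinski_sum (\<lambda>x. (- 1*x) * (x + 1) ^ n) =
     dobinski_sum (\<lambda>x. (- 1*x^2 + x) * x ^ n)"
    by (rule dobinski_sum_up1) ((intro poly_bounded_intros)[1], algebra)
  have "dobinski_sum (charlier_moment 1 n) =
     dobinski_sum (\<lambda>x. (x) * x ^ n)
     + dobinski_sum (\<lambda>x. (real n*x - x^2 + 2*x) * x ^ n)
     + dobinski_sum (\<lambda>x. (- 1*x^2 + x) * x ^ n)"
    unfolding charlier_moment_1[abs_def]
    by ((subst dobinski_sum_add; (intro poly_bounded_intros)?)+, unfold td1 tu1, rule refl)
  also have "\<dots> = dobinski_sum (\<lambda>x. x ^ n * dim_poly_1 n x)"
    by (subst dobinski_sum_add[symmetric]; (intro poly_bounded_intros)?)+ (rule dobinski_sum_cong, unfold dim_poly_1_def, algebra)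
  finally show ?thesis .
qed

lemma dobinski_sum_charlier_moment_2:
  "dobinski_sum (charlier_moment 2 n) = dobinski_sum (\<lambda>x. x ^ n * dim_poly_2 n x)"
proof -
  have td2: "dobinski_sum (\<lambda>x. (x^4 - 9/2*x^3 + 13/2*x^2 - 3*x) * (x - 2) ^ n) =
     dobinski_sum (\<lambda>x. (x^2 + 1/2*x) * x ^ n)"
    by (rule dobinski_sum_down2) ((intro poly_bounded_intros)[1], algebra)
  have td1: "dobinski_sum (\<lambda>x. (2*real n*x^3 - 4*real n*x^2 + 2*real n*x - 2*x^4 + 8*x^3 - 11*x^2 + 5*x) * (x - 1) ^ n) =
     dobinski_sum (\<lambda>x. (2*real n*x^2 - 2*x^3 + 2*x^2 - x) * x ^ n)"
    by (rule dobinski_sum_down1) ((intro poly_bounded_intros)[1], algebra)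
  have tu1: "dobinski_sum (\<lambda>x. (- 2*real n*x^2 - 2*real n*x + 2*x^3 + 2*x^2 - x) * (x + 1) ^ n) =
     dobinski_sum (\<lambda>x. (- 2*real n*x^3 + 2*real n*x^2 + 2*x^4 - 4*x^3 + x^2 + x) * x ^ n)"
    by (rule dobinski_sum_up1) ((intro poly_bounded_intros)[1], algebra)
  have tu2: "dobinski_sum (\<lambda>x. (x^2 + 3/2*x) * (x + 2) ^ n) =
     dobinski_sum (\<lambda>x. (x^4 - 7/2*x^3 + 7/2*x^2 - x) * x ^ n)"
    by (rule dobinski_sum_up2) ((intro poly_bounded_intros)[1], algebra)
  have "dobinski_sum (charlier_moment 2 n) =
     dobinski_sum (\<lambda>x. (x^2 + 1/2*x) * x ^ n)
     + dobinski_sum (\<lambda>x. (2*real n*x^2 - 2*x^3 + 2*x^2 - x) * x ^ n)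
     + dobinski_sum (\<lambda>x. (real n^2*x^2 - 2*real n*x^3 + 4*real n*x^2 - 4*real n*x + real n + x^4 - 11/2*x^3 + 3/2*x^2
       - 5/2*x) * x ^ n)
     + dobinski_sum (\<lambda>x. (- 2*real n*x^3 + 2*real n*x^2 + 2*x^4 - 4*x^3 + x^2 + x) * x ^ n)
     + dobinski_sum (\<lambda>x. (x^4 - 7/2*x^3 + 7/2*x^2 - x) * x ^ n)"
    unfolding charlier_moment_2[abs_def]
    by ((subst dobinski_sum_add; (intro poly_bounded_intros)?)+, unfold td2 td1 tu1 tu2, rule refl)
  also have "\<dots> = dobinski_sum (\<lambda>x. x ^ n * dim_poly_2 n x)"
    by (subst dobinski_sum_add[symmetric]; (intro poly_bounded_intros)?)+ (rule dobinski_sum_cong, unfold dim_poly_2_def, algebra)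
  finally show ?thesis .
qed

lemma dobinski_sum_charlier_moment_3:
  "dobinski_sum (charlier_moment 3 n) = dobinski_sum (\<lambda>x. x ^ n * dim_poly_3 n x)"
proof -
  have td3: "dobinski_sum (\<lambda>x. (x^6 - 21/2*x^5 + 257/6*x^4 - 169/2*x^3 + 481/6*x^2 - 29*x) * (x - 3) ^ n) =
     dobinski_sum (\<lambda>x. (x^3 + 3/2*x^2 + 1/3*x) * x ^ n)"
    by (rule dobinski_sum_down3) ((intro poly_bounded_intros)[1], algebra)
  have td2: "dobinski_sum (\<lambda>x. (3*real n*x^5 - 39/2*real n*x^4 + 93/2*real n*x^3 - 48*real n*x^2 + 18*real n*x - 3*x^6 +
       51/2*x^5 - 90*x^4 + 162*x^3 - 291/2*x^2 + 51*x) * (x - 2) ^ n) =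
     dobinski_sum (\<lambda>x. (3*real n*x^3 + 3/2*real n*x^2 - 3*x^4 - 3/2*x^3 - 9/2*x^2 - 3/2*x) * x ^ n)"
    by (rule dobinski_sum_down2) ((intro poly_bounded_intros)[1], algebra)
  have td1: "dobinski_sum (\<lambda>x. (3*real n^2*x^4 - 9*real n^2*x^3 + 9*real n^2*x^2 - 3*real n^2*x - 6*real n*x^5 + 30*real
       n*x^4 - 69*real n*x^3 + 75*real n*x^2 - 30*real n*x + 3*x^6 - 45/2*x^5 + 57*x^4 - 72*x^3 +
       52*x^2 - 35/2*x) * (x - 1) ^ n) =
     dobinski_sum (\<lambda>x. (3*real n^2*x^3 - 6*real n*x^4 + 6*real n*x^3 - 15*real n*x^2 + 3*real n*x + 3*x^5 - 15/2*x^4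
       - 3*x^3 - 6*x^2 + 4*x) * x ^ n)"
    by (rule dobinski_sum_down1) ((intro poly_bounded_intros)[1], algebra)
  have tu1: "dobinski_sum (\<lambda>x. (- 3*real n^2*x^3 - 6*real n^2*x^2 - 3*real n^2*x + 6*real n*x^4 + 12*real n*x^3 + 15*real
       n*x^2 + 6*real n*x - 3*x^5 - 9/2*x^4 + 15/2*x^3 + 24*x^2 + 14*x) * (x + 1) ^ n) =
     dobinski_sum (\<lambda>x. (- 3*real n^2*x^4 + 3*real n^2*x^3 + 6*real n*x^5 - 12*real n*x^4 + 15*real n*x^3 - 12*real
       n*x^2 + 3*real n*x - 3*x^6 + 21/2*x^5 - 9/2*x^4 + 9/2*x^3 - 17/2*x^2 + x) * x ^ n)"
    by (rule dobinski_sum_up1) ((intro poly_bounded_intros)[1], algebra)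
  have tu2: "dobinski_sum (\<lambda>x. (3*real n*x^3 + 21/2*real n*x^2 + 9*real n*x - 3*x^4 - 33/2*x^3 - 51/2*x^2 - 21/2*x) * (x + 2) ^ n) =
     dobinski_sum (\<lambda>x. (3*real n*x^5 - 21/2*real n*x^4 + 21/2*real n*x^3 - 3*real n*x^2 - 3*x^6 + 21/2*x^5 - 6*x^4 -
       12*x^3 + 27/2*x^2 - 3*x) * x ^ n)"
    by (rule dobinski_sum_up2) ((intro poly_bounded_intros)[1], algebra)
  have tu3: "dobinski_sum (\<lambda>x. (- 1*x^3 - 9/2*x^2 - 29/6*x) * (x + 3) ^ n) =
     dobinski_sum (\<lambda>x. (- 1*x^6 + 15/2*x^5 - 61/3*x^4 + 49/2*x^3 - 38/3*x^2 + 2*x) * x ^ n)"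
    by (rule dobinski_sum_up3) ((intro poly_bounded_intros)[1], algebra)
  have "dobinski_sum (charlier_moment 3 n) =
     dobinski_sum (\<lambda>x. (x^3 + 3/2*x^2 + 1/3*x) * x ^ n)
     + dobinski_sum (\<lambda>x. (3*real n*x^3 + 3/2*real n*x^2 - 3*x^4 - 3/2*x^3 - 9/2*x^2 - 3/2*x) * x ^ n)
     + dobinski_sum (\<lambda>x. (3*real n^2*x^3 - 6*real n*x^4 + 6*real n*x^3 - 15*real n*x^2 + 3*real n*x + 3*x^5 - 15/2*x^4
       - 3*x^3 - 6*x^2 + 4*x) * x ^ n)
     + dobinski_sum (\<lambda>x. (real n^3*x^3 - 3*real n^2*x^4 + 6*real n^2*x^3 - 12*real n^2*x^2 + 3*real n^2*x + 3*real
       n*x^5 - 33/2*real n*x^4 + 33/2*real n*x^3 - 33/2*real n*x^2 + real n - x^6 + 21/2*x^5 -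
       7/3*x^4 + 9/2*x^3 + 58/3*x^2 - 19/6*x) * x ^ n)
     + dobinski_sum (\<lambda>x. (- 3*real n^2*x^4 + 3*real n^2*x^3 + 6*real n*x^5 - 12*real n*x^4 + 15*real n*x^3 - 12*real
       n*x^2 + 3*real n*x - 3*x^6 + 21/2*x^5 - 9/2*x^4 + 9/2*x^3 - 17/2*x^2 + x) * x ^ n)
     + dobinski_sum (\<lambda>x. (3*real n*x^5 - 21/2*real n*x^4 + 21/2*real n*x^3 - 3*real n*x^2 - 3*x^6 + 21/2*x^5 - 6*x^4 -
       12*x^3 + 27/2*x^2 - 3*x) * x ^ n)
     + dobinski_sum (\<lambda>x. (- 1*x^6 + 15/2*x^5 - 61/3*x^4 + 49/2*x^3 - 38/3*x^2 + 2*x) * x ^ n)"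
    unfolding charlier_moment_3[abs_def]
    by ((subst dobinski_sum_add; (intro poly_bounded_intros)?)+, unfold td3 td2 td1 tu1 tu2 tu3, rule refl)
  also have "\<dots> = dobinski_sum (\<lambda>x. x ^ n * dim_poly_3 n x)"
    by (subst dobinski_sum_add[symmetric]; (intro poly_bounded_intros)?)+ (rule dobinski_sum_cong, unfold dim_poly_3_def, algebra)
  finally show ?thesis .
qed

text \<open>The expectation of \<open>f\<close> when \<open>k\<close> has probability proportional to \<open>k ^ n / k!\<close>.\<close>

definition mean :: "nat \<Rightarrow> (real \<Rightarrow> real) \<Rightarrow> real" where
  "mean n f = dobinski_sum (\<lambda>x. x ^ n * f x) / dobinski_sum (\<lambda>x. x ^ n)"

text \<open>The zeroth moment counts the partitions; this is Dobinski's formula.\<close>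

lemma Bell_eq_dobinski_sum: "real (Bell n) = dobinski_sum (\<lambda>x. x ^ n) / exp 1"
  using sum_dim_exponent_power[where n = n and i = 0]
  by (simp add: Bell_def charlier_moment_0[abs_def])

lemma Bell_pos: "Bell n > 0"
proof -
  have "set_partitions n \<noteq> {}"
    using partition_on_singletons[of "{1..n}"] unfolding set_partitions_def by blast
  then show ?thesis by (simp add: Bell_def card_gt_0_iff finite_set_partitions)
qed

lemma dobinski_sum_power_pos: "dobinski_sum (\<lambda>x. x ^ n) > 0"
proof -
  have "dobinski_sum (\<lambda>x. x ^ n) = exp 1 * real (Bell n)" by (simp add: Bell_eq_dobinski_sum)
  then show ?thesis using Bell_pos[of n] by simp
qed

lemma average_dim_exponent:
  "(\<Sum>P\<in>set_partitions n. real_of_int (dim_exponent n P)) / Bell n = mean n (dim_poly_1 n)"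
  "(\<Sum>P\<in>set_partitions n. real_of_int (dim_exponent n P) ^ 2) / Bell n = mean n (dim_poly_2 n)"
  "(\<Sum>P\<in>set_partitions n. real_of_int (dim_exponent n P) ^ 3) / Bell n = mean n (dim_poly_3 n)"
  using sum_dim_exponent_power[where n = n and i = 1] sum_dim_exponent_power[where n = n and i = 2]
    sum_dim_exponent_power[where n = n and i = 3]
  unfolding Bell_eq_dobinski_sum mean_def dobinski_sum_charlier_moment_1 dobinski_sum_charlier_moment_2 dobinski_sum_charlier_moment_3
  by simp_all

lemma expect_dim_exponent:
  "expect_partitions n (\<lambda>P. real_of_int (dim_exponent n P)) = mean n (dim_poly_1 n)"
proof -
  have ne: "set_partitions n \<noteq> {}" using Bell_pos[of n] by (auto simp: Bell_def)
  show ?thesis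
    unfolding average_dim_exponent(1)[symmetric] expect_partitions_def Bell_def
    by (subst integral_pmf_of_set[OF ne finite_set_partitions]) simp
qed

lemma central_moment_eq:
  "central_moment 2 dim_exponent n = mean n (dim_poly_2 n) - (mean n (dim_poly_1 n))\<^sup>2"
  "central_moment 3 dim_exponent n =
     mean n (dim_poly_3 n) - 3 * mean n (dim_poly_2 n) * mean n (dim_poly_1 n) + 2 * (mean n (dim_poly_1 n)) ^ 3"
proof -
  let ?S = "set_partitions n" and ?d = "\<lambda>P. real_of_int (dim_exponent n P)"
  define B where "B = real (Bell n)"
  have B: "B > 0" "(\<Sum>P\<in>?S. 1) = B" using Bell_pos[of n] by (auto simp: B_def Bell_def)
  define m where "m = mean n (dim_poly_1 n)"
  have m: "real_of_int (total_stat dim_exponent n) / B = m"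
    by (simp add: m_def average_dim_exponent(1)[symmetric] total_stat_def B_def)
  have s: "(\<Sum>P\<in>?S. ?d P) = B * m" "(\<Sum>P\<in>?S. ?d P ^ 2) = B * mean n (dim_poly_2 n)"
    "(\<Sum>P\<in>?S. ?d P ^ 3) = B * mean n (dim_poly_3 n)"
    using B(1) by (simp_all add: m_def average_dim_exponent[symmetric] B_def[symmetric])
  have "(\<Sum>P\<in>?S. (?d P - m) ^ 2) = (\<Sum>P\<in>?S. ?d P ^ 2 - 2 * m * ?d P + m ^ 2 * 1)"
    by (intro sum.cong) (auto simp: power2_eq_square algebra_simps)
  also have "\<dots> = B * mean n (dim_poly_2 n) - 2 * m * (B * m) + m ^ 2 * B"
    unfolding sum.distrib sum_subtractf sum_distrib_left[symmetric] s B ..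
  finally show "central_moment 2 dim_exponent n = mean n (dim_poly_2 n) - (mean n (dim_poly_1 n))\<^sup>2"
    using B(1) unfolding central_moment_def B_def[symmetric] m m_def[symmetric]
    by (simp add: field_simps power2_eq_square)
  have "(\<Sum>P\<in>?S. (?d P - m) ^ 3) = (\<Sum>P\<in>?S. ?d P ^ 3 - 3 * m * ?d P ^ 2 + 3 * m ^ 2 * ?d P - m ^ 3 * 1)"
    by (intro sum.cong) (auto simp: power2_eq_square power3_eq_cube algebra_simps)
  also have "\<dots> = B * mean n (dim_poly_3 n) - 3 * m * (B * mean n (dim_poly_2 n)) + 3 * m ^ 2 * (B * m) - m ^ 3 * B"
    unfolding sum.distrib sum_subtractf sum_distrib_left[symmetric] s B ..
  finally show "central_moment 3 dim_exponent n =
     mean n (dim_poly_3 n) - 3 * mean n (dim_poly_2 n) * mean n (dim_poly_1 n) + 2 * (mean n (dim_poly_1 n)) ^ 3"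
    using B(1) unfolding central_moment_def B_def[symmetric] m m_def[symmetric]
    by (simp add: field_simps power2_eq_square power3_eq_cube)
qed

section \<open>Concentration of the Dobinski weights\<close>

lemma alpha_pos: "alpha n > 0" and alpha_eq: "alpha n * exp (alpha n) = real n + 1"
  using theI'[OF alpha_ex1[of n]] unfolding alpha_def by auto

lemma alpha_ge:
  assumes "a * exp a \<le> real n + 1" shows "a \<le> alpha n"
proof (rule ccontr)
  assume "\<not> a \<le> alpha n"
  then have "alpha n * exp (alpha n) < a * exp a"
    using alpha_pos[of n] by (intro mult_strict_mono) auto
  then show False using assms alpha_eq[of n] by simp
qed

lemma filterlim_alpha: "filterlim alpha at_top sequentially"
  unfolding filterlim_at_top
proof
  fix a :: real
  have "\<forall>\<^sub>F n in sequentially. a * exp a \<le> real n + 1" by real_asymp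
  then show "\<forall>\<^sub>F n in sequentially. a \<le> alpha n"
    by eventually_elim (rule alpha_ge)
qed

text \<open>Logarithms of the defining equation give
  \<open>alpha n + ln (alpha n) = ln (n + 1)\<close>. What remains is
  \<open>ln (alpha n + ln (alpha n)) - ln (alpha n)\<close>, which tends to 0 because
  \<open>alpha n\<close> tends to infinity, and the passage from \<open>n + 1\<close> to
  \<open>n\<close>.\<close>

lemma alpha_asymptotics: "(\<lambda>n. alpha n - (ln (real n) - ln (ln (real n)))) \<longlonglongrightarrow> 0"
proof -
  have "((\<lambda>x::real. ln x - ln (x + ln x)) \<longlongrightarrow> 0) at_top" by real_asymp
  from filterlim_compose[OF this filterlim_alpha]
  have 1: "(\<lambda>n. ln (alpha n) - ln (alpha n + ln (alpha n))) \<longlonglongrightarrow> 0" .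
  have 2: "(\<lambda>n. ln (real n + 1) - ln (real n)) \<longlonglongrightarrow> 0" by real_asymp
  have 3: "(\<lambda>n. ln (ln (real n)) - ln (ln (real n + 1))) \<longlonglongrightarrow> 0" by real_asymp
  have ln: "alpha n + ln (alpha n) = ln (real n + 1)" for n
    using alpha_pos[of n] by (simp flip: alpha_eq add: ln_mult)
  have "(\<lambda>n. (ln (real n + 1) - ln (real n)) - (ln (alpha n) - ln (alpha n + ln (alpha n)))
      + (ln (ln (real n)) - ln (ln (real n + 1)))) \<longlonglongrightarrow> 0 - 0 + 0"
    by (intro tendsto_intros 1 2 3)
  also have "(\<lambda>n. (ln (real n + 1) - ln (real n)) - (ln (alpha n) - ln (alpha n + ln (alpha n)))
      + (ln (ln (real n)) - ln (ln (real n + 1)))) =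
      (\<lambda>n. alpha n - (ln (real n) - ln (ln (real n))))"
  proof
    fix n
    show "(ln (real n + 1) - ln (real n)) - (ln (alpha n) - ln (alpha n + ln (alpha n)))
      + (ln (ln (real n)) - ln (ln (real n + 1))) = alpha n - (ln (real n) - ln (ln (real n)))"
      unfolding ln using ln[of n] by linarith
  qed
  finally show ?thesis by simp
qed

definition cen :: "nat \<Rightarrow> real" where "cen n = exp (alpha n)"

lemma cen_gt_1: "cen n > 1" using alpha_pos[of n] by (simp add: cen_def)

lemma alpha_cen: "alpha n * cen n = real n + 1"
  by (simp add: cen_def alpha_eq)

lemma n_eq: "real n = alpha n * cen n - 1"
  by (simp add: alpha_cen)

lemma dobinski_sum_cong_nat: "(\<And>k. f (real k) = g (real k)) \<Longrightarrow> dobinski_sum f = dobinski_sum g"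
  by (simp add: dobinski_sum_def)

lemma mean_add: "poly_bounded f \<Longrightarrow> poly_bounded g \<Longrightarrow> mean n (\<lambda>x. f x + g x) = mean n f + mean n g"
  by (simp add: mean_def distrib_left dobinski_sum_add poly_bounded_intros add_divide_distrib)

lemma mean_diff: "poly_bounded f \<Longrightarrow> poly_bounded g \<Longrightarrow> mean n (\<lambda>x. f x - g x) = mean n f - mean n g"
  by (simp add: mean_def right_diff_distrib dobinski_sum_diff poly_bounded_intros diff_divide_distrib)

lemma mean_cmult: "poly_bounded f \<Longrightarrow> mean n (\<lambda>x. c * f x) = c * mean n f"
  by (simp add: mean_def mult.left_commute[of _ c] dobinski_sum_cmult poly_bounded_intros)

lemma mean_const: "mean n (\<lambda>_. c) = c"
  using mean_cmult[OF poly_bounded_const, of n c 1] dobinski_sum_power_pos[of n] by (simp add: mean_def)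

lemma mean_sum: "(\<And>i. i \<in> I \<Longrightarrow> poly_bounded (f i)) \<Longrightarrow> mean n (\<lambda>x. \<Sum>i\<in>I. f i x) = (\<Sum>i\<in>I. mean n (f i))"
  by (simp add: mean_def sum_distrib_left dobinski_sum_sum poly_bounded_intros sum_divide_distrib)

text \<open>For \<open>n > 0\<close> the index 0 has weight \<open>0 ^ n = 0\<close>, so that only
  positive integers have to be compared; \<open>ratio_slope\<close> is available exactly
  there.\<close>

lemma mean_mono:
  assumes "poly_bounded f" "poly_bounded g" "n > 0" "\<And>k. k > 0 \<Longrightarrow> f (real k) \<le> g (real k)"
  shows "mean n f \<le> mean n g"
proof -
  have "dobinski_sum (\<lambda>x. x ^ n * f x) \<le> dobinski_sum (\<lambda>x. x ^ n * g x)"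
  proof (rule dobinski_sum_mono)
    show "real k ^ n * f (real k) \<le> real k ^ n * g (real k)" for k
    proof (cases "k = 0")
      case True
      then show ?thesis using assms(3) by (simp add: power_0_left)
    next
      case False
      then show ?thesis using assms(4)[of k] by (intro mult_left_mono) auto
    qed
  qed (use assms in \<open>auto intro!: poly_bounded_intros\<close>)
  then show ?thesis
    unfolding mean_def using dobinski_sum_power_pos[of n] by (simp add: divide_right_mono)
qed

lemma mean_abs_le: "poly_bounded f \<Longrightarrow> n > 0 \<Longrightarrow> \<bar>mean n f\<bar> \<le> mean n (\<lambda>x. \<bar>f x\<bar>)"
proof -
  assume f: "poly_bounded f" "n > 0"
  have "mean n f \<le> mean n (\<lambda>x. \<bar>f x\<bar>)"
    using f by (intro mean_mono poly_bounded_intros) auto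
  moreover have "mean n (\<lambda>x. - 1 * \<bar>f x\<bar>) \<le> mean n f"
    using f by (intro mean_mono poly_bounded_intros) auto
  ultimately show ?thesis
    using mean_cmult[of "\<lambda>x. \<bar>f x\<bar>" n "-1"] f by (simp add: poly_bounded_abs)
qed

text \<open>For real \<open>x \<ge> 1\<close> this is the ratio \<open>w (x - 1) / w x\<close> of consecutive Dobinski weights
  \<open>w k = k ^ n / k!\<close>.\<close>

definition ratio :: "nat \<Rightarrow> real \<Rightarrow> real" where
  "ratio n x = (if x < 1 then 0 else x * (1 - 1 / x) ^ n)"

lemma ratio_bounds: "0 \<le> ratio n x" "ratio n x \<le> \<bar>x\<bar>"
proof -
  show "0 \<le> ratio n x" by (auto simp: ratio_def divide_le_eq_1)
  show "ratio n x \<le> \<bar>x\<bar>"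
  proof (cases "x < 1")
    case False
    then have "(1 - 1 / x) ^ n \<le> 1" by (intro power_le_one) (auto simp: divide_le_eq_1)
    then show ?thesis using False by (simp add: ratio_def mult_le_cancel_left2)
  qed (simp add: ratio_def)
qed

lemma poly_bounded_ratio: "poly_bounded (ratio n)"
  by (rule poly_bounded_le[OF poly_bounded_ident]) (use ratio_bounds in auto)

text \<open>At a positive integer, \<open>x ^ n * ratio n x\<close> equals
  \<open>x * (x - 1) ^ n\<close>, to which the index shift applies.\<close>

lemma mean_ratio:
  assumes "poly_bounded g" "n > 0"
  shows "mean n (\<lambda>x. ratio n x * g (x - 1)) = mean n g"
proof -
  have "dobinski_sum (\<lambda>x. x ^ n * (ratio n x * g (x - 1))) = dobinski_sum (\<lambda>x. x * ((x - 1) ^ n * g (x - 1)))"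
  proof (rule dobinski_sum_cong_nat)
    fix k :: nat
    show "real k ^ n * (ratio n (real k) * g (real k - 1)) = real k * ((real k - 1) ^ n * g (real k - 1))"
    proof (cases "k = 0")
      case False
      then have "real k ^ n * (1 - 1 / real k) ^ n = (real k - 1) ^ n"
        by (simp add: power_mult_distrib[symmetric] right_diff_distrib)
      then show ?thesis using False by (simp add: ratio_def mult_ac)
    qed (use assms in simp)
  qed
  also have "\<dots> = dobinski_sum (\<lambda>x. x ^ n * g x)"
    using dobinski_sum_step[of "\<lambda>x. x ^ n * g x"] assms by (simp add: poly_bounded_intros)
  finally show ?thesis by (simp add: mean_def)
qed

text \<open>The quotient \<open>ratio n x / x\<close> is a power of \<open>1 - 1 / x\<close>, hence
  increasing; its increment between \<open>c\<close> and \<open>x\<close> has the sign of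
  \<open>x - c\<close>.\<close>

lemma ratio_slope:
  assumes "x \<ge> 1" "c > 1"
  shows "ratio n c * (x - c)\<^sup>2 \<le> (ratio n x - ratio n c) * (x - c) * c"
proof -
  define f where "f = (\<lambda>x::real. (1 - 1 / x) ^ n)"
  have mono: "f a \<le> f b" if "1 \<le> a" "a \<le> b" for a b
    unfolding f_def using that by (intro power_mono) (auto simp: field_simps)
  have r: "ratio n x = x * f x" "ratio n c = c * f c" using assms by (auto simp: ratio_def f_def)
  have "0 \<le> (f x - f c) * (x - c)"
  proof (cases "x \<le> c")
    case True
    then show ?thesis using mono[of x c] assms by (intro mult_nonpos_nonpos) auto
  next
    case False
    then show ?thesis using mono[of c x] assms by (intro mult_nonneg_nonneg) auto
  qed
  then have "0 \<le> x * c * ((f x - f c) * (x - c))" using assms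
    by (intro mult_nonneg_nonneg[OF mult_nonneg_nonneg]) auto
  also have "\<dots> = (ratio n x - ratio n c) * (x - c) * c - ratio n c * (x - c)\<^sup>2"
    unfolding r by (simp add: algebra_simps power2_eq_square)
  finally show ?thesis by simp
qed

text \<open>In the exponent \<open>alpha n + n * ln (1 - 1 / cen n)\<close> the first-order part
  \<open>alpha n - n / cen n\<close> is only \<open>1 / cen n\<close>, by the equation for
  \<open>alpha\<close>. The corrections are of order \<open>alpha n / cen n\<close>.\<close>

lemma ratio_cen:
  assumes "alpha n \<ge> 1" "cen n \<ge> 2"
  shows "ratio n (cen n) \<ge> 1 - alpha n / cen n" "ratio n (cen n) \<le> 1 + 2 / cen n"
proof -
  let ?a = "alpha n" and ?c = "cen n"
  have c: "?c > 0" "1 / ?c \<le> 1 / 2" using assms by (auto simp: field_simps)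
  have pos: "1 - 1 / ?c > 0" using c by linarith
  have "ratio n ?c = ?c * (1 - 1 / ?c) ^ n" using assms by (simp add: ratio_def)
  also have "\<dots> = exp (?a + real n * ln (1 - 1 / ?c))"
    using pos by (simp add: exp_add cen_def exp_of_nat_mult)
  finally have eq: "ratio n ?c = exp (?a + real n * ln (1 - 1 / ?c))" .
  have lo: "ln (1 - 1 / ?c) \<ge> - (1 / (?c - 1))"
  proof -
    have "ln (1 + 1 / (?c - 1)) \<le> 1 / (?c - 1)" using assms by (intro ln_add_one_self_le_self) auto
    moreover have "1 + 1 / (?c - 1) = inverse (1 - 1 / ?c)" using assms by (simp add: field_simps)
    ultimately show ?thesis using pos by (simp add: ln_inverse)
  qed
  have hi: "ln (1 - 1 / ?c) \<le> - (1 / ?c)"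
    using ln_add_one_self_le_self2[of "- (1 / ?c)"] c by simp
  have "?a + real n * ln (1 - 1 / ?c) \<ge> ?a - real n / (?c - 1)"
    using mult_left_mono[OF lo, of "real n"] by simp
  also have "?a - real n / (?c - 1) = (1 - ?a) / (?c - 1)"
    using assms by (simp add: n_eq field_simps)
  finally have l: "?a + real n * ln (1 - 1 / ?c) \<ge> (1 - ?a) / (?c - 1)" .
  show "ratio n ?c \<ge> 1 - ?a / ?c"
  proof (cases "?a \<le> ?c")
    case True
    then have "(1 - ?a) / (?c - 1) \<ge> - (?a / ?c)" using assms by (simp add: field_simps)
    then have "1 - ?a / ?c \<le> 1 + (?a + real n * ln (1 - 1 / ?c))" using l by linarith
    also have "\<dots> \<le> ratio n ?c" unfolding eq by (rule exp_ge_add_one_self)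
    finally show ?thesis .
  next
    case False
    then have "1 - ?a / ?c \<le> 0" using c by (simp add: field_simps)
    then show ?thesis using ratio_bounds(1)[of n ?c] by linarith
  qed
  have "?a + real n * ln (1 - 1 / ?c) \<le> ?a - real n / ?c"
    using mult_left_mono[OF hi, of "real n"] by simp
  also have "?a - real n / ?c = 1 / ?c" using c by (simp add: n_eq field_simps)
  finally have "ratio n ?c \<le> exp (1 / ?c)" unfolding eq by simp
  also have "\<dots> \<le> 1 + 1 / ?c + (1 / ?c)\<^sup>2" using c by (intro exp_bound) auto
  also have "\<dots> \<le> 1 + 2 / ?c" using c by (simp add: power2_eq_square field_simps)
  finally show "ratio n ?c \<le> 1 + 2 / ?c" .
qed

section \<open>Deviations on the scale of the square root of the centre\<close>

definition eps :: "nat \<Rightarrow> real" where "eps n = exp (- alpha n / 2)"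

lemma eps_pos: "eps n > 0" by (simp add: eps_def)

lemma eps_le_1: "eps n \<le> 1" using alpha_pos[of n] by (simp add: eps_def)

lemma eps_square: "eps n ^ 2 = 1 / cen n"
proof -
  have "eps n ^ 2 = exp (- alpha n)"
    unfolding eps_def exp_of_nat_mult[symmetric] by simp
  then show ?thesis by (simp add: cen_def exp_minus inverse_eq_divide)
qed

lemma cen_eps: "cen n * eps n ^ 2 = 1"
  using cen_gt_1[of n] by (simp add: eps_square)

definition dev :: "nat \<Rightarrow> real \<Rightarrow> real" where "dev n x = (x - cen n) * eps n"

lemma poly_bounded_dev: "poly_bounded (dev n)"
  unfolding dev_def by (intro poly_bounded_intros)

lemmas poly_bounded_intros' = poly_bounded_intros poly_bounded_dev poly_bounded_ratio

lemma mean_ratio_dev: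
  assumes "n > 0"
  shows "mean n (\<lambda>x. ratio n x * dev n x ^ j) = mean n (\<lambda>x. (dev n x + eps n) ^ j)"
proof -
  have shift: "dev n (x - 1) + eps n = dev n x" for x by (simp add: dev_def algebra_simps)
  have "poly_bounded (\<lambda>x. (dev n x + eps n) ^ j)" by (intro poly_bounded_intros')
  from mean_ratio[OF this assms] show ?thesis unfolding shift .
qed

lemma power_add_diff_le:
  fixes u e :: real
  assumes "0 \<le> e"
  shows "\<bar>(u + e) ^ Suc q - u ^ Suc q\<bar> \<le> real (Suc q) * e * (\<bar>u\<bar> + e) ^ q"
proof -
  have "\<bar>(u + e) ^ Suc q - u ^ Suc q\<bar> = \<bar>(u + e - u) * (\<Sum>p<Suc q. (u + e) ^ p * u ^ (q - p))\<bar>"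
    by (simp only: diff_power_eq_sum)
  also have "\<dots> = e * \<bar>\<Sum>p<Suc q. (u + e) ^ p * u ^ (q - p)\<bar>"
    using assms by (simp add: abs_mult del: sum.lessThan_Suc)
  also have "\<dots> \<le> e * (\<Sum>p<Suc q. (\<bar>u\<bar> + e) ^ q)"
  proof (intro mult_left_mono order_trans[OF sum_abs] sum_mono)
    fix p assume "p \<in> {..<Suc q}"
    then have q: "p + (q - p) = q" by simp
    have "\<bar>(u + e) ^ p * u ^ (q - p)\<bar> \<le> (\<bar>u\<bar> + e) ^ p * (\<bar>u\<bar> + e) ^ (q - p)"
      unfolding abs_mult power_abs using assms by (intro mult_mono power_mono) auto
    then show "\<bar>(u + e) ^ p * u ^ (q - p)\<bar> \<le> (\<bar>u\<bar> + e) ^ q"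
      unfolding power_add[symmetric] q .
  qed (use assms in auto)
  finally show ?thesis by (simp add: mult_ac)
qed

lemma abs_power_le: "\<bar>u::real\<bar> ^ j \<le> 1 + u ^ (2 * m)" if "j \<le> 2 * m"
proof (cases "\<bar>u\<bar> \<le> 1")
  case True
  then have "\<bar>u\<bar> ^ j \<le> 1" by (intro power_le_one) auto
  then show ?thesis by (simp add: power_mult add_increasing2)
next
  case False
  then have "\<bar>u\<bar> ^ j \<le> \<bar>u\<bar> ^ (2 * m)" using that by (intro power_increasing) auto
  then show ?thesis by (simp add: power_even_abs)
qed

lemma eventually_alpha_large: "\<forall>\<^sub>F n in sequentially. alpha n \<ge> a"
  using filterlim_alpha by (simp add: filterlim_at_top)

lemma eventually_compose_alpha:
  "eventually P at_top \<Longrightarrow> \<forall>\<^sub>F n in sequentially. P (alpha n)"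
  using filterlim_alpha unfolding filterlim_iff by blast

text \<open>By \<open>ratio_slope\<close> the weight ratio minus its value at the centre has the sign of the deviation
  and at least linear size, so \<open>mean_ratio_dev\<close> bounds each even moment by the preceding one.\<close>

lemma even_dev_moments_bounded: "\<exists>C. \<forall>\<^sub>F n in sequentially. mean n (\<lambda>x. dev n x ^ (2 * m)) \<le> C"
proof (induction m)
  case 0
  then show ?case by (intro exI[of _ 1]) (simp add: mean_const)
next
  case (Suc m)
  then obtain C where C: "\<forall>\<^sub>F n in sequentially. mean n (\<lambda>x. dev n x ^ (2 * m)) \<le> C" by blast
  let ?q = "2 * m"
  \<comment> \<open>Comes from \<open>power_add_diff_le\<close>, with \<open>|u| + eps\<close>
    bounded by \<open>2 * max 1 |u|\<close> and the preceding even moment by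
    \<open>C\<close>.\<close>
  let ?K = "real (Suc ?q) * 2 ^ ?q * (1 + C)"
  have "\<forall>\<^sub>F x::real in at_top. x * exp (- x / 2) \<le> 1 / 16" by real_asymp
  then have small: "\<forall>\<^sub>F n in sequentially. alpha n * eps n \<le> 1 / 16"
    unfolding eps_def by (rule eventually_compose_alpha)
  have "\<forall>\<^sub>F n in sequentially. mean n (\<lambda>x. dev n x ^ (2 * Suc m)) \<le> (8 * ?K + 1) / 3"
    using small C eventually_alpha_large[of 2] eventually_gt_at_top[of 0]
  proof eventually_elim
    case (elim n)
    let ?u = "dev n" and ?e = "eps n" and ?c = "cen n" and ?r = "ratio n (cen n)"
    have "1 + alpha n \<le> ?c" unfolding cen_def by (rule exp_ge_add_one_self)
    then have c: "?c \<ge> 2" using elim(3) by linarith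
    have ce: "?c * ?e * ?e = 1" using cen_eps[of n] by (simp add: power2_eq_square)
    have e: "0 < ?e" "?e \<le> 1" using eps_pos eps_le_1 by auto
    have ae: "alpha n / ?c = (alpha n * ?e) * ?e"
      using eps_square[of n] by (simp add: power2_eq_square mult.assoc)
    have "alpha n / ?c \<le> 1 / 16" unfolding ae using elim(1) e mult_mono[of "alpha n * ?e" "1/16" ?e 1] by simp
    have r: "?r \<ge> 1 - alpha n / ?c" "?r \<le> 1 + 2 / ?c" using ratio_cen[of n] elim(3) c by auto
    have r1: "?r \<ge> 1 / 2" using r \<open>alpha n / ?c \<le> 1 / 16\<close> by linarith
    have "2 / ?c \<le> alpha n / ?c" using elim(3) c by (intro divide_right_mono) auto
    then have "\<bar>1 - ?r\<bar> \<le> alpha n / ?c" using r by linarith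
    then have "?c * ?e * \<bar>1 - ?r\<bar> \<le> ?c * ?e * (alpha n * ?e * ?e)"
      using e c ae by (intro mult_left_mono) auto
    also have "\<dots> = alpha n * ?e" using ce by (simp add: mult_ac)
    finally have r2: "?c * ?e * \<bar>1 - ?r\<bar> \<le> 1 / 8" using elim(1) by linarith
    define A where "A = mean n (\<lambda>x. ?u x ^ (2 * Suc m))"
    define B where "B = mean n (\<lambda>x. ?u x ^ Suc ?q)"
    have "mean n (\<lambda>x. ?r * ?u x ^ (2 * Suc m)) \<le> mean n (\<lambda>x. ?c * ?e * ((ratio n x - ?r) * ?u x ^ Suc ?q))"
    proof (rule mean_mono)
      fix k :: nat assume "k > 0"
      then have "?r * (real k - ?c)\<^sup>2 \<le> (ratio n (real k) - ?r) * (real k - ?c) * ?c"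
        using c by (intro ratio_slope) auto
      then have "(?r * (real k - ?c)\<^sup>2) * (?e\<^sup>2 * ?u (real k) ^ ?q)
         \<le> ((ratio n (real k) - ?r) * (real k - ?c) * ?c) * (?e\<^sup>2 * ?u (real k) ^ ?q)"
        by (intro mult_right_mono) (auto simp: power_mult)
      moreover have "?r * ?u (real k) ^ (2 * Suc m) = (?r * (real k - ?c)\<^sup>2) * (?e\<^sup>2 * ?u (real k) ^ ?q)"
        by (simp add: dev_def power_mult_distrib power2_eq_square mult_ac)
      moreover have "?c * ?e * ((ratio n (real k) - ?r) * ?u (real k) ^ Suc ?q) =
        ((ratio n (real k) - ?r) * (real k - ?c) * ?c) * (?e\<^sup>2 * ?u (real k) ^ ?q)"
        by (simp add: dev_def power_mult_distrib power2_eq_square mult_ac)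
      ultimately show "?r * ?u (real k) ^ (2 * Suc m) \<le> ?c * ?e * ((ratio n (real k) - ?r) * ?u (real k) ^ Suc ?q)"
        by (simp only:)
    qed (use elim in \<open>auto intro!: poly_bounded_intros'\<close>)
    also have "mean n (\<lambda>x. ?c * ?e * ((ratio n x - ?r) * ?u x ^ Suc ?q)) =
       ?c * ?e * (mean n (\<lambda>x. (?u x + ?e) ^ Suc ?q) - ?r * B)"
      using elim(4) unfolding B_def mean_ratio_dev[OF elim(4), symmetric] left_diff_distrib
      by (simp only: mean_cmult mean_diff poly_bounded_intros')
    also have "\<dots> = ?c * ?e * mean n (\<lambda>x. (?u x + ?e) ^ Suc ?q - ?u x ^ Suc ?q) + ?c * ?e * (1 - ?r) * B"
      unfolding B_def by (subst mean_diff) (auto intro!: poly_bounded_intros' simp: algebra_simps)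
    \<comment> \<open>The odd power is at most one plus the very moment to be estimated; the small
      factor \<open>1 / 8\<close> lets the left-hand side absorb it.\<close>
    also have "?c * ?e * (1 - ?r) * B \<le> 1 / 8 * (1 + A)"
    proof -
      have "\<bar>B\<bar> \<le> mean n (\<lambda>x. \<bar>?u x ^ Suc ?q\<bar>)"
        unfolding B_def using elim by (intro mean_abs_le poly_bounded_intros') auto
      also have "\<dots> \<le> mean n (\<lambda>x. 1 + ?u x ^ (2 * Suc m))"
        using elim(4) abs_power_le[of "Suc ?q" "Suc m"]
        by (intro mean_mono poly_bounded_intros') (auto simp: power_abs simp del: power_Suc)
      also have "\<dots> = 1 + A" unfolding A_def by (subst mean_add) (auto intro!: poly_bounded_intros' simp: mean_const)
      finally have B: "\<bar>B\<bar> \<le> 1 + A" .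
      have "?c * ?e * (1 - ?r) * B \<le> \<bar>?c * ?e * (1 - ?r)\<bar> * \<bar>B\<bar>" by (metis abs_ge_self abs_mult)
      also have "\<dots> \<le> 1 / 8 * (1 + A)"
        using r2 B e c by (intro mult_mono) (auto simp: abs_mult)
      finally show ?thesis .
    qed
    also have "?c * ?e * mean n (\<lambda>x. (?u x + ?e) ^ Suc ?q - ?u x ^ Suc ?q) \<le> ?K"
    proof -
      have "mean n (\<lambda>x. (?u x + ?e) ^ Suc ?q - ?u x ^ Suc ?q) \<le>
          mean n (\<lambda>x. real (Suc ?q) * ?e * 2 ^ ?q * (1 + ?u x ^ ?q))"
      proof (rule mean_mono)
        fix k :: nat
        have "(\<bar>?u (real k)\<bar> + ?e) ^ ?q \<le> (2 * max 1 \<bar>?u (real k)\<bar>) ^ ?q"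
          using e by (intro power_mono) auto
        also have "\<dots> = 2 ^ ?q * (max 1 \<bar>?u (real k)\<bar>) ^ ?q" by (rule power_mult_distrib)
        also have "(max 1 \<bar>?u (real k)\<bar>) ^ ?q \<le> 1 + ?u (real k) ^ ?q"
          by (cases "\<bar>?u (real k)\<bar> \<le> 1") (auto simp: max_def power_mult)
        finally have "(\<bar>?u (real k)\<bar> + ?e) ^ ?q \<le> 2 ^ ?q * (1 + ?u (real k) ^ ?q)" by simp
        then have "real (Suc ?q) * ?e * (\<bar>?u (real k)\<bar> + ?e) ^ ?q
           \<le> real (Suc ?q) * ?e * (2 ^ ?q * (1 + ?u (real k) ^ ?q))"
          using e by (intro mult_left_mono) auto
        then show "(?u (real k) + ?e) ^ Suc ?q - ?u (real k) ^ Suc ?q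
            \<le> real (Suc ?q) * ?e * 2 ^ ?q * (1 + ?u (real k) ^ ?q)"
          using power_add_diff_le[of ?e "?u (real k)" ?q] e by (simp only: mult.assoc) linarith
      qed (use elim in \<open>auto intro!: poly_bounded_intros'\<close>)
      also have "\<dots> = real (Suc ?q) * ?e * 2 ^ ?q * (1 + mean n (\<lambda>x. ?u x ^ ?q))"
        by (simp only: mean_cmult mean_add mean_const poly_bounded_intros')
      also have "\<dots> \<le> real (Suc ?q) * ?e * 2 ^ ?q * (1 + C)"
        using elim(2) e by (intro mult_left_mono) auto
      finally have "?c * ?e * mean n (\<lambda>x. (?u x + ?e) ^ Suc ?q - ?u x ^ Suc ?q)
         \<le> ?c * ?e * (real (Suc ?q) * ?e * 2 ^ ?q * (1 + C))"
        using e c by (intro mult_left_mono) auto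
      also have "\<dots> = (?c * ?e * ?e) * ?K" by (simp only: mult_ac)
      finally show ?thesis using ce by simp
    qed
    also have "mean n (\<lambda>x. ?r * ?u x ^ (2 * Suc m)) = ?r * A"
      unfolding A_def by (simp only: mean_cmult poly_bounded_intros')
    finally have main: "?r * A \<le> ?K + 1 / 8 * (1 + A)" by simp
    have "mean n (\<lambda>_. 0) \<le> A"
      unfolding A_def using elim(4) by (intro mean_mono poly_bounded_intros' zero_le_even_power) auto
    then have "0 \<le> A" by (simp add: mean_const)
    then have "1 / 2 * A \<le> ?r * A" using r1 by (intro mult_right_mono) auto
    \<comment> \<open>With the ratio at the centre at least \<open>1 / 2\<close>, the estimate reads
      \<open>A / 2 \<le> K + (1 + A) / 8\<close>, which is the bound
      \<open>(8 * K + 1) / 3\<close>.\<close>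
    then show ?case using main \<open>0 \<le> A\<close> unfolding A_def[symmetric] by argo
  qed
  then show ?case by blast
qed

lemma abs_dev_moments_bounded: "\<exists>C. \<forall>\<^sub>F n in sequentially. mean n (\<lambda>x. \<bar>dev n x\<bar> ^ j) \<le> C"
proof -
  obtain C where C: "\<forall>\<^sub>F n in sequentially. mean n (\<lambda>x. dev n x ^ (2 * j)) \<le> C"
    using even_dev_moments_bounded by blast
  have "\<forall>\<^sub>F n in sequentially. mean n (\<lambda>x. \<bar>dev n x\<bar> ^ j) \<le> 1 + C"
    using C eventually_gt_at_top[of 0]
  proof eventually_elim
    case (elim n)
    have "mean n (\<lambda>x. \<bar>dev n x\<bar> ^ j) \<le> mean n (\<lambda>x. 1 + dev n x ^ (2 * j))"
      using elim(2) by (intro mean_mono poly_bounded_intros' abs_power_le) auto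
    also have "\<dots> = 1 + mean n (\<lambda>x. dev n x ^ (2 * j))"
      by (simp only: mean_add mean_const poly_bounded_intros')
    finally show ?case using elim(1) by linarith
  qed
  then show ?thesis by blast
qed

section \<open>Graded expansions\<close>

text \<open>\<open>ow i f\<close> says that \<open>f\<close> has weight at least \<open>i\<close>; \<open>gexp\<close> is an expansion into
  components of weights 0 to 4 with an error of weight 5.\<close>

locale graded =
  fixes F :: "'a filter" and W :: "'a \<Rightarrow> real"
  assumes W_bounded: "W \<in> O[F](\<lambda>_. 1)"
begin

definition ow :: "nat \<Rightarrow> ('a \<Rightarrow> real) \<Rightarrow> bool" where
  "ow i f \<longleftrightarrow> f \<in> O[F](\<lambda>z. W z ^ i)"

lemma ow_mono:
  assumes "ow i f" "j \<le> i" shows "ow j f"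
proof -
  have "(\<lambda>z. W z ^ (i - j)) \<in> O[F](\<lambda>z. 1 ^ (i - j))"
    using W_bounded by (rule landau_o.big_power)
  then have "(\<lambda>z. W z ^ j * W z ^ (i - j)) \<in> O[F](\<lambda>z. W z ^ j * 1)"
    by (intro landau_o.big.mult) auto
  also have "(\<lambda>z. W z ^ j * W z ^ (i - j)) = (\<lambda>z. W z ^ i)"
    using assms(2) by (simp add: power_add[symmetric])
  finally show ?thesis using assms(1) unfolding ow_def by (auto intro: landau_o.big_trans)
qed

lemma ow_mult: "ow i f \<Longrightarrow> ow j g \<Longrightarrow> k \<le> i + j \<Longrightarrow> ow k (\<lambda>z. f z * g z)"
  by (rule ow_mono[of "i + j"]) (auto simp: ow_def power_add intro: landau_o.big.mult)

lemma ow_add: "ow i f \<Longrightarrow> ow i g \<Longrightarrow> ow i (\<lambda>z. f z + g z)"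
  unfolding ow_def by (rule sum_in_bigo)

lemma ow_diff: "ow i f \<Longrightarrow> ow i g \<Longrightarrow> ow i (\<lambda>z. f z - g z)"
  unfolding ow_def by (rule sum_in_bigo)

lemma ow_const: "ow 0 (\<lambda>_. c)"
  by (simp add: ow_def)

lemma ow_cmult: "ow i f \<Longrightarrow> ow i (\<lambda>z. c * f z)"
  using ow_mult[OF ow_const, of i f i c] by simp

lemma ow_power: "ow i f \<Longrightarrow> ow (i * m) (\<lambda>z. f z ^ m)"
  unfolding ow_def power_mult by (rule landau_o.big_power)

lemma ow_cong:
  assumes "ow i f" "eventually (\<lambda>z. f z = g z) F" shows "ow i g"
  using assms unfolding ow_def by (simp add: landau_o.big.in_cong)

lemma ow_le:
  assumes "ow i g" "eventually (\<lambda>z. \<bar>f z\<bar> \<le> C * \<bar>g z\<bar>) F" shows "ow i f"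
proof -
  have "f \<in> O[F](g)" using assms(2) by (intro bigoI[of _ C]) simp
  then show ?thesis using assms(1) unfolding ow_def by (rule landau_o.big_trans)
qed

definition gexp :: "('a \<Rightarrow> real) \<Rightarrow> ('a \<Rightarrow> real) \<Rightarrow> ('a \<Rightarrow> real) \<Rightarrow> ('a \<Rightarrow> real) \<Rightarrow> ('a \<Rightarrow> real)
    \<Rightarrow> ('a \<Rightarrow> real) \<Rightarrow> bool" where
  "gexp f a0 a1 a2 a3 a4 \<longleftrightarrow> ow 0 a0 \<and> ow 1 a1 \<and> ow 2 a2 \<and> ow 3 a3 \<and> ow 4 a4 \<and>
     ow 5 (\<lambda>z. f z - (a0 z + a1 z + a2 z + a3 z + a4 z))"

lemma gexp_bounded: assumes "gexp f a0 a1 a2 a3 a4"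
  shows "ow 0 f" "ow 0 (\<lambda>z. a0 z + a1 z + a2 z + a3 z + a4 z)"
proof -
  note a = assms[unfolded gexp_def]
  show s: "ow 0 (\<lambda>z. a0 z + a1 z + a2 z + a3 z + a4 z)"
    using a by (intro ow_add) (auto elim!: ow_mono)
  have "ow 0 (\<lambda>z. (f z - (a0 z + a1 z + a2 z + a3 z + a4 z)) + (a0 z + a1 z + a2 z + a3 z + a4 z))"
    using a by (intro ow_add[OF _ s]) (auto elim!: ow_mono)
  then show "ow 0 f" by simp
qed

lemma gexp_mult:
  assumes f: "gexp f a0 a1 a2 a3 a4" and g: "gexp g b0 b1 b2 b3 b4"
  shows "gexp (\<lambda>z. f z * g z) (\<lambda>z. a0 z * b0 z) (\<lambda>z. a0 z * b1 z + a1 z * b0 z)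
    (\<lambda>z. a0 z * b2 z + a1 z * b1 z + a2 z * b0 z)
    (\<lambda>z. a0 z * b3 z + a1 z * b2 z + a2 z * b1 z + a3 z * b0 z)
    (\<lambda>z. a0 z * b4 z + a1 z * b3 z + a2 z * b2 z + a3 z * b1 z + a4 z * b0 z)"
proof -
  note a = f[unfolded gexp_def] and b = g[unfolded gexp_def]
  note m = ow_mult
  \<comment> \<open>The error of each factor times the other factor or its expansion, and all
    products of components of total weight 5 to 8.\<close>
  have "ow 5 (\<lambda>z. (f z - (a0 z + a1 z + a2 z + a3 z + a4 z)) * g z
      + (a0 z + a1 z + a2 z + a3 z + a4 z) * (g z - (b0 z + b1 z + b2 z + b3 z + b4 z))
      + a1 z * b4 z + a2 z * b3 z + a3 z * b2 z + a4 z * b1 z + a2 z * b4 z + a3 z * b3 z + a4 z * b2 z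
      + a3 z * b4 z + a4 z * b3 z + a4 z * b4 z)" (is "ow 5 ?f")
    apply (intro ow_add)
    subgoal by (rule m[of 5 _ 0]) (use a gexp_bounded[OF g] in auto)
    subgoal by (rule m[of 0 _ 5]) (use b gexp_bounded[OF f] in auto)
    subgoal by (rule m[of 1 _ 4]) (use a b in auto)
    subgoal by (rule m[of 2 _ 3]) (use a b in auto)
    subgoal by (rule m[of 3 _ 2]) (use a b in auto)
    subgoal by (rule m[of 4 _ 1]) (use a b in auto)
    subgoal by (rule m[of 2 _ 4]) (use a b in auto)
    subgoal by (rule m[of 3 _ 3]) (use a b in auto)
    subgoal by (rule m[of 4 _ 2]) (use a b in auto)
    subgoal by (rule m[of 3 _ 4]) (use a b in auto)
    subgoal by (rule m[of 4 _ 3]) (use a b in auto)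
    subgoal by (rule m[of 4 _ 4]) (use a b in auto)
    done
  also have "?f =
    (\<lambda>z. f z * g z - (a0 z * b0 z + (a0 z * b1 z + a1 z * b0 z) + (a0 z * b2 z + a1 z * b1 z + a2 z * b0 z)
      + (a0 z * b3 z + a1 z * b2 z + a2 z * b1 z + a3 z * b0 z)
      + (a0 z * b4 z + a1 z * b3 z + a2 z * b2 z + a3 z * b1 z + a4 z * b0 z)))"
    by (rule ext) algebra
  finally have rem: "ow 5 \<dots>" .
  show ?thesis
    unfolding gexp_def
    apply (intro conjI rem ow_add)
    subgoal by (rule m[of 0 _ 0]) (use a b in auto)
    subgoal by (rule m[of 0 _ 1]) (use a b in auto)
    subgoal by (rule m[of 1 _ 0]) (use a b in auto)
    subgoal by (rule m[of 0 _ 2]) (use a b in auto)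
    subgoal by (rule m[of 1 _ 1]) (use a b in auto)
    subgoal by (rule m[of 2 _ 0]) (use a b in auto)
    subgoal by (rule m[of 0 _ 3]) (use a b in auto)
    subgoal by (rule m[of 1 _ 2]) (use a b in auto)
    subgoal by (rule m[of 2 _ 1]) (use a b in auto)
    subgoal by (rule m[of 3 _ 0]) (use a b in auto)
    subgoal by (rule m[of 0 _ 4]) (use a b in auto)
    subgoal by (rule m[of 1 _ 3]) (use a b in auto)
    subgoal by (rule m[of 2 _ 2]) (use a b in auto)
    subgoal by (rule m[of 3 _ 1]) (use a b in auto)
    subgoal by (rule m[of 4 _ 0]) (use a b in auto)
    done
qed

lemma ow_exp_remainder:
  assumes "ow 1 X"
  shows "ow 5 (\<lambda>z. exp (X z) - (1 + X z + X z ^ 2 / 2 + X z ^ 3 / 6 + X z ^ 4 / 24))"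
proof -
  from ow_mono[OF assms, of 0] have "X \<in> O[F](\<lambda>_. 1)" by (simp add: ow_def)
  then obtain C where C: "eventually (\<lambda>z. \<bar>X z\<bar> \<le> C) F" by (auto elim!: landau_o.bigE)
  have "ow 5 (\<lambda>z. X z ^ 5)" using ow_power[OF assms, of 5] by simp
  then show ?thesis
  proof (rule ow_le)
    show "eventually (\<lambda>z. \<bar>exp (X z) - (1 + X z + X z ^ 2 / 2 + X z ^ 3 / 6 + X z ^ 4 / 24)\<bar>
      \<le> exp C / 24 * \<bar>X z ^ 5\<bar>) F"
      using C
    proof eventually_elim
      case (elim z)
      have "\<bar>exp (X z) - (\<Sum>i\<le>4. X z ^ i / fact i)\<bar> \<le> exp \<bar>X z\<bar> * (\<bar>X z\<bar> ^ Suc 4) / fact 4"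
        using Taylor_exp_field[of "X z" 4] by simp
      also have "exp \<bar>X z\<bar> * (\<bar>X z\<bar> ^ Suc 4) / fact 4 \<le> exp C * (\<bar>X z\<bar> ^ Suc 4) / fact 4"
        using elim by (intro divide_right_mono mult_right_mono) auto
      finally show ?case by (simp add: eval_nat_numeral fact_numeral power_abs abs_mult algebra_simps)
    qed
  qed
qed

text \<open>Without a component of weight 0 the powers of \<open>X\<close> start at weights 2, 3 and
  4, so the fourth-order Taylor polynomial suffices and \<open>gexp_mult\<close> sorts it by
  weight.\<close>

lemma gexp_exp:
  assumes "gexp X (\<lambda>_. 0) X1 X2 X3 X4"
  shows "ow 5 (\<lambda>z. exp (X z) - (1 + X1 z + (X2 z + X1 z ^ 2 / 2) + (X3 z + X1 z * X2 z + X1 z ^ 3 / 6)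
    + (X4 z + X1 z * X3 z + X2 z ^ 2 / 2 + X1 z ^ 2 * X2 z / 2 + X1 z ^ 4 / 24)))"
proof -
  note a = assms[unfolded gexp_def]
  have "ow 1 (\<lambda>z. (X z - (0 + X1 z + X2 z + X3 z + X4 z)) + (X1 z + X2 z + X3 z + X4 z))"
    by (intro ow_add) (use a in \<open>auto elim!: ow_mono\<close>)
  then have X: "ow 1 X" by simp
  note g2 = gexp_mult[OF assms assms]
  note g3 = gexp_mult[OF g2 assms] and g4 = gexp_mult[OF g2 g2]
  from g2 g3 g4 have r: "ow 5 (\<lambda>z. X z * X z - (X1 z * X1 z + (X1 z * X2 z + X2 z * X1 z) +
      (X1 z * X3 z + X2 z * X2 z + X3 z * X1 z)))"
    "ow 5 (\<lambda>z. X z * X z * X z - (X1 z * X1 z * X1 z + (X1 z * X1 z * X2 z + (X1 z * X2 z + X2 z * X1 z) * X1 z)))"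
    "ow 5 (\<lambda>z. X z * X z * (X z * X z) - X1 z * X1 z * (X1 z * X1 z))"
    by (simp_all add: gexp_def)
  have "ow 5 (\<lambda>z. (exp (X z) - (1 + X z + X z ^ 2 / 2 + X z ^ 3 / 6 + X z ^ 4 / 24))
     + (X z - (0 + X1 z + X2 z + X3 z + X4 z))
     + 1 / 2 * (X z * X z - (X1 z * X1 z + (X1 z * X2 z + X2 z * X1 z) +
      (X1 z * X3 z + X2 z * X2 z + X3 z * X1 z)))
     + 1 / 6 * (X z * X z * X z - (X1 z * X1 z * X1 z + (X1 z * X1 z * X2 z + (X1 z * X2 z + X2 z * X1 z) * X1 z)))
     + 1 / 24 * (X z * X z * (X z * X z) - X1 z * X1 z * (X1 z * X1 z)))" (is "ow 5 ?f")
    by (intro ow_add ow_cmult ow_exp_remainder X r) (use a in auto)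
  also have "?f =
    (\<lambda>z. exp (X z) - (1 + X1 z + (X2 z + X1 z ^ 2 / 2) + (X3 z + X1 z * X2 z + X1 z ^ 3 / 6)
    + (X4 z + X1 z * X3 z + X2 z ^ 2 / 2 + X1 z ^ 2 * X2 z / 2 + X1 z ^ 4 / 24)))"
    by (rule ext) (simp add: field_simps power2_eq_square power3_eq_cube power4_eq_xxxx)
  finally show ?thesis .
qed

end

text \<open>The error has derivative \<open>y ^ 4 / (1 + y)\<close>, which is at most
  \<open>2 * |x| ^ 4\<close> whenever \<open>|y| \<le> |x|\<close>.\<close>

lemma ln_one_plus_taylor:
  fixes x :: real
  assumes "\<bar>x\<bar> \<le> 1 / 2"
  shows "\<bar>ln (1 + x) - (x - x ^ 2 / 2 + x ^ 3 / 3 - x ^ 4 / 4)\<bar> \<le> 2 * \<bar>x\<bar> ^ 5"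
proof -
  define f where "f = (\<lambda>x::real. ln (1 + x) - (x - x ^ 2 / 2 + x ^ 3 / 3 - x ^ 4 / 4))"
  define S where "S = {- \<bar>x\<bar>..\<bar>x\<bar>}"
  have "norm (f x - f 0) \<le> (2 * \<bar>x\<bar> ^ 4) * norm (x - 0)"
  proof (rule field_differentiable_bound[of S])
    fix y assume "y \<in> S"
    then have y: "\<bar>y\<bar> \<le> \<bar>x\<bar>" "1 + y \<ge> 1 / 2" using assms by (auto simp: S_def)
    show "(f has_field_derivative y ^ 4 / (1 + y)) (at y within S)"
      unfolding f_def using y
      by (auto intro!: derivative_eq_intros simp: field_simps)
         (simp add: power2_eq_square power3_eq_cube power4_eq_xxxx algebra_simps)
    have "\<bar>y\<bar> ^ 4 / (1 + y) \<le> \<bar>x\<bar> ^ 4 / (1 / 2)"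
      using y by (intro frac_le power_mono) auto
    then show "norm (y ^ 4 / (1 + y)) \<le> 2 * \<bar>x\<bar> ^ 4" using y by (simp add: power_abs[symmetric])
  qed (auto simp: S_def)
  then show ?thesis by (simp add: f_def eval_nat_numeral algebra_simps)
qed

section \<open>Expansion of the weight ratio\<close>

text \<open>Pairs \<open>(n, x)\<close> with \<open>n\<close> tending to infinity and \<open>alpha n * \<bar>x - cen n\<bar> \<le> cen n / 2\<close>; nothing
  is required of \<open>x\<close> beyond this, so bounds along the filter are uniform in \<open>x\<close>.\<close>

definition near :: "(nat \<times> real) filter" where
  "near = inf (filtercomap fst sequentially) (principal {(n, x). alpha n * \<bar>x - cen n\<bar> \<le> cen n / 2})"

lemma eventually_near:
  "eventually P near \<longleftrightarrow>
    (\<forall>\<^sub>F n in sequentially. \<forall>x. alpha n * \<bar>x - cen n\<bar> \<le> cen n / 2 \<longrightarrow> P (n, x))"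
  unfolding near_def eventually_inf_principal eventually_filtercomap eventually_sequentially
  by (auto; metis fst_conv order_refl)

text \<open>Dominates both \<open>alpha n * eps n\<close> and \<open>alpha n\<close> times the
  relative deviation: in the expansion every factor \<open>alpha n\<close> is accompanied by an
  \<open>eps n\<close> or a relative deviation of its own.\<close>

definition near_size :: "nat \<times> real \<Rightarrow> real" where
  "near_size = (\<lambda>(n, x). alpha n * eps n * (1 + \<bar>dev n x\<bar>))"

text \<open>The Taylor polynomial of \<open>ratio n (cen n * (1 + v))\<close> in \<open>v\<close> and \<open>1 / cen n = eps n ^ 2\<close>, where \<open>v\<close>
  has weight 1 and \<open>1 / cen n\<close> weight 2, truncated after weight 4.\<close>

definition ratio_poly :: "nat \<Rightarrow> real \<Rightarrow> real" where
  "ratio_poly n v = (let s = 1 + alpha n; d = eps n ^ 2 in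
      1 + d * ((3/2 - 1/2 * s) + d * (1/8 * s^2 - 13/12 * s + 47/24))
      + (s + d * (5/2 * s - 1/2 * s^2 - 2)) * v
      + ((1/2 * s^2 - s + 1/2) + d * (9/4 * s^2 - 1/4 * s^3 - 21/4 * s + 13/4)) * v^2
      + (1/6 * s^3 - s^2 + 3/2 * s - 2/3) * v^3
      + (1/24 * s^4 - 1/2 * s^3 + 7/4 * s^2 - 13/6 * s + 7/8) * v^4)"

lemma eps_dev: "eps n * dev n x = (x - cen n) / cen n"
proof -
  have "eps n * dev n x = (x - cen n) * eps n ^ 2" by (simp add: dev_def power2_eq_square)
  then show ?thesis by (simp add: eps_square)
qed

lemma near_size_ge:
  assumes "alpha n \<ge> 1"
  shows "alpha n * \<bar>eps n * dev n x\<bar> \<le> near_size (n, x)" "alpha n * eps n \<le> near_size (n, x)"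
    "0 < near_size (n, x)"
  using assms eps_pos[of n]
  by (auto simp: near_size_def abs_mult algebra_simps add_pos_nonneg)

lemma ratio_eq_exp:
  assumes "alpha n \<ge> 1" "cen n \<ge> 8" "alpha n * \<bar>x - cen n\<bar> \<le> cen n / 2"
  defines "v \<equiv> (x - cen n) / cen n"
  shows "\<bar>v\<bar> \<le> 1 / 2" "x = cen n * (1 + v)" "0 < 1 / x" "1 / x \<le> 1 / 2"
    "ratio n x = exp (alpha n + ln (1 + v) + real n * ln (1 - 1 / x))"
proof -
  have c: "cen n > 0" using assms by simp
  have "1 * \<bar>x - cen n\<bar> \<le> alpha n * \<bar>x - cen n\<bar>" using assms(1) by (intro mult_right_mono) auto
  from order_trans[OF this assms(3)] have d: "\<bar>x - cen n\<bar> \<le> cen n / 2" by simp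
  show v: "\<bar>v\<bar> \<le> 1 / 2" unfolding v_def using d c by (simp add: abs_divide field_simps)
  show x: "x = cen n * (1 + v)" using c by (simp add: v_def field_simps)
  have "x \<ge> cen n / 2" using d by linarith
  then have x4: "x \<ge> 4" using assms by linarith
  then show "0 < 1 / x" "1 / x \<le> 1 / 2" by (auto simp: field_simps)
  have ex: "exp (alpha n + ln (1 + v)) = x" using v x by (simp add: exp_add cen_def)
  have pw: "exp (real n * ln (1 - 1 / x)) = (1 - 1 / x) ^ n"
    using x4 \<open>1 / x \<le> 1 / 2\<close> by (simp add: exp_of_nat_mult)
  show "ratio n x = exp (alpha n + ln (1 + v) + real n * ln (1 - 1 / x))"
    unfolding exp_add[of "alpha n + ln (1 + v)"] ex pw using x4 by (simp add: ratio_def)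
qed

lemma eventually_near_base:
  "eventually (\<lambda>(n, x). alpha n \<ge> 1 \<and> cen n \<ge> 8 \<and> alpha n * \<bar>x - cen n\<bar> \<le> cen n / 2) near"
proof -
  have "\<forall>\<^sub>F x::real in at_top. exp x \<ge> 8" by real_asymp
  then have "\<forall>\<^sub>F n in sequentially. cen n \<ge> 8"
    unfolding cen_def by (rule eventually_compose_alpha)
  with eventually_alpha_large[of 1] show ?thesis
    unfolding eventually_near by eventually_elim auto
qed

lemma near_size_bounded: "near_size \<in> O[near](\<lambda>_. 1)"
proof -
  have "\<forall>\<^sub>F x::real in at_top. x * exp (- x / 2) \<le> 1" by real_asymp
  then have small: "\<forall>\<^sub>F n in sequentially. alpha n * eps n \<le> 1"
    unfolding eps_def by (rule eventually_compose_alpha)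
  show ?thesis
  proof (rule bigoI[of _ 2])
    show "eventually (\<lambda>z. norm (near_size z) \<le> 2 * norm (1::real)) near"
      unfolding eventually_near using small
    proof (eventually_elim, intro allI impI)
      fix n x assume n: "alpha n * eps n \<le> 1" and x: "alpha n * \<bar>x - cen n\<bar> \<le> cen n / 2"
      have "alpha n * \<bar>eps n * dev n x\<bar> \<le> 1 / 2"
        unfolding eps_dev using x cen_gt_1[of n] by (simp add: abs_divide field_simps)
      then have "near_size (n, x) \<le> 2" using n eps_pos[of n]
        by (simp add: near_size_def abs_mult algebra_simps)
      moreover have "0 \<le> near_size (n, x)" using alpha_pos[of n] eps_pos[of n]
        by (simp add: near_size_def)
      ultimately show "norm (near_size (n, x)) \<le> 2 * norm (1::real)" by simp
    qed
  qed
qed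

interpretation near: graded near near_size
  by unfold_locales (rule near_size_bounded)

text \<open>The exponent of \<open>ratio_eq_exp\<close> is expanded after the substitutions
  \<open>n = A / T - 1\<close> and \<open>1 / x = T * J\<close>. The leading term
  \<open>- A * J\<close> of \<open>n * ln (1 - 1 / x)\<close> cancels the constant \<open>A\<close>
  up to weight 1; the exponent therefore has no component of weight 0, as \<open>gexp_exp\<close>
  requires.\<close>

lemma ratio_near:
  "near.ow 5 (\<lambda>(n, x). ratio n x - ratio_poly n (eps n * dev n x))"
proof -
  define A where "A = (\<lambda>(n::nat, x::real). alpha n)"
  define T where "T = (\<lambda>(n::nat, x::real). eps n ^ 2)"
  define V where "V = (\<lambda>(n, x). eps n * dev n x)"
  define J where "J = (\<lambda>z. 1 / (1 + V z))"
  define R where "R = (\<lambda>x::real. ln (1 + x) - (x - x ^ 2 / 2 + x ^ 3 / 3 - x ^ 4 / 4))"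
  define X where "X = (\<lambda>(n, x). alpha n + ln (1 + (x - cen n) / cen n) + real n * ln (1 - 1 / x))"
  note m = near.ow_mult
  have base: "eventually (\<lambda>z. A z \<ge> 1 \<and> \<bar>V z\<bar> \<le> 1 / 2 \<and> A z * \<bar>V z\<bar> \<le> near_size z \<and> T z > 0
      \<and> A z ^ 2 * T z \<le> near_size z ^ 2 \<and> \<bar>T z * J z\<bar> \<le> 1 / 2 \<and> near_size z > 0) near"
    using eventually_near_base
  proof eventually_elim
    case (elim z)
    obtain n x where z: "z = (n, x)" by (cases z)
    have h: "alpha n \<ge> 1" "cen n \<ge> 8" "alpha n * \<bar>x - cen n\<bar> \<le> cen n / 2" using elim z by auto
    note r = ratio_eq_exp[OF h]
    have TJ: "T z * J z = 1 / x"
      using r(2) h(2) eps_square[of n] unfolding T_def J_def V_def z eps_dev case_prod_conv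
      by (metis divide_divide_eq_left mult.left_neutral times_divide_eq_right mult.commute)
    have "(alpha n * eps n) ^ 2 \<le> near_size z ^ 2"
      using near_size_ge(2)[OF h(1), of x] h(1) eps_pos[of n] unfolding z by (intro power_mono) auto
    then show ?case
      using r(1,3,4) h near_size_ge[OF h(1), of x] eps_pos[of n] TJ
      by (auto simp: A_def V_def T_def z eps_dev power_mult_distrib abs_mult)
  qed
  have AV: "near.ow 1 (\<lambda>z. A z * V z)"
    unfolding near.ow_def using base by (intro bigoI[of _ 1]) (auto elim!: eventually_mono simp: abs_mult)
  have V: "near.ow 1 V"
  proof (rule near.ow_le[OF AV, of _ 1])
    show "eventually (\<lambda>z. \<bar>V z\<bar> \<le> 1 * \<bar>A z * V z\<bar>) near"
      using base
    proof eventually_elim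
      case (elim z)
      then have "1 * \<bar>V z\<bar> \<le> \<bar>A z\<bar> * \<bar>V z\<bar>" by (intro mult_right_mono) auto
      then show ?case by (simp add: abs_mult)
    qed
  qed
  have A2T: "near.ow 2 (\<lambda>z. A z ^ 2 * T z)"
    unfolding near.ow_def using base by (intro bigoI[of _ 1]) (auto elim!: eventually_mono simp: abs_mult)
  have AT: "near.ow 2 (\<lambda>z. A z * T z)"
  proof (rule near.ow_le[OF A2T, of _ 1])
    show "eventually (\<lambda>z. \<bar>A z * T z\<bar> \<le> 1 * \<bar>A z ^ 2 * T z\<bar>) near"
      using base
    proof eventually_elim
      case (elim z)
      then have "1 * (A z * T z) \<le> A z * (A z * T z)" by (intro mult_right_mono) auto
      then show ?case using elim by (simp add: abs_mult power2_eq_square mult_ac)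
    qed
  qed
  have T: "near.ow 2 T"
  proof (rule near.ow_le[OF AT, of _ 1])
    show "eventually (\<lambda>z. \<bar>T z\<bar> \<le> 1 * \<bar>A z * T z\<bar>) near"
      using base
    proof eventually_elim
      case (elim z)
      then have "1 * T z \<le> A z * T z" by (intro mult_right_mono) auto
      then show ?case using elim by (simp add: abs_mult)
    qed
  qed
  have J: "near.ow 0 J"
    unfolding near.ow_def
  proof (rule bigoI[of _ 2])
    show "eventually (\<lambda>z. norm (J z) \<le> 2 * norm (near_size z ^ 0)) near"
      using base
    proof eventually_elim
      case (elim z)
      then have "1 + V z \<ge> 1 / 2" by auto
      then show ?case by (simp add: J_def field_simps abs_if)
    qed
  qed
  have J2: "near.ow 0 (\<lambda>z. J z ^ 2)" and J3: "near.ow 0 (\<lambda>z. J z ^ 3)" and J4: "near.ow 0 (\<lambda>z. J z ^ 4)"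
    using near.ow_power[OF J, of 2] near.ow_power[OF J, of 3] near.ow_power[OF J, of 4] by simp_all
  have V2: "near.ow 2 (\<lambda>z. V z ^ 2)" and V3: "near.ow 3 (\<lambda>z. V z ^ 3)" and V4: "near.ow 4 (\<lambda>z. V z ^ 4)"
    and V5: "near.ow 5 (\<lambda>z. V z ^ 5)"
    using near.ow_power[OF V, of 2] near.ow_power[OF V, of 3] near.ow_power[OF V, of 4]
      near.ow_power[OF V, of 5] by simp_all
  have AVp: "near.ow 2 (\<lambda>z. A z * V z ^ 2)" "near.ow 3 (\<lambda>z. A z * V z ^ 3)" "near.ow 4 (\<lambda>z. A z * V z ^ 4)"
    "near.ow 5 (\<lambda>z. A z * V z ^ 5)"
    using m[OF AV V, of 2] m[OF AV V2, of 3] m[OF AV V3, of 4] m[OF AV V4, of 5]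
    by (simp_all add: mult.assoc eval_nat_numeral)
  have TJ: "near.ow 2 (\<lambda>z. T z * J z)" by (rule m[OF T J]) simp
  have RV: "near.ow 5 (\<lambda>z. R (V z))"
    by (rule near.ow_le[OF V5, of _ 2])
       (use base in \<open>eventually_elim, auto simp: R_def power_abs intro!: ln_one_plus_taylor\<close>)
  \<comment> \<open>The prefactor is \<open>n\<close>, which costs a factor \<open>T\<close>, but
    the fifth-order logarithmic error still leaves \<open>A * T ^ 4\<close>, of weight 8.\<close>
  have nR: "near.ow 5 (\<lambda>z. (A z / T z - 1) * R (- (T z * J z)))"
  proof (rule near.ow_le)
    have TJ5: "near.ow 6 (\<lambda>z. T z ^ 3 * J z ^ 5)"
      using m[OF near.ow_power[OF T, of 3] near.ow_power[OF J, of 5], of 6] by simp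
    show "near.ow 5 (\<lambda>z. A z * T z * (T z ^ 3 * J z ^ 5))"
      by (rule m[OF AT TJ5]) simp
    show "eventually (\<lambda>z. \<bar>(A z / T z - 1) * R (- (T z * J z))\<bar>
       \<le> 4 * \<bar>A z * T z * (T z ^ 3 * J z ^ 5)\<bar>) near"
      using base eventually_near_base
    proof eventually_elim
      case (elim z)
      obtain n x where z: "z = (n, x)" by (cases z)
      have nn: "0 \<le> A z / T z - 1"
        using n_eq[of n] eps_square[of n] by (simp add: A_def T_def z)
      have T0: "T z > 0" using elim by simp
      have R: "\<bar>R (- (T z * J z))\<bar> \<le> 2 * \<bar>T z * J z\<bar> ^ 5"
        using ln_one_plus_taylor[of "- (T z * J z)"] elim by (simp add: R_def)
      have "\<bar>(A z / T z - 1) * R (- (T z * J z))\<bar> \<le> (A z / T z) * (2 * \<bar>T z * J z\<bar> ^ 5)"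
        unfolding abs_mult[of "A z / T z - 1"] using nn R by (intro mult_mono) auto
      also have "\<dots> = 2 * \<bar>A z * T z * (T z ^ 3 * J z ^ 5)\<bar>"
        using elim T0 by (simp add: abs_mult power_mult_distrib power_abs eval_nat_numeral)
      finally show ?case by simp
    qed
  qed
  define X1 where "X1 = (\<lambda>z. V z + A z * V z)"
  define X2 where "X2 = (\<lambda>z. - 1 / 2 * V z ^ 2 - A z * V z ^ 2 + T z - 1 / 2 * (A z * T z))"
  define X3 where "X3 = (\<lambda>z. 1 / 3 * V z ^ 3 + A z * V z ^ 3 - T z * V z + A z * T z * V z)"
  define X4 where "X4 = (\<lambda>z. - 1 / 4 * V z ^ 4 - A z * V z ^ 4 + T z * V z ^ 2 - 3 / 2 * (A z * T z * V z ^ 2)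
     + 1 / 2 * (T z * T z) - 1 / 3 * (A z * T z * T z))"
  \<comment> \<open>The exact remainder of the exponent: the errors of the two logarithms, the
    truncation errors of \<open>J\<close>, \<open>J ^ 2\<close> and \<open>J ^ 3\<close> as series
    in \<open>V\<close>, and the terms with at least three factors \<open>T\<close>, kept
    whole.\<close>
  define Q where "Q = (\<lambda>z. R (V z) + A z * V z ^ 5 * J z - T z * J z * V z ^ 3
     + 1 / 2 * (A z * T z * V z ^ 3 * ((4 + 3 * V z) * J z ^ 2))
     - 1 / 2 * (T z * T z * V z * ((2 + V z) * J z ^ 2))
     + 1 / 3 * (A z * T z * T z * V z * ((3 + 3 * V z + V z ^ 2) * J z ^ 3))
     + 1 / 3 * (T z * T z * T z * J z ^ 3)
     - 1 / 4 * (A z * T z * T z * T z * J z ^ 4) + 1 / 4 * (T z * T z * T z * T z * J z ^ 4)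
     + (A z / T z - 1) * R (- (T z * J z)))"
  have rem: "near.ow 5 Q"
  proof -
    have V0: "near.ow 0 V" "near.ow 0 (\<lambda>z. V z ^ 2)"
      using near.ow_mono[OF V] near.ow_mono[OF V2] by auto
    have c0: "near.ow 0 (\<lambda>z. (4 + 3 * V z) * J z ^ 2)" "near.ow 0 (\<lambda>z. (2 + V z) * J z ^ 2)"
      "near.ow 0 (\<lambda>z. (3 + 3 * V z + V z ^ 2) * J z ^ 3)"
      by (intro m[of 0 _ 0] near.ow_add near.ow_cmult near.ow_const V0 J2 J3; simp)+
    have TT: "near.ow 4 (\<lambda>z. T z * T z)" by (rule m[OF T T]) simp
    have TTT: "near.ow 6 (\<lambda>z. T z * T z * T z)" by (rule m[OF TT T]) simp
    have TTTT: "near.ow 8 (\<lambda>z. T z * T z * T z * T z)" by (rule m[OF TTT T]) simp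
    have ATT: "near.ow 4 (\<lambda>z. A z * T z * T z)" by (rule m[OF AT T]) simp
    have ATTT: "near.ow 6 (\<lambda>z. A z * T z * T z * T z)" by (rule m[OF ATT T]) simp
    have p: "near.ow 5 (\<lambda>z. A z * T z * V z ^ 3)" "near.ow 5 (\<lambda>z. T z * T z * V z)"
      "near.ow 5 (\<lambda>z. A z * T z * T z * V z)"
      using m[OF AT V3] m[OF TT V] m[OF ATT V] by simp_all
    show ?thesis
      unfolding Q_def
      apply (intro near.ow_add near.ow_diff near.ow_cmult RV nR)
      subgoal by (rule m[OF AVp(4) J]) simp
      subgoal by (rule m[OF TJ V3]) simp
      subgoal by (rule m[OF p(1) c0(1)]) simp
      subgoal by (rule m[OF p(2) c0(2)]) simp
      subgoal by (rule m[OF p(3) c0(3)]) simp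
      subgoal by (rule m[OF TTT J3]) simp
      subgoal by (rule m[OF ATTT J4]) simp
      subgoal by (rule m[OF TTTT J4]) simp
      done
  qed
  have "near.gexp X (\<lambda>_. 0) X1 X2 X3 X4"
    unfolding near.gexp_def
  proof (intro conjI)
    have TT: "near.ow 4 (\<lambda>z. T z * T z)" by (rule m[OF T T]) simp
    have ATT: "near.ow 4 (\<lambda>z. A z * T z * T z)" by (rule m[OF AT T]) simp
    have tv: "near.ow 3 (\<lambda>z. T z * V z)" "near.ow 3 (\<lambda>z. A z * T z * V z)"
      "near.ow 4 (\<lambda>z. T z * V z ^ 2)" "near.ow 4 (\<lambda>z. A z * T z * V z ^ 2)"
      using m[OF T V] m[OF AT V] m[OF T V2] m[OF AT V2] by simp_all
    show "near.ow 0 (\<lambda>_. 0)" by (rule near.ow_const)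
    show "near.ow 1 X1" unfolding X1_def by (intro near.ow_add V AV)
    show "near.ow 2 X2" unfolding X2_def by (intro near.ow_add near.ow_diff near.ow_cmult V2 AVp T AT)
    show "near.ow 3 X3" unfolding X3_def by (intro near.ow_add near.ow_diff near.ow_cmult V3 AVp tv)
    show "near.ow 4 X4" unfolding X4_def by (intro near.ow_add near.ow_diff near.ow_cmult V4 AVp tv TT ATT)
    show "near.ow 5 (\<lambda>z. X z - (0 + X1 z + X2 z + X3 z + X4 z))"
    proof (rule near.ow_cong[OF rem])
      show "eventually (\<lambda>z. Q z = X z - (0 + X1 z + X2 z + X3 z + X4 z)) near"
        using base eventually_near_base
      proof eventually_elim
        case (elim z)
        obtain n x where z: "z = (n, x)" by (cases z)
        have h: "alpha n \<ge> 1" "cen n \<ge> 8" "alpha n * \<bar>x - cen n\<bar> \<le> cen n / 2" using elim z by auto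
        note r = ratio_eq_exp[OF h]
        define a t v j where "a = A z" and "t = T z" and "v = V z" and "j = J z"
        have t0: "t > 0" using elim by (simp add: t_def)
        have v: "v = (x - cen n) / cen n" by (simp add: v_def V_def z eps_dev)
        have v1: "1 + v \<ge> 1 / 2" using elim by (auto simp: v_def)
        have jv: "j * (1 + v) = 1" using v1 by (simp add: j_def J_def v_def)
        have c: "cen n = 1 / t" using eps_square[of n] by (simp add: t_def T_def z)
        have nn: "real n = a / t - 1" using n_eq[of n] c by (simp add: a_def A_def z)
        have x: "1 / x = t * j"
        proof -
          have "t * x = 1 + v" using r(2) c t0 unfolding v[symmetric] by simp
          then have "(t * j) * x = 1" using jv by algebra
          then show ?thesis by (metis divide_eq_eq mult_zero_right zero_neq_one)
        qed
        have Xz: "X z = a + ln (1 + v) + (a / t - 1) * ln (1 - t * j)"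
          unfolding X_def z case_prod_conv nn x v[symmetric] by (simp add: a_def A_def z)
        define L1 L2 where "L1 = ln (1 + v)" and "L2 = ln (1 - t * j)"
        have RV: "R v = L1 - (v - v ^ 2 / 2 + v ^ 3 / 3 - v ^ 4 / 4)" by (simp add: R_def L1_def)
        have RT: "R (- (t * j)) = L2 - (- (t * j) - (t * j) ^ 2 / 2 - (t * j) ^ 3 / 3 - (t * j) ^ 4 / 4)"
          by (simp add: R_def L2_def)
        \<comment> \<open>Removes the division: with \<open>a = b * t\<close> the claim is a
          polynomial identity modulo \<open>j * (1 + v) = 1\<close>.\<close>
        define b where "b = a / t"
        have a: "a = b * t" using t0 by (simp add: b_def)
        show ?case
          unfolding Q_def Xz X1_def X2_def X3_def X4_def a_def[symmetric] t_def[symmetric] v_def[symmetric]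
            j_def[symmetric] L1_def[symmetric] L2_def[symmetric] RV RT b_def[symmetric] unfolding a
          using jv by algebra
      qed
    qed
  qed
  from near.gexp_exp[OF this]
  show ?thesis
  proof (rule near.ow_cong)
    show "eventually (\<lambda>z. exp (X z) - (1 + X1 z + (X2 z + X1 z ^ 2 / 2) + (X3 z + X1 z * X2 z + X1 z ^ 3 / 6)
      + (X4 z + X1 z * X3 z + X2 z ^ 2 / 2 + X1 z ^ 2 * X2 z / 2 + X1 z ^ 4 / 24)) =
        (case z of (n, x) \<Rightarrow> ratio n x - ratio_poly n (eps n * dev n x))) near"
      using eventually_near_base
    proof eventually_elim
      case (elim z)
      obtain n x where z: "z = (n, x)" by (cases z)
      have h: "alpha n \<ge> 1" "cen n \<ge> 8" "alpha n * \<bar>x - cen n\<bar> \<le> cen n / 2" using elim z by auto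
      have e: "exp (X z) = ratio n x" using ratio_eq_exp(5)[OF h] by (simp add: X_def z)
      define a t v where "a = A z" and "t = T z" and "v = V z"
      have p: "ratio_poly n (eps n * dev n x) = 1 + X1 z + (X2 z + X1 z ^ 2 / 2) + (X3 z + X1 z * X2 z + X1 z ^ 3 / 6)
      + (X4 z + X1 z * X3 z + X2 z ^ 2 / 2 + X1 z ^ 2 * X2 z / 2 + X1 z ^ 4 / 24)"
      proof -
        have eqs: "alpha n = a" "eps n ^ 2 = t" "eps n * dev n x = v"
          by (simp_all add: a_def t_def v_def A_def T_def V_def z)
        show ?thesis
          unfolding ratio_poly_def Let_def eqs X1_def X2_def X3_def X4_def a_def[symmetric]
            t_def[symmetric] v_def[symmetric]
          by (simp add: field_simps power2_eq_square power3_eq_cube power4_eq_xxxx)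
      qed
      show ?case unfolding e p[symmetric] by (simp add: z)
    qed
  qed
qed

text \<open>Near the centre this is \<open>ratio_near\<close>. Elsewhere \<open>near_size\<close>
  exceeds \<open>1 / 2\<close>, so crude bounds by its powers suffice: ratio and polynomial are at
  most a multiple of \<open>cen n * near_size ^ 4\<close>, and raising the exponent to 8 supplies
  \<open>eps n ^ 8\<close>, of which \<open>cen n\<close> consumes two factors.\<close>

lemma ratio_taylor:
  "\<exists>C. \<forall>\<^sub>F n in sequentially. \<forall>x.
     \<bar>ratio n x - ratio_poly n (eps n * dev n x)\<bar> \<le> C * (alpha n ^ 8 * eps n ^ 5 * (1 + \<bar>dev n x\<bar>) ^ 8)"
proof -
  from ratio_near[unfolded near.ow_def] obtain C where C0: "C > 0" and
    C: "eventually (\<lambda>z. norm (case z of (n, x) \<Rightarrow> ratio n x - ratio_poly n (eps n * dev n x))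
          \<le> C * norm (near_size z ^ 5)) near"
    by (rule landau_o.bigE)
  \<comment> \<open>The sum of the absolute values of the coefficients of \<open>ratio_poly\<close>,
    as a polynomial in \<open>1 + alpha n\<close>, \<open>eps n ^ 2\<close> and \<open>v\<close>.
    The factor 256 below is \<open>2 ^ 8\<close>, from \<open>b = 2 * W\<close>.\<close>
  define K :: real where "K = 203/6"
  have "\<forall>\<^sub>F n in sequentially. \<forall>x.
     \<bar>ratio n x - ratio_poly n (eps n * dev n x)\<bar>
       \<le> (C + (2 + K) * 256) * (alpha n ^ 8 * eps n ^ 5 * (1 + \<bar>dev n x\<bar>) ^ 8)"
    using C[unfolded eventually_near] eventually_alpha_large[of 1]
  proof (eventually_elim, intro allI)
    fix n x
    assume near: "\<forall>x. alpha n * \<bar>x - cen n\<bar> \<le> cen n / 2 \<longrightarrow>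
      norm (case (n, x) of (n, x) \<Rightarrow> ratio n x - ratio_poly n (eps n * dev n x)) \<le> C * norm (near_size (n, x) ^ 5)"
      and al: "1 \<le> alpha n"
    define W where "W = near_size (n, x)"
    define E where "E = alpha n ^ 8 * eps n ^ 5 * (1 + \<bar>dev n x\<bar>) ^ 8"
    have e: "0 < eps n" "eps n \<le> 1" using eps_pos eps_le_1 by auto
    have W: "alpha n * \<bar>eps n * dev n x\<bar> \<le> W" "alpha n * eps n \<le> W" "0 < W"
      using near_size_ge[OF al, of x] by (auto simp: W_def)
    have E0: "0 \<le> E" using al e by (simp add: E_def)
    have W_eq: "W = alpha n * eps n * (1 + \<bar>dev n x\<bar>)" by (simp add: W_def near_size_def)
    show "\<bar>ratio n x - ratio_poly n (eps n * dev n x)\<bar>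
       \<le> (C + (2 + K) * 256) * (alpha n ^ 8 * eps n ^ 5 * (1 + \<bar>dev n x\<bar>) ^ 8)"
    proof (cases "alpha n * \<bar>x - cen n\<bar> \<le> cen n / 2")
      case True
      have "alpha n ^ 5 \<le> alpha n ^ 8" "(1 + \<bar>dev n x\<bar>) ^ 5 \<le> (1 + \<bar>dev n x\<bar>) ^ 8"
        using al by (auto intro!: power_increasing)
      then have "W ^ 5 \<le> E"
        unfolding W_eq E_def power_mult_distrib using al e by (intro mult_mono order_refl) auto
      have "\<bar>ratio n x - ratio_poly n (eps n * dev n x)\<bar> \<le> C * W ^ 5"
        using near[rule_format, OF True] W(3) by (simp add: W_def[symmetric])
      also have "\<dots> \<le> C * E" using \<open>W ^ 5 \<le> E\<close> C0 by (intro mult_left_mono) auto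
      also have "\<dots> \<le> (C + (2 + K) * 256) * E" using E0 by (intro mult_right_mono) (auto simp: K_def)
      finally show ?thesis by (simp add: E_def)
    next
      case False
      define s d v b where "s = 1 + alpha n" and "d = eps n ^ 2" and "v = eps n * dev n x" and "b = 2 * W"
      have c: "cen n > 0" using cen_gt_1[of n] by simp
      have "alpha n * \<bar>v\<bar> > 1 / 2"
        using False c unfolding v_def eps_dev by (simp add: abs_divide field_simps)
      then have W2: "W > 1 / 2" using W(1) by (simp add: v_def)
      then have b1: "b \<ge> 1" by (simp add: b_def)
      have s: "1 \<le> s" "s \<le> 2 * alpha n" using al by (auto simp: s_def)
      have "s * eps n \<le> (2 * alpha n) * eps n" using s e by (intro mult_right_mono) auto
      then have se: "s * eps n \<le> b" using W(2) by (simp add: b_def)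
      have "s * \<bar>v\<bar> \<le> (2 * alpha n) * \<bar>v\<bar>" using s by (intro mult_right_mono) auto
      then have sv: "s * \<bar>v\<bar> \<le> b" using W(1) by (simp add: b_def v_def)
      have "1 * \<bar>v\<bar> \<le> alpha n * \<bar>v\<bar>" using al by (intro mult_right_mono) auto
      then have vW: "\<bar>v\<bar> \<le> W" using W(1) by (simp add: v_def)
      \<comment> \<open>In the monomials that occur, the exponent of \<open>s\<close> is at most the
        weight \<open>2 * k + i\<close>; each \<open>s\<close> pairs with an \<open>eps n\<close> or
        a \<open>v\<close>, and each such product is at most \<open>b\<close>.\<close>
      define mon where "mon = (\<lambda>a k i. s ^ a * d ^ k * v ^ i)"
      have mb: "\<bar>mon a k i\<bar> \<le> b ^ 4" if "a \<le> 2 * k + i" "2 * k + i \<le> 4" for a k i :: nat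
      proof -
        have "\<bar>mon a k i\<bar> = s ^ a * (eps n ^ (2 * k) * \<bar>v\<bar> ^ i)"
          using s e by (simp add: mon_def d_def abs_mult power_abs power_mult)
        also have "\<dots> \<le> s ^ (2 * k + i) * (eps n ^ (2 * k) * \<bar>v\<bar> ^ i)"
          using s e that by (intro mult_right_mono power_increasing) auto
        also have "\<dots> = (s * eps n) ^ (2 * k) * (s * \<bar>v\<bar>) ^ i"
          by (simp add: power_mult_distrib power_add)
        also have "\<dots> \<le> b ^ (2 * k) * b ^ i"
          using se sv s e b1 by (intro mult_mono power_mono) auto
        also have "\<dots> = b ^ (2 * k + i)" by (simp add: power_add)
        also have "\<dots> \<le> b ^ 4" using b1 that by (intro power_increasing) auto
        finally show ?thesis .
      qed
      have P: "ratio_poly n v = 7/8 * mon 0 0 4 + 13/4 * mon 0 1 2 - 2/3 * mon 0 0 3 + 47/24 * mon 0 2 0 - 2 * mon 0 1 1 +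
          1/2 * mon 0 0 2 + 3/2 * mon 0 1 0 + 1 * mon 0 0 0 - 13/6 * mon 1 0 4 - 21/4 * mon 1 1 2 +
          3/2 * mon 1 0 3 - 13/12 * mon 1 2 0 + 5/2 * mon 1 1 1 - 1 * mon 1 0 2 - 1/2 * mon 1 1 0 +
          1 * mon 1 0 1 + 7/4 * mon 2 0 4 + 9/4 * mon 2 1 2 - 1 * mon 2 0 3 + 1/8 * mon 2 2 0 - 1/2
          * mon 2 1 1 + 1/2 * mon 2 0 2 - 1/2 * mon 3 0 4 - 1/4 * mon 3 1 2 + 1/6 * mon 3 0 3 + 1/24
          * mon 4 0 4"
        unfolding ratio_poly_def Let_def s_def[symmetric] d_def[symmetric] mon_def
        by (simp add: algebra_simps power2_eq_square)
      have mb': "mon a k i \<le> b ^ 4" "- mon a k i \<le> b ^ 4" if "a \<le> 2 * k + i" "2 * k + i \<le> 4" for a k i :: nat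
        using mb[OF that] by (auto simp: abs_le_iff)
      have Pb: "\<bar>ratio_poly n v\<bar> \<le> K * b ^ 4"
      proof -
        have 1: "mon 0 0 4 \<le> b ^ 4" "mon 0 1 2 \<le> b ^ 4" "mon 0 0 3 \<le> b ^ 4" "mon 0 2 0 \<le> b ^ 4"
          "mon 0 1 1 \<le> b ^ 4" "mon 0 0 2 \<le> b ^ 4" "mon 0 1 0 \<le> b ^ 4" "mon 0 0 0 \<le> b ^ 4"
          "mon 1 0 4 \<le> b ^ 4" "mon 1 1 2 \<le> b ^ 4" "mon 1 0 3 \<le> b ^ 4" "mon 1 2 0 \<le> b ^ 4"
          "mon 1 1 1 \<le> b ^ 4" "mon 1 0 2 \<le> b ^ 4" "mon 1 1 0 \<le> b ^ 4" "mon 1 0 1 \<le> b ^ 4"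
          "mon 2 0 4 \<le> b ^ 4" "mon 2 1 2 \<le> b ^ 4" "mon 2 0 3 \<le> b ^ 4" "mon 2 2 0 \<le> b ^ 4"
          "mon 2 1 1 \<le> b ^ 4" "mon 2 0 2 \<le> b ^ 4" "mon 3 0 4 \<le> b ^ 4" "mon 3 1 2 \<le> b ^ 4"
          "mon 3 0 3 \<le> b ^ 4" "mon 4 0 4 \<le> b ^ 4"
          by (rule mb'; simp)+
        have 2: "- mon 0 0 4 \<le> b ^ 4" "- mon 0 1 2 \<le> b ^ 4" "- mon 0 0 3 \<le> b ^ 4" "- mon 0 2 0
          \<le> b ^ 4" "- mon 0 1 1 \<le> b ^ 4" "- mon 0 0 2 \<le> b ^ 4" "- mon 0 1 0 \<le> b ^ 4" "-
          mon 0 0 0 \<le> b ^ 4" "- mon 1 0 4 \<le> b ^ 4" "- mon 1 1 2 \<le> b ^ 4" "- mon 1 0 3 \<le> b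
          ^ 4" "- mon 1 2 0 \<le> b ^ 4" "- mon 1 1 1 \<le> b ^ 4" "- mon 1 0 2 \<le> b ^ 4" "- mon 1 1 0
          \<le> b ^ 4" "- mon 1 0 1 \<le> b ^ 4" "- mon 2 0 4 \<le> b ^ 4" "- mon 2 1 2 \<le> b ^ 4" "-
          mon 2 0 3 \<le> b ^ 4" "- mon 2 2 0 \<le> b ^ 4" "- mon 2 1 1 \<le> b ^ 4" "- mon 2 0 2 \<le> b
          ^ 4" "- mon 3 0 4 \<le> b ^ 4" "- mon 3 1 2 \<le> b ^ 4" "- mon 3 0 3 \<le> b ^ 4" "- mon 4 0 4
          \<le> b ^ 4"
          by (rule mb'; simp)+
        show ?thesis unfolding P K_def abs_le_iff using 1 2 by linarith
      qed
      have "\<bar>ratio n x\<bar> \<le> \<bar>x\<bar>" using ratio_bounds[of n x] by simp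
      also have "\<bar>x\<bar> \<le> cen n * (2 * b ^ 4)"
      proof -
        have "x = cen n * (1 + v)" using c unfolding v_def eps_dev by (simp add: field_simps)
        then have x: "\<bar>x\<bar> = cen n * \<bar>1 + v\<bar>" using c by (simp add: abs_mult)
        have "\<bar>1 + v\<bar> \<le> 1 + W" using vW by linarith
        also have "\<dots> \<le> 2 * b" using W2 by (simp add: b_def)
        also have "b \<le> b ^ 4" using b1 by (intro self_le_power) auto
        finally show ?thesis using c unfolding x by simp
      qed
      finally have "\<bar>ratio n x - ratio_poly n v\<bar> \<le> cen n * (2 * b ^ 4) + K * b ^ 4" using Pb by linarith
      also have "K * b ^ 4 \<le> cen n * (K * b ^ 4)"
        using cen_gt_1[of n] b1 mult_right_mono[of 1 "cen n" "K * b ^ 4"] by (simp add: K_def)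
      also have "cen n * (2 * b ^ 4) + cen n * (K * b ^ 4) = (2 + K) * (cen n * b ^ 4)" by (simp add: algebra_simps)
      also have "\<dots> \<le> (2 + K) * (cen n * b ^ 8)"
        using c b1 by (intro mult_left_mono power_increasing) (auto simp: K_def)
      also have "cen n * b ^ 8 = 256 * (alpha n ^ 8 * (cen n * eps n ^ 8) * (1 + \<bar>dev n x\<bar>) ^ 8)"
        by (simp add: b_def W_eq power_mult_distrib)
      also have "cen n * eps n ^ 8 = (cen n * eps n ^ 2) * eps n ^ 6"
        by (simp add: mult.assoc flip: power_add)
      also have "\<dots> = eps n ^ 6" by (simp add: cen_eps)
      also have "(2 + K) * (256 * (alpha n ^ 8 * eps n ^ 6 * (1 + \<bar>dev n x\<bar>) ^ 8)) \<le> (2 + K) * (256 * E)"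
        unfolding E_def using e al
        by (intro mult_left_mono mult_right_mono power_decreasing) (auto simp: K_def)
      also have "\<dots> \<le> (C + (2 + K) * 256) * E"
        using E0 C0 by (simp add: algebra_simps)
      finally show ?thesis by (simp add: E_def v_def)
    qed
  qed
  then show ?thesis by blast
qed

lemma poly_bounded_ratio_poly: "poly_bounded (\<lambda>x. ratio_poly n (eps n * dev n x))"
  unfolding ratio_poly_def Let_def by (intro poly_bounded_intros')

lemma mean_ratio_poly_error:
  "\<exists>C. \<forall>\<^sub>F n in sequentially.
     \<bar>mean n (\<lambda>x. (ratio n x - ratio_poly n (eps n * dev n x)) * dev n x ^ j)\<bar> \<le> C * (alpha n ^ 8 * eps n ^ 5)"
proof -
  obtain C where C: "\<forall>\<^sub>F n in sequentially. \<forall>x.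
     \<bar>ratio n x - ratio_poly n (eps n * dev n x)\<bar> \<le> C * (alpha n ^ 8 * eps n ^ 5 * (1 + \<bar>dev n x\<bar>) ^ 8)"
    using ratio_taylor by blast
  obtain D where D: "\<forall>\<^sub>F n in sequentially. mean n (\<lambda>x. \<bar>dev n x\<bar> ^ (8 + j)) \<le> D"
    using abs_dev_moments_bounded by blast
  have "\<forall>\<^sub>F n in sequentially.
     \<bar>mean n (\<lambda>x. (ratio n x - ratio_poly n (eps n * dev n x)) * dev n x ^ j)\<bar>
       \<le> (\<bar>C\<bar> * 2 ^ (8 + j) * (1 + D)) * (alpha n ^ 8 * eps n ^ 5)"
    using C D eventually_gt_at_top[of 0]
  proof eventually_elim
    case (elim n)
    let ?e = "alpha n ^ 8 * eps n ^ 5" and ?u = "dev n"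
    have e: "0 \<le> ?e" using alpha_pos[of n] eps_pos[of n] by simp
    have "\<bar>mean n (\<lambda>x. (ratio n x - ratio_poly n (eps n * ?u x)) * ?u x ^ j)\<bar>
      \<le> mean n (\<lambda>x. \<bar>(ratio n x - ratio_poly n (eps n * ?u x)) * ?u x ^ j\<bar>)"
      using elim(3) by (intro mean_abs_le poly_bounded_intros' poly_bounded_ratio_poly)
    also have "\<dots> \<le> mean n (\<lambda>x. \<bar>C\<bar> * ?e * 2 ^ (8 + j) * (1 + \<bar>?u x\<bar> ^ (8 + j)))"
    proof (rule mean_mono)
      fix k :: nat
      let ?x = "real k"
      have "(1 + \<bar>?u ?x\<bar>) ^ (8 + j) \<le> (2 * max 1 \<bar>?u ?x\<bar>) ^ (8 + j)" by (intro power_mono) auto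
      also have "\<dots> = 2 ^ (8 + j) * max 1 \<bar>?u ?x\<bar> ^ (8 + j)" by (rule power_mult_distrib)
      also have "max 1 \<bar>?u ?x\<bar> ^ (8 + j) \<le> 1 + \<bar>?u ?x\<bar> ^ (8 + j)" by (auto simp: max_def)
      finally have b: "(1 + \<bar>?u ?x\<bar>) ^ (8 + j) \<le> 2 ^ (8 + j) * (1 + \<bar>?u ?x\<bar> ^ (8 + j))" by simp
      have "\<bar>ratio n ?x - ratio_poly n (eps n * ?u ?x)\<bar> \<le> C * (?e * (1 + \<bar>?u ?x\<bar>) ^ 8)"
        using elim(1) by simp
      also have "\<dots> \<le> \<bar>C\<bar> * (?e * (1 + \<bar>?u ?x\<bar>) ^ 8)" using e by (intro mult_right_mono) auto
      finally have "\<bar>(ratio n ?x - ratio_poly n (eps n * ?u ?x)) * ?u ?x ^ j\<bar>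
          \<le> \<bar>C\<bar> * (?e * (1 + \<bar>?u ?x\<bar>) ^ 8) * (1 + \<bar>?u ?x\<bar>) ^ j"
        unfolding abs_mult power_abs[symmetric] using e
        by (intro mult_mono power_mono) (auto simp: power_abs intro!: power_mono)
      also have "\<dots> = \<bar>C\<bar> * ?e * (1 + \<bar>?u ?x\<bar>) ^ (8 + j)" by (simp add: power_add)
      also have "\<dots> \<le> \<bar>C\<bar> * ?e * (2 ^ (8 + j) * (1 + \<bar>?u ?x\<bar> ^ (8 + j)))"
        using b e by (intro mult_left_mono) auto
      finally show "\<bar>(ratio n ?x - ratio_poly n (eps n * ?u ?x)) * ?u ?x ^ j\<bar>
        \<le> \<bar>C\<bar> * ?e * 2 ^ (8 + j) * (1 + \<bar>?u ?x\<bar> ^ (8 + j))" by (simp add: mult.assoc)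
    qed (use elim in \<open>auto intro!: poly_bounded_intros' poly_bounded_ratio_poly\<close>)
    also have "\<dots> = \<bar>C\<bar> * ?e * 2 ^ (8 + j) * (1 + mean n (\<lambda>x. \<bar>?u x\<bar> ^ (8 + j)))"
      by (simp only: mean_cmult mean_add mean_const poly_bounded_intros')
    also have "\<dots> \<le> \<bar>C\<bar> * ?e * 2 ^ (8 + j) * (1 + D)"
      using elim(2) e by (intro mult_left_mono) auto
    finally show ?case by (simp only: mult_ac)
  qed
  then show ?thesis by blast
qed

section \<open>Moments of the Dobinski weights\<close>

text \<open>Powers of \<open>alpha n\<close>, being logarithmic, never compete with powers of \<open>eps n\<close>.\<close>

definition eps_order :: "nat \<Rightarrow> (nat \<Rightarrow> real) \<Rightarrow> bool" where
  "eps_order k f \<longleftrightarrow> (\<exists>p. f \<in> O(\<lambda>n. alpha n ^ p * eps n ^ k))"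

lemma bigo_alpha_power:
  assumes "f \<in> O(\<lambda>n. alpha n ^ p * g n)" "p \<le> q"
  shows "f \<in> O(\<lambda>n. alpha n ^ q * g n)"
proof -
  have "(\<lambda>n. alpha n ^ p) \<in> O(\<lambda>n. alpha n ^ q)"
  proof (rule bigoI[of _ 1])
    show "\<forall>\<^sub>F n in sequentially. norm (alpha n ^ p) \<le> 1 * norm (alpha n ^ q)"
      using eventually_alpha_large[of 1]
      by eventually_elim (use assms(2) in \<open>auto intro!: power_increasing\<close>)
  qed
  then have "(\<lambda>n. alpha n ^ p * g n) \<in> O(\<lambda>n. alpha n ^ q * g n)" by (intro landau_o.big.mult) auto
  with assms(1) show ?thesis by (rule landau_o.big_trans)
qed

lemma eps_order_add: "eps_order k f \<Longrightarrow> eps_order k g \<Longrightarrow> eps_order k (\<lambda>n. f n + g n)"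
  unfolding eps_order_def
proof (elim exE)
  fix p q assume "f \<in> O(\<lambda>n. alpha n ^ p * eps n ^ k)" "g \<in> O(\<lambda>n. alpha n ^ q * eps n ^ k)"
  then have "(\<lambda>n. f n + g n) \<in> O(\<lambda>n. alpha n ^ (p + q) * eps n ^ k)"
    by (intro sum_in_bigo) (auto elim: bigo_alpha_power)
  then show "\<exists>p. (\<lambda>n. f n + g n) \<in> O(\<lambda>n. alpha n ^ p * eps n ^ k)" by blast
qed

lemma eps_order_mono: "eps_order i f \<Longrightarrow> j \<le> i \<Longrightarrow> eps_order j f"
  unfolding eps_order_def
proof (elim exE)
  fix p assume f: "f \<in> O(\<lambda>n. alpha n ^ p * eps n ^ i)" and "j \<le> i"
  have "(\<lambda>n. eps n ^ i) \<in> O(\<lambda>n. eps n ^ j)"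
    by (rule bigoI[of _ 1]) (use eps_pos eps_le_1 \<open>j \<le> i\<close> in
      \<open>auto intro!: always_eventually power_decreasing simp: less_imp_le\<close>)
  then have "(\<lambda>n. alpha n ^ p * eps n ^ i) \<in> O(\<lambda>n. alpha n ^ p * eps n ^ j)"
    by (intro landau_o.big.mult) auto
  with f show "\<exists>p. f \<in> O(\<lambda>n. alpha n ^ p * eps n ^ j)" by (blast intro: landau_o.big_trans)
qed

lemma eps_order_mult: "eps_order i f \<Longrightarrow> eps_order j g \<Longrightarrow> eps_order (i + j) (\<lambda>n. f n * g n)"
  unfolding eps_order_def
proof (elim exE)
  fix p q assume "f \<in> O(\<lambda>n. alpha n ^ p * eps n ^ i)" "g \<in> O(\<lambda>n. alpha n ^ q * eps n ^ j)"
  then have "(\<lambda>n. f n * g n) \<in> O(\<lambda>n. alpha n ^ p * eps n ^ i * (alpha n ^ q * eps n ^ j))"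
    by (rule landau_o.big.mult)
  then have "(\<lambda>n. f n * g n) \<in> O(\<lambda>n. alpha n ^ (p + q) * eps n ^ (i + j))"
    by (simp add: power_add mult_ac)
  then show "\<exists>p. (\<lambda>n. f n * g n) \<in> O(\<lambda>n. alpha n ^ p * eps n ^ (i + j))" by blast
qed

lemma eps_order_const: "eps_order 0 (\<lambda>_. c)"
  unfolding eps_order_def by (rule exI[of _ 0]) simp

lemma eps_order_mult_left: "eps_order i f \<Longrightarrow> eps_order 0 g \<Longrightarrow> eps_order i (\<lambda>n. f n * g n)"
  using eps_order_mult[of i f 0 g] by simp

lemma eps_order_mult_right: "eps_order 0 f \<Longrightarrow> eps_order i g \<Longrightarrow> eps_order i (\<lambda>n. f n * g n)"
  using eps_order_mult[of 0 f i g] by simp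

lemma eps_order_minus: "eps_order i f \<Longrightarrow> eps_order i (\<lambda>n. - f n)"
  using eps_order_mult_right[OF eps_order_const, of i f "-1"] by simp

lemma eps_order_diff: "eps_order i f \<Longrightarrow> eps_order i g \<Longrightarrow> eps_order i (\<lambda>n. f n - g n)"
  using eps_order_add[of i f "\<lambda>n. - g n"] eps_order_minus[of i g] by simp

lemma eps_order_power: "eps_order 0 f \<Longrightarrow> eps_order 0 (\<lambda>n. f n ^ m)"
  by (induction m) (auto intro: eps_order_const eps_order_mult_left)

lemma eps_order_eps: "eps_order 1 eps"
  unfolding eps_order_def by (rule exI[of _ 0]) simp

lemma eps_order_eps0: "eps_order 0 eps"
  using eps_order_mono[OF eps_order_eps] by simp

lemma eps_order_divide_eps:
  assumes "eps_order (i + k) f" shows "eps_order i (\<lambda>n. f n / eps n ^ k)"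
proof -
  obtain p where "f \<in> O(\<lambda>n. alpha n ^ p * eps n ^ (i + k))" using assms by (auto simp: eps_order_def)
  then have "(\<lambda>n. f n / eps n ^ k) \<in> O(\<lambda>n. alpha n ^ p * eps n ^ (i + k) / eps n ^ k)"
    by (rule landau_o.big.divide_right[rotated]) (use eps_pos in \<open>auto intro!: always_eventually simp: less_imp_neq[symmetric]\<close>)
  moreover have "(\<lambda>n. alpha n ^ p * eps n ^ (i + k) / eps n ^ k) = (\<lambda>n. alpha n ^ p * eps n ^ i)"
    using eps_pos by (auto simp: power_add less_imp_neq[symmetric])
  ultimately show ?thesis by (auto simp: eps_order_def)
qed

lemma eps_order_bounded: "f \<in> O(\<lambda>_. 1) \<Longrightarrow> eps_order 0 f"
  unfolding eps_order_def by (rule exI[of _ 0]) simp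

text \<open>The main coefficient of the linear term of \<open>ratio_poly\<close>, hence the pivot of
  the linear system for the moments. Its inverse \<open>r1\<close> turns out to be the leading term
  of the variance of \<open>dev n\<close>.\<close>

definition s1 :: "nat \<Rightarrow> real" where "s1 n = 1 + alpha n"
definition r1 :: "nat \<Rightarrow> real" where "r1 n = 1 / (1 + alpha n)"

lemma s1_r1: "s1 n * r1 n = 1"
  using alpha_pos[of n] by (simp add: s1_def r1_def)

lemma eps_order_s1: "eps_order 0 s1"
proof -
  have "eps_order 0 alpha" unfolding eps_order_def by (rule exI[of _ 1]) simp
  then show ?thesis unfolding s1_def[abs_def] by (intro eps_order_add eps_order_const)
qed

lemma eps_order_r1: "eps_order 0 r1"
proof (rule eps_order_bounded, rule bigoI[of _ 1])
  show "\<forall>\<^sub>F n in sequentially. norm (r1 n) \<le> 1 * norm (1::real)"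
    using alpha_pos by (auto intro!: always_eventually simp: r1_def divide_le_eq less_imp_le add_pos_pos)
qed

definition dmom :: "nat \<Rightarrow> nat \<Rightarrow> real" where
  "dmom j n = mean n (\<lambda>x. dev n x ^ j)"

lemma dmom_0: "dmom 0 n = 1" by (simp add: dmom_def mean_const)

lemma eps_order_dmom: "eps_order 0 (dmom j)"
proof (rule eps_order_bounded)
  obtain C where C: "\<forall>\<^sub>F n in sequentially. mean n (\<lambda>x. \<bar>dev n x\<bar> ^ j) \<le> C"
    using abs_dev_moments_bounded by blast
  show "dmom j \<in> O(\<lambda>_. 1)"
  proof (rule bigoI[of _ C])
    show "\<forall>\<^sub>F n in sequentially. norm (dmom j n) \<le> C * norm (1::real)"
      using C eventually_gt_at_top[of 0]
    proof eventually_elim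
      case (elim n)
      have "\<bar>dmom j n\<bar> \<le> mean n (\<lambda>x. \<bar>dev n x ^ j\<bar>)"
        unfolding dmom_def using elim(2) by (intro mean_abs_le poly_bounded_intros')
      then show ?case using elim(1) by (simp add: power_abs)
    qed
  qed
qed

section \<open>The moment identities as an approximate linear system\<close>

definition q01 where "q01 n = 3/2 - 1/2 * s1 n"
definition q02 where "q02 n = 1/8 * s1 n^2 - 13/12 * s1 n + 47/24"
definition q11 where "q11 n = 5/2 * s1 n - 1/2 * s1 n^2 - 2"
definition q20 where "q20 n = 1/2 * s1 n^2 - s1 n + 1/2"
definition q21 where "q21 n = 9/4 * s1 n^2 - 1/4 * s1 n^3 - 21/4 * s1 n + 13/4"
definition q30 where "q30 n = 1/6 * s1 n^3 - s1 n^2 + 3/2 * s1 n - 2/3"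
definition q40 where "q40 n = 1/24 * s1 n^4 - 1/2 * s1 n^3 + 7/4 * s1 n^2 - 13/6 * s1 n + 7/8"

lemmas q_defs = q01_def q02_def q11_def q20_def q21_def q30_def q40_def

lemma eps_order_q: "eps_order 0 q01" "eps_order 0 q02" "eps_order 0 q11" "eps_order 0 q20" "eps_order 0 q21" "eps_order 0 q30" "eps_order 0 q40"
  unfolding q_defs[abs_def]
  by (intro eps_order_add eps_order_diff eps_order_mult_left eps_order_power eps_order_const eps_order_s1)+

text \<open>The error committed when \<open>ratio\<close> is replaced by \<open>ratio_poly\<close> in the identity \<open>mean_ratio_dev\<close>; the
  coefficients \<open>qij\<close> are those of \<open>v ^ i / cen n ^ j\<close> in \<open>ratio_poly\<close>.\<close>

definition stein_err :: "nat \<Rightarrow> nat \<Rightarrow> real" where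
  "stein_err j n = (\<Sum>i<j. real (j choose i) * eps n ^ (j - i) * dmom i n)
     - (eps n ^ 2 * (q01 n + eps n ^ 2 * q02 n) * dmom j n
        + (s1 n + eps n ^ 2 * q11 n) * eps n * dmom (j + 1) n
        + (q20 n + eps n ^ 2 * q21 n) * eps n ^ 2 * dmom (j + 2) n
        + q30 n * eps n ^ 3 * dmom (j + 3) n + q40 n * eps n ^ 4 * dmom (j + 4) n)"

text \<open>Expanding \<open>(dev + eps) ^ j\<close> binomially in \<open>mean_ratio_dev\<close> and
  subtracting the mean of \<open>ratio_poly\<close> times \<open>dev ^ j\<close> yields exactly this
  error, the two terms \<open>dmom j\<close> cancelling.\<close>

lemma eps_order_stein_err: "eps_order 5 (stein_err j)"
proof -
  obtain C where C: "\<forall>\<^sub>F n in sequentially.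
     \<bar>mean n (\<lambda>x. (ratio n x - ratio_poly n (eps n * dev n x)) * dev n x ^ j)\<bar> \<le> C * (alpha n ^ 8 * eps n ^ 5)"
    using mean_ratio_poly_error by blast
  have "stein_err j \<in> O(\<lambda>n. alpha n ^ 8 * eps n ^ 5)"
  proof (rule bigoI[of _ C])
    show "\<forall>\<^sub>F n in sequentially. norm (stein_err j n) \<le> C * norm (alpha n ^ 8 * eps n ^ 5)"
      using C eventually_gt_at_top[of 0]
    proof eventually_elim
      case (elim n)
      let ?u = "dev n" and ?e = "eps n"
      have "mean n (\<lambda>x. (ratio n x - ratio_poly n (?e * ?u x)) * ?u x ^ j) =
        mean n (\<lambda>x. ratio n x * ?u x ^ j) - mean n (\<lambda>x. ratio_poly n (?e * ?u x) * ?u x ^ j)"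
        unfolding left_diff_distrib by (intro mean_diff poly_bounded_intros' poly_bounded_ratio_poly)
      also have "mean n (\<lambda>x. ratio n x * ?u x ^ j) = mean n (\<lambda>x. (?u x + ?e) ^ j)"
        by (rule mean_ratio_dev[OF elim(2)])
      also have "\<dots> = mean n (\<lambda>x. \<Sum>i\<le>j. real (j choose i) * ?e ^ (j - i) * ?u x ^ i)"
        by (subst binomial_ring) (simp add: mult_ac)
      also have "\<dots> = (\<Sum>i\<le>j. real (j choose i) * ?e ^ (j - i) * dmom i n)"
        unfolding dmom_def by (subst mean_sum) (auto intro!: poly_bounded_intros' sum.cong mean_cmult)
      also have "\<dots> = (\<Sum>i<j. real (j choose i) * ?e ^ (j - i) * dmom i n) + dmom j n"
        by (simp flip: lessThan_Suc_atMost)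
      also have "mean n (\<lambda>x. ratio_poly n (?e * ?u x) * ?u x ^ j) =
        mean n (\<lambda>x. (1 + ?e ^ 2 * (q01 n + ?e ^ 2 * q02 n)) * ?u x ^ j
          + ((s1 n + ?e ^ 2 * q11 n) * ?e) * ?u x ^ (j + 1)
          + ((q20 n + ?e ^ 2 * q21 n) * ?e ^ 2) * ?u x ^ (j + 2)
          + (q30 n * ?e ^ 3) * ?u x ^ (j + 3) + (q40 n * ?e ^ 4) * ?u x ^ (j + 4))"
        unfolding ratio_poly_def Let_def q_defs s1_def power_add power_mult_distrib
        by (rule arg_cong[of _ _ "mean n"], rule ext) algebra
      also have "\<dots> = (1 + ?e ^ 2 * (q01 n + ?e ^ 2 * q02 n)) * dmom j n
          + ((s1 n + ?e ^ 2 * q11 n) * ?e) * dmom (j + 1) n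
          + ((q20 n + ?e ^ 2 * q21 n) * ?e ^ 2) * dmom (j + 2) n
          + (q30 n * ?e ^ 3) * dmom (j + 3) n + (q40 n * ?e ^ 4) * dmom (j + 4) n"
        unfolding dmom_def by (simp only: mean_add mean_cmult poly_bounded_intros')
      finally have "mean n (\<lambda>x. (ratio n x - ratio_poly n (?e * ?u x)) * ?u x ^ j) = stein_err j n"
        unfolding stein_err_def by (simp add: algebra_simps)
      then show ?case using elim(1) alpha_pos[of n] eps_pos[of n] by (simp add: abs_mult)
    qed
  qed
  then show ?thesis by (auto simp: eps_order_def)
qed

text \<open>Odd moments turn out to be of order \<open>eps n\<close>, one order smaller than their a priori bound, whence
  this normalisation.\<close>

definition nmom :: "nat \<Rightarrow> nat \<Rightarrow> real" where
  "nmom j n = dmom j n / eps n"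

lemma dmom_nmom: "dmom j n = eps n * nmom j n"
  using eps_pos[of n] by (simp add: nmom_def)

text \<open>The bound on \<open>g\<close> carries over to \<open>f\<close> and makes the relation
  compatible with products.\<close>

definition eps_cong :: "(nat \<Rightarrow> real) \<Rightarrow> (nat \<Rightarrow> real) \<Rightarrow> bool" where
  "eps_cong f g \<longleftrightarrow> eps_order 0 g \<and> eps_order 1 (\<lambda>n. f n - g n)"

lemma eps_cong_oe: "eps_cong f g \<Longrightarrow> eps_order 0 f"
  using eps_order_add[of 0 "\<lambda>n. f n - g n" g] eps_order_mono[of 1 "\<lambda>n. f n - g n" 0] by (auto simp: eps_cong_def)

lemma eps_order_0_eq: "eps_order i (\<lambda>_. 0)"
  unfolding eps_order_def by simp

lemma eps_cong_refl: "eps_order 0 f \<Longrightarrow> eps_cong f f"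
  by (simp add: eps_cong_def eps_order_0_eq)

lemma eps_cong_add: "eps_cong f f' \<Longrightarrow> eps_cong g g' \<Longrightarrow> eps_cong (\<lambda>n. f n + g n) (\<lambda>n. f' n + g' n)"
  using eps_order_add[of 1 "\<lambda>n. f n - f' n" "\<lambda>n. g n - g' n"]
  by (auto simp: eps_cong_def algebra_simps intro: eps_order_add)

lemma eps_cong_diff: "eps_cong f f' \<Longrightarrow> eps_cong g g' \<Longrightarrow> eps_cong (\<lambda>n. f n - g n) (\<lambda>n. f' n - g' n)"
  using eps_order_diff[of 1 "\<lambda>n. f n - f' n" "\<lambda>n. g n - g' n"]
  by (auto simp: eps_cong_def algebra_simps intro: eps_order_diff)

lemma eps_cong_mult: 
  assumes "eps_cong f f'" "eps_cong g g'" shows "eps_cong (\<lambda>n. f n * g n) (\<lambda>n. f' n * g' n)"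
proof -
  have "eps_order 1 (\<lambda>n. (f n - f' n) * g n + (g n - g' n) * f' n)"
    using assms eps_cong_oe[OF assms(2)] by (intro eps_order_add eps_order_mult_left) (auto simp: eps_cong_def)
  then show ?thesis using assms by (auto simp: eps_cong_def algebra_simps intro: eps_order_mult_left)
qed

lemma eps_cong_trans: "eps_cong f g \<Longrightarrow> eps_cong g h \<Longrightarrow> eps_cong f h"
  using eps_order_add[of 1 "\<lambda>n. f n - g n" "\<lambda>n. g n - h n"] by (auto simp: eps_cong_def)

lemma eps_cong_cong: "eps_cong f g \<Longrightarrow> (\<And>n. f' n = f n) \<Longrightarrow> (\<And>n. g' n = g n) \<Longrightarrow> eps_cong f' g'"
  by (metis ext)

lemma eps_cong_solve:
  assumes "eps_cong (\<lambda>n. s1 n * f n) g" "\<And>n. r1 n * g n = h n" shows "eps_cong f h"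
proof (rule eps_cong_cong[OF eps_cong_mult[OF eps_cong_refl[OF eps_order_r1] assms(1)]])
  show "f n = r1 n * (s1 n * f n)" for n using s1_r1[of n] by algebra
qed (simp add: assms(2))

lemmas eps_order_0_intros = eps_order_add[where k = 0] eps_order_diff[where i = 0] eps_order_minus[where i = 0]
  eps_order_mult_left[where i = 0] eps_order_power eps_order_const eps_order_s1 eps_order_r1 eps_order_eps0 eps_order_q eps_order_dmom

lemma eps_order_err: "eps_order 1 (\<lambda>n. stein_err j n / eps n)" "eps_order 1 (\<lambda>n. stein_err j n / eps n ^ 2)"
  "eps_order 1 (\<lambda>n. stein_err j n / eps n ^ 3)" "eps_order 1 (\<lambda>n. stein_err j n / eps n ^ 4)"
  using eps_order_divide_eps[of 1 1 "stein_err j"] eps_order_divide_eps[of 1 2 "stein_err j"]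
    eps_order_divide_eps[of 1 3 "stein_err j"] eps_order_divide_eps[of 1 4 "stein_err j"]
  by (simp_all add: eps_order_mono[OF eps_order_stein_err])

lemma eps_congI: "eps_order 0 g \<Longrightarrow> eps_order 0 h \<Longrightarrow> eps_order 1 e \<Longrightarrow> (\<And>n. f n = g n + eps n * h n - e n) \<Longrightarrow> eps_cong f g"
proof -
  assume a: "eps_order 0 g" "eps_order 0 h" "eps_order 1 e" "\<And>n. f n = g n + eps n * h n - e n"
  have "eps_order 1 (\<lambda>n. eps n * h n - e n)" by (intro eps_order_diff eps_order_mult_left eps_order_eps a)
  then show "eps_cong f g" using a by (simp add: eps_cong_def)
qed

text \<open>Testing with an odd power balances \<open>j * eps * dmom (j - 1)\<close> against
  \<open>s1 * eps * dmom (j + 1)\<close> and determines an even moment. For an even power these two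
  are odd moments, smaller by a factor \<open>eps\<close>; the terms with \<open>q01\<close> and
  \<open>q20\<close> then have the same order, and the division is by
  \<open>eps ^ 2\<close>.\<close>

lemma stein_eqs:
  fixes n
  defines "e \<equiv> eps n" and "M \<equiv> \<lambda>j. dmom j n"
  shows
  "s1 n * M 2 = 1 + e * (- ((q01 n + e^2 * q02 n) * M 1 + e * q11 n * M 2 + (q20 n + e^2 * q21 n) * M 3
      + e * q30 n * M 4 + e^2 * q40 n * M 5)) - stein_err 1 n / e" (is ?e1)
  "s1 n * M 4 = 3 * M 2 + e * (3 * M 1 + e - ((q01 n + e^2 * q02 n) * M 3 + e * q11 n * M 4
      + (q20 n + e^2 * q21 n) * M 5 + e * q30 n * M 6 + e^2 * q40 n * M 7)) - stein_err 3 n / e" (is ?e3)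
  "s1 n * M 6 = 5 * M 4 + e * (10 * M 3 + 10 * e * M 2 + 5 * e^2 * M 1 + e^3 - ((q01 n + e^2 * q02 n) * M 5
      + e * q11 n * M 6 + (q20 n + e^2 * q21 n) * M 7 + e * q30 n * M 8 + e^2 * q40 n * M 9)) - stein_err 5 n / e" (is ?e5)
  "s1 n * nmom 1 n = - q01 n - q20 n * M 2 + e * (- (e * q02 n + q11 n * M 1 + e * q21 n * M 2
      + q30 n * M 3 + e * q40 n * M 4)) - stein_err 0 n / e^2" (is ?e0)
  "s1 n * nmom 3 n = 1 + 2 * nmom 1 n - q01 n * M 2 - q20 n * M 4 + e * (- (e * q02 n * M 2 + q11 n * M 3
      + e * q21 n * M 4 + q30 n * M 5 + e * q40 n * M 6)) - stein_err 2 n / e^2" (is ?e2)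
  "s1 n * nmom 5 n = 4 * nmom 3 n + 6 * M 2 - q01 n * M 4 - q20 n * M 6 + e * (4 * M 1 + e
      - (e * q02 n * M 4 + q11 n * M 5 + e * q21 n * M 6 + q30 n * M 7 + e * q40 n * M 8)) - stein_err 4 n / e^2" (is ?e4)
proof -
  have e: "e > 0" unfolding e_def by (rule eps_pos)
  note expand = stein_err_def e_def[symmetric] M_def nmom_def dmom_0 lessThan_Suc eval_nat_numeral
  show ?e1 using e by (simp add: expand field_simps)
  show ?e3 using e by (simp add: expand field_simps)
  show ?e5 using e by (simp add: expand field_simps)
  show ?e0 using e by (simp add: expand field_simps)
  show ?e2 using e by (simp add: expand field_simps)
  show ?e4 using e by (simp add: expand field_simps)
qed

section \<open>Leading terms of the moments\<close>

lemma eps_cong_minus: "eps_cong f g \<Longrightarrow> eps_cong (\<lambda>n. - f n) (\<lambda>n. - g n)"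
  using eps_cong_diff[OF eps_cong_refl[OF eps_order_const[of 0]], of f g] by simp

lemmas eps_cong_intros = eps_cong_add eps_cong_diff eps_cong_minus eps_cong_mult eps_cong_refl[OF eps_order_q(1)] eps_cong_refl[OF eps_order_q(2)]
  eps_cong_refl[OF eps_order_q(3)] eps_cong_refl[OF eps_order_q(4)] eps_cong_refl[OF eps_order_q(5)] eps_cong_refl[OF eps_order_q(6)]
  eps_cong_refl[OF eps_order_q(7)] eps_cong_refl[OF eps_order_const]

text \<open>To leading order the odd tests are Stein's equation of the Gaussian law with variance
  \<open>r1\<close>; hence the even moments \<open>r1\<close>, \<open>3 * r1 ^ 2\<close> and
  \<open>15 * r1 ^ 3\<close>.\<close>

lemma eps_cong_dmom_2: "eps_cong (dmom 2) r1"
proof (rule eps_cong_solve)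
  show "eps_cong (\<lambda>n. s1 n * dmom 2 n) (\<lambda>n. 1)"
    by (rule eps_congI[OF _ _ _ stein_eqs(1)]) (intro eps_order_0_intros eps_order_err)+
qed simp

lemma eps_cong_dmom_4: "eps_cong (dmom 4) (\<lambda>n. 3 * r1 n ^ 2)"
proof (rule eps_cong_solve[OF eps_cong_trans])
  show "eps_cong (\<lambda>n. s1 n * dmom 4 n) (\<lambda>n. 3 * dmom 2 n)"
    by (rule eps_congI[OF _ _ _ stein_eqs(2)]) (intro eps_order_0_intros eps_order_err)+
  show "eps_cong (\<lambda>n. 3 * dmom 2 n) (\<lambda>n. 3 * r1 n)" by (intro eps_cong_intros eps_cong_dmom_2)
qed (simp add: power2_eq_square)

lemma eps_cong_dmom_6: "eps_cong (dmom 6) (\<lambda>n. 15 * r1 n ^ 3)"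
proof (rule eps_cong_solve[OF eps_cong_trans])
  show "eps_cong (\<lambda>n. s1 n * dmom 6 n) (\<lambda>n. 5 * dmom 4 n)"
    by (rule eps_congI[OF _ _ _ stein_eqs(3)]) (intro eps_order_0_intros eps_order_err)+
  show "eps_cong (\<lambda>n. 5 * dmom 4 n) (\<lambda>n. 5 * (3 * r1 n ^ 2))" by (intro eps_cong_intros eps_cong_dmom_4)
qed (simp add: power2_eq_square power3_eq_cube)

text \<open>The Gaussian limit has no odd moments; what shows up one order later comes from the
  offset \<open>q01\<close> of the ratio at the centre and its curvature \<open>q20\<close>.\<close>

lemma eps_cong_nmom_1: "eps_cong (nmom 1) (\<lambda>n. - 1/2 * r1 n - 1/2 * r1 n ^ 2)"
proof (rule eps_cong_solve[OF eps_cong_trans])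
  show "eps_cong (\<lambda>n. s1 n * nmom 1 n) (\<lambda>n. - q01 n - q20 n * dmom 2 n)" (is "eps_cong _ ?B")
    by (rule eps_congI[OF _ _ _ stein_eqs(4)]) (intro eps_order_0_intros eps_order_err)+
  show "eps_cong ?B (\<lambda>n. - q01 n - q20 n * r1 n)" (is "eps_cong _ ?C")
    by (intro eps_cong_intros eps_cong_dmom_2)
  show "r1 n * ?C n = - 1/2 * r1 n - 1/2 * r1 n ^ 2" for n
    using s1_r1[of n] unfolding q_defs by algebra
qed

lemma eps_cong_nmom_3: "eps_cong (nmom 3) (\<lambda>n. 1/2 * r1 n ^ 2 - 5/2 * r1 n ^ 3)"
proof (rule eps_cong_solve[OF eps_cong_trans])
  show "eps_cong (\<lambda>n. s1 n * nmom 3 n) (\<lambda>n. 1 + 2 * nmom 1 n - q01 n * dmom 2 n - q20 n * dmom 4 n)" (is "eps_cong _ ?B")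
    by (rule eps_congI[OF _ _ _ stein_eqs(5)]) (intro eps_order_0_intros eps_order_err eps_cong_oe[OF eps_cong_nmom_1])+
  show "eps_cong ?B (\<lambda>n. 1 + 2 * (- 1/2 * r1 n - 1/2 * r1 n ^ 2) - q01 n * r1 n - q20 n * (3 * r1 n ^ 2))" (is "eps_cong _ ?C")
    by (intro eps_cong_intros eps_cong_dmom_2 eps_cong_dmom_4 eps_cong_nmom_1)
  show "r1 n * ?C n = 1/2 * r1 n ^ 2 - 5/2 * r1 n ^ 3" for n
    using s1_r1[of n] unfolding q_defs by algebra
qed

lemma eps_cong_nmom_5: "eps_cong (nmom 5) (\<lambda>n. 25/2 * r1 n ^ 3 - 35/2 * r1 n ^ 4)"
proof (rule eps_cong_solve[OF eps_cong_trans])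
  show "eps_cong (\<lambda>n. s1 n * nmom 5 n) (\<lambda>n. 4 * nmom 3 n + 6 * dmom 2 n - q01 n * dmom 4 n - q20 n * dmom 6 n)" (is "eps_cong _ ?B")
    by (rule eps_congI[OF _ _ _ stein_eqs(6)]) (intro eps_order_0_intros eps_order_err eps_cong_oe[OF eps_cong_nmom_3])+
  show "eps_cong ?B (\<lambda>n. 4 * (1/2 * r1 n ^ 2 - 5/2 * r1 n ^ 3) + 6 * r1 n - q01 n * (3 * r1 n ^ 2) - q20 n * (15 * r1 n ^ 3))" (is "eps_cong _ ?C")
    by (intro eps_cong_intros eps_cong_dmom_2 eps_cong_dmom_4 eps_cong_dmom_6 eps_cong_nmom_3)
  show "r1 n * ?C n = 25/2 * r1 n ^ 3 - 35/2 * r1 n ^ 4" for n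
    using s1_r1[of n] unfolding q_defs by algebra
qed

lemmas eps_order_nmom = eps_cong_oe[OF eps_cong_nmom_1] eps_cong_oe[OF eps_cong_nmom_3] eps_cong_oe[OF eps_cong_nmom_5]

text \<open>The coefficients of \<open>eps n ^ 2\<close> in the expansions of the moments.\<close>

definition dmom2' where "dmom2' n = (dmom 2 n - r1 n) / eps n ^ 2"
definition dmom4' where "dmom4' n = (dmom 4 n - 3 * r1 n ^ 2) / eps n ^ 2"
definition nmom1' where "nmom1' n = (nmom 1 n + 1/2 * r1 n + 1/2 * r1 n ^ 2) / eps n ^ 2"
definition nmom3' where "nmom3' n = (nmom 3 n - 1/2 * r1 n ^ 2 + 5/2 * r1 n ^ 3) / eps n ^ 2"

text \<open>The leading solutions are subtracted from \<open>stein_eqs\<close> and the rest is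
  divided by \<open>eps n ^ 2\<close>; the leading parts cancel modulo
  \<open>s1 n * r1 n = 1\<close>.\<close>

lemma second_order_eqs:
  fixes n
  defines "e \<equiv> eps n" and "M \<equiv> \<lambda>j. dmom j n" and "N \<equiv> \<lambda>j. nmom j n"
  shows
  "s1 n * dmom2' n = - (q01 n * N 1 + q11 n * M 2 + q20 n * N 3 + q30 n * M 4)
     + e * (- e * (q02 n * N 1 + q21 n * N 3 + q40 n * N 5)) - stein_err 1 n / e^3" (is ?e1)
  "s1 n * dmom4' n = 3 * dmom2' n + 3 * N 1 + 1 - (q01 n * N 3 + q11 n * M 4 + q20 n * N 5 + q30 n * M 6)
     + e * (- (e * q02 n * N 3 + e * q21 n * N 5 + q40 n * M 7)) - stein_err 3 n / e^3" (is ?e3)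
  "s1 n * nmom1' n = - q20 n * dmom2' n - q02 n - q11 n * N 1 - q21 n * M 2 - q30 n * N 3 - q40 n * M 4
     + e * 0 - stein_err 0 n / e^4" (is ?e0)
  "s1 n * nmom3' n = 2 * nmom1' n - q01 n * dmom2' n - q20 n * dmom4' n - q02 n * M 2 - q11 n * N 3
     - q21 n * M 4 - q30 n * N 5 - q40 n * M 6 + e * 0 - stein_err 2 n / e^4" (is ?e2)
proof -
  have e: "e > 0" unfolding e_def by (rule eps_pos)
  have cancel: "a = b" if "e^2 * a = e^2 * b" for a b using that e by simp
  note sr = s1_r1[of n]
  have MN: "dmom 1 n = e * nmom 1 n" "dmom 3 n = e * nmom 3 n" "dmom 5 n = e * nmom 5 n"
    by (simp_all add: e_def dmom_nmom)
  have d: "e^2 * dmom2' n = dmom 2 n - r1 n" "e^2 * dmom4' n = dmom 4 n - 3 * r1 n ^ 2"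
    "e^2 * nmom1' n = nmom 1 n + 1/2 * r1 n + 1/2 * r1 n ^ 2"
    "e^2 * nmom3' n = nmom 3 n - 1/2 * r1 n ^ 2 + 5/2 * r1 n ^ 3"
    using e by (simp_all add: dmom2'_def dmom4'_def nmom1'_def nmom3'_def e_def)
  have z: "stein_err j n / e = e^2 * (stein_err j n / e^3)" "stein_err j n / e^2 = e^2 * (stein_err j n / e^4)" for j
    using e by (simp_all add: eval_nat_numeral)
  note st = stein_eqs[of n, folded e_def, unfolded MN z]
  define z1 z3 z0 z2 where "z1 = stein_err 1 n / e^3" and "z3 = stein_err 3 n / e^3"
    and "z0 = stein_err 0 n / e^4" and "z2 = stein_err 2 n / e^4"
  note zd = z1_def[symmetric] z3_def[symmetric] z0_def[symmetric] z2_def[symmetric]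
  show ?e1 unfolding zd M_def N_def by (rule cancel) (use st(1)[unfolded zd] sr d(1) in algebra)
  show ?e3 unfolding zd M_def N_def by (rule cancel) (use st(2)[unfolded zd] sr d(1,2) in algebra)
  \<comment> \<open>For the even tests the leading parts cancel only with the explicit values of
    \<open>q01\<close> and \<open>q20\<close>.\<close>
  show ?e0 unfolding zd M_def N_def by (rule cancel) (use st(4)[unfolded zd q01_def q20_def] sr d(1,3) in \<open>unfold q20_def, algebra\<close>)
  show ?e2 unfolding zd M_def N_def by (rule cancel)
    (use st(5)[unfolded zd q01_def q20_def] sr d in \<open>unfold q01_def q20_def, algebra\<close>)
qed

lemma eps_cong_dmom2': "eps_cong dmom2' (\<lambda>n. - 1/4 * r1 n ^ 2 + 5/4 * r1 n ^ 4)"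
proof (rule eps_cong_solve[OF eps_cong_trans])
  show "eps_cong (\<lambda>n. s1 n * dmom2' n) (\<lambda>n. - (q01 n * nmom 1 n + q11 n * dmom 2 n + q20 n * nmom 3 n + q30 n * dmom 4 n))" (is "eps_cong _ ?B")
    by (rule eps_congI[OF _ _ _ second_order_eqs(1)]) (intro eps_order_0_intros eps_order_err eps_order_nmom)+
  show "eps_cong ?B (\<lambda>n. - (q01 n * (- 1/2 * r1 n - 1/2 * r1 n ^ 2) + q11 n * r1 n + q20 n * (1/2 * r1 n ^ 2 - 5/2 * r1 n ^ 3)
         + q30 n * (3 * r1 n ^ 2)))" (is "eps_cong _ ?C")
    by (intro eps_cong_intros eps_cong_dmom_2 eps_cong_dmom_4 eps_cong_nmom_1 eps_cong_nmom_3)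
  show "r1 n * ?C n = - 1/4 * r1 n ^ 2 + 5/4 * r1 n ^ 4" for n
    using s1_r1[of n] unfolding q_defs by algebra
qed

lemma eps_cong_dmom4': "eps_cong dmom4' (\<lambda>n. 1/2 * r1 n ^ 3 - 10 * r1 n ^ 4 + 25/2 * r1 n ^ 5)"
proof (rule eps_cong_solve[OF eps_cong_trans])
  show "eps_cong (\<lambda>n. s1 n * dmom4' n) (\<lambda>n. 3 * dmom2' n + 3 * nmom 1 n + 1 -
     (q01 n * nmom 3 n + q11 n * dmom 4 n + q20 n * nmom 5 n + q30 n * dmom 6 n))" (is "eps_cong _ ?B")
    by (rule eps_congI[OF _ _ _ second_order_eqs(2)]) (intro eps_order_0_intros eps_order_err eps_order_nmom eps_cong_oe[OF eps_cong_dmom2'])+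
  show "eps_cong ?B (\<lambda>n. 3 * (- 1/4 * r1 n ^ 2 + 5/4 * r1 n ^ 4) + 3 * (- 1/2 * r1 n - 1/2 * r1 n ^ 2) + 1 -
     (q01 n * (1/2 * r1 n ^ 2 - 5/2 * r1 n ^ 3) + q11 n * (3 * r1 n ^ 2)
       + q20 n * (25/2 * r1 n ^ 3 - 35/2 * r1 n ^ 4) + q30 n * (15 * r1 n ^ 3)))" (is "eps_cong _ ?C")
    by (intro eps_cong_intros eps_cong_dmom_4 eps_cong_dmom_6 eps_cong_nmom_1 eps_cong_nmom_3 eps_cong_nmom_5 eps_cong_dmom2')
  show "r1 n * ?C n = 1/2 * r1 n ^ 3 - 10 * r1 n ^ 4 + 25/2 * r1 n ^ 5" for n
    using s1_r1[of n] unfolding q_defs by algebra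
qed

lemma eps_cong_nmom1': "eps_cong nmom1' (\<lambda>n. 1/12 * r1 n - 1/24 * r1 n ^ 3 - 5/12 * r1 n ^ 4 - 5/8 * r1 n ^ 5)"
proof (rule eps_cong_solve[OF eps_cong_trans])
  show "eps_cong (\<lambda>n. s1 n * nmom1' n) (\<lambda>n. - q20 n * dmom2' n - q02 n - q11 n * nmom 1 n - q21 n * dmom 2 n
      - q30 n * nmom 3 n - q40 n * dmom 4 n)" (is "eps_cong _ ?B")
    by (rule eps_congI[OF _ _ _ second_order_eqs(3)]) (intro eps_order_0_intros eps_order_err eps_order_nmom eps_cong_oe[OF eps_cong_dmom2'])+
  show "eps_cong ?B (\<lambda>n. - q20 n * (- 1/4 * r1 n ^ 2 + 5/4 * r1 n ^ 4) - q02 n - q11 n * (- 1/2 * r1 n - 1/2 * r1 n ^ 2)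
      - q21 n * r1 n - q30 n * (1/2 * r1 n ^ 2 - 5/2 * r1 n ^ 3) - q40 n * (3 * r1 n ^ 2))" (is "eps_cong _ ?C")
    by (intro eps_cong_intros eps_cong_dmom_2 eps_cong_dmom_4 eps_cong_nmom_1 eps_cong_nmom_3 eps_cong_dmom2')
  show "r1 n * ?C n = 1/12 * r1 n - 1/24 * r1 n ^ 3 - 5/12 * r1 n ^ 4 - 5/8 * r1 n ^ 5" for n
    using s1_r1[of n] unfolding q_defs by algebra
qed

text \<open>The last equation of the triangular system: it uses the three other second-order terms
  and, through \<open>q30\<close> and \<open>q40\<close>, the leading terms of the fifth and sixth
  moments.\<close>

lemma eps_cong_nmom3': "eps_cong nmom3' (\<lambda>n. 1/4 * r1 n ^ 2 - 3/8 * r1 n ^ 3 + 1/2 * r1 n ^ 4 + 25/8 * r1 n ^ 5 - 15/2 * r1 n ^ 6)"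
proof (rule eps_cong_solve[OF eps_cong_trans])
  show "eps_cong (\<lambda>n. s1 n * nmom3' n) (\<lambda>n. 2 * nmom1' n - q01 n * dmom2' n - q20 n * dmom4' n - q02 n * dmom 2 n
      - q11 n * nmom 3 n - q21 n * dmom 4 n - q30 n * nmom 5 n - q40 n * dmom 6 n)" (is "eps_cong _ ?B")
    by (rule eps_congI[OF _ _ _ second_order_eqs(4)])
       (intro eps_order_0_intros eps_order_err eps_order_nmom eps_cong_oe[OF eps_cong_dmom2'] eps_cong_oe[OF eps_cong_dmom4'] eps_cong_oe[OF eps_cong_nmom1'])+
  show "eps_cong ?B (\<lambda>n. 2 * (1/12 * r1 n - 1/24 * r1 n ^ 3 - 5/12 * r1 n ^ 4 - 5/8 * r1 n ^ 5)
      - q01 n * (- 1/4 * r1 n ^ 2 + 5/4 * r1 n ^ 4) - q20 n * (1/2 * r1 n ^ 3 - 10 * r1 n ^ 4 + 25/2 * r1 n ^ 5)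
      - q02 n * r1 n - q11 n * (1/2 * r1 n ^ 2 - 5/2 * r1 n ^ 3) - q21 n * (3 * r1 n ^ 2)
      - q30 n * (25/2 * r1 n ^ 3 - 35/2 * r1 n ^ 4) - q40 n * (15 * r1 n ^ 3))" (is "eps_cong _ ?C")
    by (intro eps_cong_intros eps_cong_dmom_2 eps_cong_dmom_4 eps_cong_dmom_6 eps_cong_nmom_3 eps_cong_nmom_5 eps_cong_dmom2' eps_cong_dmom4' eps_cong_nmom1')
  show "r1 n * ?C n = 1/4 * r1 n ^ 2 - 3/8 * r1 n ^ 3 + 1/2 * r1 n ^ 4 + 25/8 * r1 n ^ 5 - 15/2 * r1 n ^ 6" for n
    using s1_r1[of n] unfolding q_defs by algebra
qed

section \<open>Central moments of the dimension exponent\<close>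

text \<open>Moments of the relative deviation \<open>(K - cen n) / cen n\<close>.\<close>

definition vmom :: "nat \<Rightarrow> nat \<Rightarrow> real" where "vmom j n = eps n ^ j * dmom j n"

lemma mean_poly:
  fixes n defines "v \<equiv> \<lambda>x. eps n * dev n x"
  assumes "\<And>x. f x = a0 + a1 * v x + a2 * v x ^ 2 + a3 * v x ^ 3 + a4 * v x ^ 4 + a5 * v x ^ 5 + a6 * v x ^ 6"
  shows "mean n f = a0 + a1 * vmom 1 n + a2 * vmom 2 n + a3 * vmom 3 n + a4 * vmom 4 n + a5 * vmom 5 n
     + a6 * vmom 6 n"
proof -
  have "poly_bounded v" unfolding v_def by (intro poly_bounded_intros')
  then have p: "poly_bounded v" "\<And>j. poly_bounded (\<lambda>x. v x ^ j)" by (auto intro: poly_bounded_power)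
  have V: "mean n (\<lambda>x. v x ^ j) = vmom j n" for j
    unfolding v_def power_mult_distrib vmom_def dmom_def by (rule mean_cmult) (intro poly_bounded_intros')
  have "mean n f = mean n (\<lambda>x. a0 + a1 * v x ^ 1 + a2 * v x ^ 2 + a3 * v x ^ 3 + a4 * v x ^ 4
     + a5 * v x ^ 5 + a6 * v x ^ 6)"
    by (intro arg_cong[of _ _ "mean n"] ext) (simp add: assms(2))
  also have "\<dots> = a0 + a1 * vmom 1 n + a2 * vmom 2 n + a3 * vmom 3 n + a4 * vmom 4 n + a5 * vmom 5 n
     + a6 * vmom 6 n"
    by (simp only: mean_add mean_cmult mean_const poly_bounded_intros p V)
  finally show ?thesis .
qed

lemma x_eq_dev: "x = cen n * (1 + eps n * dev n x)"
  using cen_gt_1[of n] by (simp add: eps_dev field_simps)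

text \<open>The \<open>dim_poly\<close> behave like conditional moments given \<open>K\<close>. The
  corresponding variance \<open>dim_poly_2 - dim_poly_1 ^ 2\<close> and third cumulant have joint
  degree only 3 and 4 in \<open>n\<close> and \<open>x\<close>. The identities are the laws of total
  variance and of the total third cumulant, in which the constant \<open>F\<close>, of size
  \<open>c ^ 2\<close>, drops out.\<close>

lemma moments_dim_poly:
  fixes n
  defines "c \<equiv> cen n" and "a \<equiv> alpha n" and "V \<equiv> \<lambda>j. vmom j n"
  defines "F \<equiv> (a - 2) * c^2 + 3 * c" and "b \<equiv> (a - 4) * c^2 + 3 * c"
    and "K0 \<equiv> c^3 - 7 * c^2 - (4 * (a * c - 1) + 3) * c + (a * c - 1)"
    and "K1 \<equiv> 3 * c^3 - 14 * c^2 - (4 * (a * c - 1) + 3) * c"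
    and "K2 \<equiv> 3 * c^3 - 7 * c^2"
  defines "g \<equiv> b * V 1 - 2 * c^2 * V 2"
    and "G2 \<equiv> b^2 * V 2 - 4 * b * c^2 * V 3 + 4 * c^4 * V 4"
    and "G3 \<equiv> b^3 * V 3 - 6 * b^2 * c^2 * V 4 + 12 * b * c^4 * V 5 - 8 * c^6 * V 6"
    and "KK \<equiv> K0 + K1 * V 1 + K2 * V 2 + c^3 * V 3"
    and "GK \<equiv> b * (K0 * V 1 + K1 * V 2 + K2 * V 3 + c^3 * V 4) - 2 * c^2 * (K0 * V 2 + K1 * V 3 + K2 * V 4 + c^3 * V 5)"
    and "H \<equiv> - 5/3 * c^4 * (1 + 4 * V 1 + 6 * V 2 + 4 * V 3 + V 4) + 20 * c^3 * (1 + 3 * V 1 + 3 * V 2 + V 3)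
      + (18 * (a * c - 1) + 116/3) * c^2 * (1 + 2 * V 1 + V 2) + (- 6 * (a * c - 1) - 1/3) * c * (1 + V 1) + (a * c - 1)"
  shows "mean n (dim_poly_1 n) = F + g" (is ?m1)
    "central_moment 2 dim_exponent n = G2 - g^2 + KK" (is ?m2)
    "central_moment 3 dim_exponent n = G3 - 3 * G2 * g + 2 * g^3 + 3 * (GK - g * KK) + H" (is ?m3)
proof -
  have n: "real n = a * c - 1" by (simp add: a_def c_def n_eq)
  define v where "v = (\<lambda>x. eps n * dev n x)"
  have x: "x = c * (1 + v x)" for x unfolding c_def v_def by (rule x_eq_dev)
  define h where "h = a * c - 1"
  define f k l where "f = (\<lambda>y. F + b * y - 2 * c^2 * y ^ 2)"
    and "k = (\<lambda>y. K0 + K1 * y + K2 * y ^ 2 + c^3 * y ^ 3)"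
    and "l = (\<lambda>y. - 5/3 * c^4 * (1 + y)^4 + 20 * c^3 * (1 + y)^3 + (18 * h + 116/3) * c^2 * (1 + y)^2
        + (- 6 * h - 1/3) * c * (1 + y) + h)"
  have n': "real n = h" by (simp add: n h_def)
  have P1: "dim_poly_1 n (c * (1 + y)) = f y" for y
    unfolding dim_poly_1_def f_def n F_def b_def by algebra
  have P2: "dim_poly_2 n (c * (1 + y)) = f y ^ 2 + k y" for y
  proof -
    have "dim_poly_2 n x = (dim_poly_1 n x)^2 + (x^3 - 7 * x^2 - (4 * real n + 3) * x + real n)" for x
      unfolding dim_poly_1_def dim_poly_2_def by algebra
    moreover have "(c * (1 + y))^3 - 7 * (c * (1 + y))^2 - (4 * real n + 3) * (c * (1 + y)) + real n = k y"
      unfolding n k_def K0_def K1_def K2_def by algebra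
    ultimately show ?thesis unfolding P1[symmetric] by simp
  qed
  have P3: "dim_poly_3 n (c * (1 + y)) = f y ^ 3 + 3 * f y * k y + l y" for y
  proof -
    have "dim_poly_3 n x = (dim_poly_1 n x)^3 + 3 * dim_poly_1 n x * (dim_poly_2 n x - (dim_poly_1 n x)^2)
      + (- 5/3 * x^4 + 20 * x^3 + (18 * real n + 116/3) * x^2 + (- 6 * real n - 1/3) * x + real n)" for x
      unfolding dim_poly_1_def dim_poly_2_def dim_poly_3_def by algebra
    from this[of "c * (1 + y)"] show ?thesis unfolding P1 P2 n' l_def by (simp add: power_mult_distrib)
  qed
  have F1: "dim_poly_1 n x = f (v x)" and F2: "dim_poly_2 n x = f (v x) ^ 2 + k (v x)"
    and F3: "dim_poly_3 n x = f (v x) ^ 3 + 3 * f (v x) * k (v x) + l (v x)" for x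
    using arg_cong[OF x[of x], of "dim_poly_1 n"] arg_cong[OF x[of x], of "dim_poly_2 n"]
      arg_cong[OF x[of x], of "dim_poly_3 n"] unfolding P1 P2 P3 .
  have vx: "eps n * dev n x = v x" for x by (simp add: v_def)
  have m1: "mean n (dim_poly_1 n) = F + b * V 1 + (- 2 * c^2) * V 2 + 0 * V 3 + 0 * V 4 + 0 * V 5 + 0 * V 6"
    unfolding V_def by (rule mean_poly) (simp add: F1 f_def vx)
  have m2: "mean n (dim_poly_2 n) = (F^2 + K0) + (2 * F * b + K1) * V 1 + (b^2 - 4 * F * c^2 + K2) * V 2
     + (- 4 * b * c^2 + c^3) * V 3 + 4 * c^4 * V 4 + 0 * V 5 + 0 * V 6"
    unfolding V_def by (rule mean_poly) (unfold vx F2 f_def k_def, algebra)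
  have m3: "mean n (dim_poly_3 n) =
      (F^3 + 3 * F * K0 + (- 5/3 * c^4 + 20 * c^3 + (18 * h + 116/3) * c^2 + (- 6 * h - 1/3) * c + h))
     + (3 * F^2 * b + 3 * (F * K1 + b * K0) + (- 20/3 * c^4 + 60 * c^3 + 2 * (18 * h + 116/3) * c^2 + (- 6 * h - 1/3) * c)) * V 1
     + (3 * F * b^2 - 6 * F^2 * c^2 + 3 * (F * K2 + b * K1 - 2 * c^2 * K0) + (- 10 * c^4 + 60 * c^3 + (18 * h + 116/3) * c^2)) * V 2
     + (b^3 - 12 * F * b * c^2 + 3 * (F * c^3 + b * K2 - 2 * c^2 * K1) + (- 20/3 * c^4 + 20 * c^3)) * V 3
     + (- 6 * b^2 * c^2 + 12 * F * c^4 + 3 * (b * c^3 - 2 * c^2 * K2) - 5/3 * c^4) * V 4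
     + (12 * b * c^4 - 6 * c^5) * V 5 + (- 8 * c^6) * V 6"
    unfolding V_def by (rule mean_poly) (unfold vx F3 f_def k_def l_def, algebra)
  show ?m1 unfolding m1 g_def by simp
  show ?m2 unfolding central_moment_eq m1 m2 G2_def g_def KK_def by algebra
  show ?m3 unfolding central_moment_eq m1 m2 m3 G2_def g_def KK_def G3_def GK_def H_def h_def[symmetric] by algebra
qed

text \<open>The residuals are the differences between the moments of the dimension exponent and their main
  terms, divided by the largest remaining power of \<open>cen n\<close>. They are written without division by \<open>d\<close>,
  which stands for \<open>1 / cen n\<close>, so that \<open>d = 0\<close> gives their limiting form.\<close>

definition mean_resid :: "real \<Rightarrow> real \<Rightarrow> real \<Rightarrow> real \<Rightarrow> real" where
  "mean_resid d a N1 M2 = 3 + ((a - 4 + 3 * d) * N1 - 2 * M2) + (a - 2) * (2 * (1 / a) - d * (1 / a)^2)"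

definition var_resid :: "real \<Rightarrow> real \<Rightarrow> real \<Rightarrow> real \<Rightarrow> real \<Rightarrow> real \<Rightarrow> real \<Rightarrow> real \<Rightarrow> real" where
  "var_resid d a r N1 N3 M2 M4 M2' =
    (let \<beta>0 = a - 4; \<beta> = \<beta>0 + 3 * d; g = \<beta> * N1 - 2 * M2; i = 1 / a in
      - 4 * \<beta> * N3 + 4 * M4 - g^2 + 3 * N1 + 3 * M2 + d * N3 - 7 * (1 + 2 * d * N1 + d * M2)
      - (4 * a - d) * (1 + d * N1) + d * (a - d)
      + (\<beta>^2 * M2' + 3 * (\<beta> + \<beta>0) * r)
      + (\<beta>0^2 * r + 1) * (3 * i - 3 * d * i^2 + d^2 * i^3))"

definition skew_resid :: "real \<Rightarrow> real \<Rightarrow> real \<Rightarrow> real \<Rightarrow> real \<Rightarrow> real \<Rightarrow> real \<Rightarrow> real \<Rightarrow> real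
    \<Rightarrow> real \<Rightarrow> real \<Rightarrow> real \<Rightarrow> real \<Rightarrow> real" where
  "skew_resid d a r N1 N3 N5 M2 M4 M6 N1' N3' M2' M4' =
    (let \<beta>0 = a - 4; \<beta> = \<beta>0 + 3 * d; g = \<beta> * N1 - 2 * M2; i = 1 / a;
      k1' = - 14 - 4 * a + d; k1 = 3 + d * k1'; k2 = 3 - 7 * d;
      n1 = - 1/2 * r - 1/2 * r^2; n3 = 1/2 * r^2 - 5/2 * r^3;
      g0 = \<beta>0 * n1 - 2 * r; g' = \<beta> * N1' + 3 * n1 - 2 * M2' in
      12 * \<beta> * N5 - 8 * M6 + 12 * (\<beta> * N3 - M4) * g + 2 * g^3 - 3 * \<beta> * k1 * N1^2
      + 3 * ((\<beta> * k2 - 2 * k1) * (N3 - N1 * M2) + \<beta> * (M4 - d * N1 * N3) - 2 * k2 * (M4 - M2^2)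
          - 2 * d * (N5 - M2 * N3))
      - 5/3 * (4 * N1 + 6 * M2 + 4 * d * N3 + d * M4) + 20 * (1 + 3 * d * N1 + 3 * d * M2 + d^2 * N3)
      + (18 * (a - d) + 116/3 * d) * (1 + 2 * d * N1 + d * M2)
      + (- 6 * d * (a - d) - 1/3 * d^2) * (1 + d * N1) + d^2 * (a - d)
      + (\<beta>^3 * N3' + 3 * (\<beta>^2 + \<beta> * \<beta>0 + \<beta>0^2) * n3 - 6 * (\<beta>^2 * M4' + 9 * (\<beta> + \<beta>0) * r^2)
         - 3 * (\<beta>^2 * M2 * g' + (\<beta>^2 * M2' + 3 * (\<beta> + \<beta>0) * r) * g0)
         + 3 * (\<beta> * k1 * M2' + (\<beta> * k1' + 9) * r))
      + (\<beta>0^3 * n3 - 18 * \<beta>0^2 * r^2 - 3 * \<beta>0^2 * r * g0 + 9 * \<beta>0 * r - 5/3)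
         * (4 * i - 6 * d * i^2 + 4 * d^2 * i^3 - d^3 * i^4))"

section \<open>Exact comparison with the main terms\<close>

lemma scaled_moments:
  fixes n
  defines "d \<equiv> eps n ^ 2"
  shows "vmom 1 n = d * nmom 1 n" "vmom 2 n = d * dmom 2 n" "vmom 3 n = d^2 * nmom 3 n"
    "vmom 4 n = d^2 * dmom 4 n" "vmom 5 n = d^3 * nmom 5 n" "vmom 6 n = d^3 * dmom 6 n"
    "dmom 2 n = r1 n + d * dmom2' n" "dmom 4 n = 3 * r1 n ^ 2 + d * dmom4' n"
    "nmom 1 n = - 1/2 * r1 n - 1/2 * r1 n ^ 2 + d * nmom1' n"
    "nmom 3 n = 1/2 * r1 n ^ 2 - 5/2 * r1 n ^ 3 + d * nmom3' n"
    "cen n * d = 1"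
  using eps_pos[of n] cen_eps[of n]
  by (simp_all add: d_def vmom_def dmom_nmom dmom2'_def dmom4'_def nmom1'_def nmom3'_def eval_nat_numeral)

text \<open>Polynomial algebra modulo \<open>c * d = 1\<close> and \<open>a * i = 1\<close>. As
  \<open>n = c * (a - d)\<close>, the main term is \<open>(a - 2) * c ^ 2 * (1 - d * i) ^ 2\<close>;
  expanding the square produces the powers of \<open>1 / a\<close> in the residual.\<close>

lemma mean_eq:
  "mean n (dim_poly_1 n) - ((alpha n - 2) / (alpha n)^2) * (real n)^2 =
    cen n * mean_resid (eps n ^ 2) (alpha n) (nmom 1 n) (dmom 2 n)"
proof -
  define a c d i N1 M2 where "a = alpha n" and "c = cen n" and "d = eps n ^ 2" and "i = 1 / alpha n"
    and "N1 = nmom 1 n" and "M2 = dmom 2 n"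
  note V = scaled_moments(1,2)[of n, folded d_def N1_def M2_def]
  have cd: "c * d = 1" unfolding c_def d_def by (rule scaled_moments(11))
  have ai: "a * i = 1" using alpha_pos[of n] by (simp add: a_def i_def)
  have n: "real n = c * (a - d)"
    using cd n_eq[of n, folded a_def c_def] by algebra
  have T: "((a - 2) / a^2) * (real n)^2 = (a - 2) * i^2 * (real n)^2"
    using alpha_pos[of n] by (simp add: a_def i_def power_divide)
  show ?thesis
    unfolding moments_dim_poly(1) V mean_resid_def a_def[symmetric] c_def[symmetric] d_def[symmetric]
      N1_def[symmetric] M2_def[symmetric] T i_def[folded a_def, symmetric] unfolding n
    using cd ai by algebra
qed

text \<open>Origin of the numerator: the variance \<open>r\<close> of the weights enters with the
  squared slope \<open>(a - 4) ^ 2\<close> of \<open>dim_poly_1\<close> at the centre, and the mean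
  of \<open>dim_poly_2 - dim_poly_1 ^ 2\<close> adds \<open>1 = (a + 1) * r\<close>. Together this
  is \<open>(a ^ 2 - 7 * a + 17) * r\<close>.\<close>

lemma variance_eq:
  "central_moment 2 dim_exponent n
      - (((alpha n)^2 - 7 * alpha n + 17) / ((alpha n)^3 * (alpha n + 1))) * (real n)^3 =
    (cen n)^2 * var_resid (eps n ^ 2) (alpha n) (r1 n) (nmom 1 n) (nmom 3 n) (dmom 2 n) (dmom 4 n) (dmom2' n)"
proof -
  define a c d i r where "a = alpha n" and "c = cen n" and "d = eps n ^ 2" and "i = 1 / alpha n"
    and "r = r1 n"
  define N1 N3 M2 M4 M2' where "N1 = nmom 1 n" and "N3 = nmom 3 n" and "M2 = dmom 2 n"
    and "M4 = dmom 4 n" and "M2' = dmom2' n"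
  note folds = N1_def N3_def M2_def M4_def M2'_def d_def a_def c_def r_def
  note V = scaled_moments(1-4)[of n, folded folds]
  have M2: "M2 = r + d * M2'" using scaled_moments(7)[of n, folded folds] .
  have cd: "c * d = 1" unfolding c_def d_def by (rule scaled_moments(11))
  have ai: "a * i = 1" using alpha_pos[of n] by (simp add: a_def i_def)
  have ar: "(a + 1) * r = 1" using s1_r1[of n] by (simp add: a_def r_def s1_def add.commute)
  have n: "real n = c * (a - d)"
    using cd n_eq[of n, folded a_def c_def] by algebra
  define \<beta> g where "\<beta> = a - 4 + 3 * d" and "g = \<beta> * N1 - 2 * M2"
  have b: "(a - 4) * c^2 + 3 * c = c^2 * \<beta>" unfolding \<beta>_def using cd by algebra
  have gg: "c^2 * \<beta> * (d * N1) - 2 * c^2 * (d * M2) = c * g" unfolding g_def using cd by algebra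
  have G2: "(c^2 * \<beta>)^2 * (d * M2) - 4 * (c^2 * \<beta>) * c^2 * (d^2 * N3) + 4 * c^4 * (d^2 * M4)
      = c^3 * (\<beta>^2 * M2 - 4 * d * \<beta> * N3 + 4 * d * M4)" using cd by algebra
  have KK: "c^3 - 7 * c^2 - (4 * (a * c - 1) + 3) * c + (a * c - 1)
     + (3 * c^3 - 14 * c^2 - (4 * (a * c - 1) + 3) * c) * (d * N1) + (3 * c^3 - 7 * c^2) * (d * M2) + c^3 * (d^2 * N3)
     = c^3 * (1 + d * (3 * N1 + 3 * M2 + d * N3 - 7 * (1 + 2 * d * N1 + d * M2)
      - (4 * a - d) * (1 + d * N1) + d * (a - d)))" using cd by algebra
  have lead: "\<beta>^2 * M2 + 1 = ((a - 4)^2 * r + 1) + d * (\<beta>^2 * M2' + 3 * (\<beta> + (a - 4)) * r)"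
    unfolding M2 \<beta>_def by algebra
  have "((a^2 - 7 * a + 17) / (a^3 * (a + 1))) * (real n)^3 = (a^2 - 7 * a + 17) * r * (i * real n)^3"
    using alpha_pos[of n] by (simp add: a_def i_def r_def r1_def power_divide add.commute)
  also have "(a^2 - 7 * a + 17) * r = (a - 4)^2 * r + 1" using ar by algebra
  also have "i * real n = c * (1 - d * i)" unfolding n using ai by algebra
  finally have T: "((a^2 - 7 * a + 17) / (a^3 * (a + 1))) * (real n)^3 = ((a - 4)^2 * r + 1) * (c * (1 - d * i))^3" .
  have "central_moment 2 dim_exponent n = c^3 * (\<beta>^2 * M2 - 4 * d * \<beta> * N3 + 4 * d * M4) - (c * g)^2
    + c^3 * (1 + d * (3 * N1 + 3 * M2 + d * N3 - 7 * (1 + 2 * d * N1 + d * M2)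
      - (4 * a - d) * (1 + d * N1) + d * (a - d)))"
    unfolding moments_dim_poly(2) V folds[symmetric] b gg G2 KK ..
  also have "\<dots> = c^3 * ((\<beta>^2 * M2 + 1) + d * (- 4 * \<beta> * N3 + 4 * M4 - g^2
      + (3 * N1 + 3 * M2 + d * N3 - 7 * (1 + 2 * d * N1 + d * M2) - (4 * a - d) * (1 + d * N1) + d * (a - d))))"
    using cd by algebra
  finally show ?thesis
    unfolding folds[symmetric] T lead var_resid_def Let_def \<beta>_def[symmetric] g_def[symmetric]
      i_def[folded a_def, symmetric]
    using cd by algebra
qed

text \<open>The quartic divided by \<open>(a + 1) ^ 3\<close> is \<open>L\<close>. There
  \<open>n3\<close>, \<open>r ^ 2\<close> and \<open>g0\<close> carry the skewness of the weights
  and the curvature of \<open>dim_poly_1\<close>, \<open>9 * \<beta>0 * r\<close> is three times the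
  covariance of \<open>dim_poly_1\<close> with \<open>dim_poly_2 - dim_poly_1 ^ 2\<close>, and
  \<open>- 5/3\<close> is the leading coefficient of the third cumulant.\<close>

lemma skewness_eq:
  "central_moment 3 dim_exponent n
      - (- (881 / 3) - 244 * alpha n + 145 * (alpha n)^2 - (83 / 3) * (alpha n)^3 + 2 * (alpha n)^4)
            * ((real n)^4 / ((alpha n)^4 * (alpha n + 1)^3)) =
    (cen n)^3 * skew_resid (eps n ^ 2) (alpha n) (r1 n) (nmom 1 n) (nmom 3 n) (nmom 5 n)
      (dmom 2 n) (dmom 4 n) (dmom 6 n) (nmom1' n) (nmom3' n) (dmom2' n) (dmom4' n)"
proof -
  define a c d i r where "a = alpha n" and "c = cen n" and "d = eps n ^ 2" and "i = 1 / alpha n"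
    and "r = r1 n"
  define N1 N3 N5 M2 M4 M6 where "N1 = nmom 1 n" and "N3 = nmom 3 n" and "N5 = nmom 5 n"
    and "M2 = dmom 2 n" and "M4 = dmom 4 n" and "M6 = dmom 6 n"
  define N1' N3' M2' M4' where "N1' = nmom1' n" and "N3' = nmom3' n" and "M2' = dmom2' n" and "M4' = dmom4' n"
  note folds = N1_def N3_def N5_def M2_def M4_def M6_def N1'_def N3'_def M2'_def M4'_def
    d_def a_def c_def r_def
  note V = scaled_moments(1-6)[of n, folded folds]
  note E = scaled_moments(7-10)[of n, folded folds]
  have cd: "c * d = 1" unfolding c_def d_def by (rule scaled_moments(11))
  have ai: "a * i = 1" using alpha_pos[of n] by (simp add: a_def i_def)
  have ar: "(a + 1) * r = 1" using s1_r1[of n] by (simp add: a_def r_def s1_def add.commute)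
  have n: "real n = c * (a - d)"
    using cd n_eq[of n, folded a_def c_def] by algebra
  define \<beta>0 where "\<beta>0 = a - 4"
  define \<beta> where "\<beta> = \<beta>0 + 3 * d"
  define g where "g = \<beta> * N1 - 2 * M2"
  define k1' where "k1' = - 14 - 4 * a + d"
  define k1 k2 where "k1 = 3 + d * k1'" and "k2 = 3 - 7 * d"
  define n1 n3 where "n1 = - 1/2 * r - 1/2 * r^2" and "n3 = 1/2 * r^2 - 5/2 * r^3"
  define g0 g' where "g0 = \<beta>0 * n1 - 2 * r" and "g' = \<beta> * N1' + 3 * n1 - 2 * M2'"
  define L where "L = \<beta>0^3 * n3 - 18 * \<beta>0^2 * r^2 - 3 * \<beta>0^2 * r * g0 + 9 * \<beta>0 * r - 5/3"
  have b: "(a - 4) * c^2 + 3 * c = c^2 * \<beta>" unfolding \<beta>_def \<beta>0_def using cd by algebra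
  have gg: "c^2 * \<beta> * (d * N1) - 2 * c^2 * (d * M2) = c * g" unfolding g_def using cd by algebra
  have G2: "(c^2 * \<beta>)^2 * (d * M2) - 4 * (c^2 * \<beta>) * c^2 * (d^2 * N3) + 4 * c^4 * (d^2 * M4)
      = c^3 * (\<beta>^2 * M2 - 4 * d * \<beta> * N3 + 4 * d * M4)" using cd by algebra
  have G3: "(c^2 * \<beta>)^3 * (d^2 * N3) - 6 * (c^2 * \<beta>)^2 * c^2 * (d^2 * M4) + 12 * (c^2 * \<beta>) * c^4 * (d^3 * N5)
      - 8 * c^6 * (d^3 * M6) = c^4 * (\<beta>^3 * N3 - 6 * \<beta>^2 * M4 + 12 * d * \<beta> * N5 - 8 * d * M6)"
    using cd by algebra
  define K0 K1 K2 where "K0 = c^3 - 7 * c^2 - (4 * (a * c - 1) + 3) * c + (a * c - 1)"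
    and "K1 = 3 * c^3 - 14 * c^2 - (4 * (a * c - 1) + 3) * c" and "K2 = 3 * c^3 - 7 * c^2"
  have K: "K1 = c^3 * k1" "K2 = c^3 * k2"
    unfolding K1_def K2_def k1_def k2_def k1'_def using cd by algebra+
  have GK: "c^2 * \<beta> * (K0 * (d * N1) + K1 * (d * M2) + K2 * (d^2 * N3) + c^3 * (d^2 * M4))
     - 2 * c^2 * (K0 * (d * M2) + K1 * (d^2 * N3) + K2 * (d^2 * M4) + c^3 * (d^3 * N5))
     - c * g * (K0 + K1 * (d * N1) + K2 * (d * M2) + c^3 * (d^2 * N3)) =
     c^4 * (\<beta> * k1 * (M2 - d * N1^2) + d * ((\<beta> * k2 - 2 * k1) * (N3 - N1 * M2) + \<beta> * (M4 - d * N1 * N3)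
       - 2 * k2 * (M4 - M2^2) - 2 * d * (N5 - M2 * N3)))"
    unfolding K g_def using cd by algebra
  have H: "- 5/3 * c^4 * (1 + 4 * (d * N1) + 6 * (d * M2) + 4 * (d^2 * N3) + d^2 * M4)
      + 20 * c^3 * (1 + 3 * (d * N1) + 3 * (d * M2) + d^2 * N3)
      + (18 * (a * c - 1) + 116/3) * c^2 * (1 + 2 * (d * N1) + d * M2)
      + (- 6 * (a * c - 1) - 1/3) * c * (1 + d * N1) + (a * c - 1) =
     c^4 * (- 5/3 + d * (- 5/3 * (4 * N1 + 6 * M2 + 4 * d * N3 + d * M4)
      + 20 * (1 + 3 * d * N1 + 3 * d * M2 + d^2 * N3)
      + (18 * (a - d) + 116/3 * d) * (1 + 2 * d * N1 + d * M2)
      + (- 6 * d * (a - d) - 1/3 * d^2) * (1 + d * N1) + d^2 * (a - d)))"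
    using cd by algebra
  have gd: "g = g0 + d * g'" unfolding g_def g0_def g'_def E \<beta>_def n1_def by algebra
  have lead: "\<beta>^3 * N3 - 6 * \<beta>^2 * M4 - 3 * \<beta>^2 * M2 * g + 3 * \<beta> * k1 * M2 - 5/3 =
      L + d * (\<beta>^3 * N3' + 3 * (\<beta>^2 + \<beta> * \<beta>0 + \<beta>0^2) * n3 - 6 * (\<beta>^2 * M4' + 9 * (\<beta> + \<beta>0) * r^2)
         - 3 * (\<beta>^2 * M2 * g' + (\<beta>^2 * M2' + 3 * (\<beta> + \<beta>0) * r) * g0)
         + 3 * (\<beta> * k1 * M2' + (\<beta> * k1' + 9) * r))"
    unfolding gd L_def E n3_def k1_def \<beta>_def by algebra
  have "(- (881 / 3) - 244 * a + 145 * a^2 - (83 / 3) * a^3 + 2 * a^4) * ((real n)^4 / (a^4 * (a + 1)^3)) =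
    (- (881 / 3) - 244 * a + 145 * a^2 - (83 / 3) * a^3 + 2 * a^4) * r^3 * (i * real n)^4"
    using alpha_pos[of n] by (simp add: a_def i_def r_def r1_def power_divide add.commute)
  also have "(- (881 / 3) - 244 * a + 145 * a^2 - (83 / 3) * a^3 + 2 * a^4) * r^3 = L"
    unfolding L_def g0_def n1_def n3_def \<beta>0_def using ar by algebra
  also have "i * real n = c * (1 - d * i)" unfolding n using ai by algebra
  finally have T: "(- (881 / 3) - 244 * a + 145 * a^2 - (83 / 3) * a^3 + 2 * a^4) * ((real n)^4 / (a^4 * (a + 1)^3))
     = L * (c * (1 - d * i))^4" .
  have "central_moment 3 dim_exponent n = c^4 * (\<beta>^3 * N3 - 6 * \<beta>^2 * M4 + 12 * d * \<beta> * N5 - 8 * d * M6)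
    - 3 * (c^3 * (\<beta>^2 * M2 - 4 * d * \<beta> * N3 + 4 * d * M4)) * (c * g) + 2 * (c * g)^3
    + 3 * (c^4 * (\<beta> * k1 * (M2 - d * N1^2) + d * ((\<beta> * k2 - 2 * k1) * (N3 - N1 * M2) + \<beta> * (M4 - d * N1 * N3)
       - 2 * k2 * (M4 - M2^2) - 2 * d * (N5 - M2 * N3))))
    + c^4 * (- 5/3 + d * (- 5/3 * (4 * N1 + 6 * M2 + 4 * d * N3 + d * M4)
      + 20 * (1 + 3 * d * N1 + 3 * d * M2 + d^2 * N3)
      + (18 * (a - d) + 116/3 * d) * (1 + 2 * d * N1 + d * M2)
      + (- 6 * d * (a - d) - 1/3 * d^2) * (1 + d * N1) + d^2 * (a - d)))"
    unfolding moments_dim_poly(3) V folds[symmetric] b gg G2 G3 H K0_def[symmetric] K1_def[symmetric]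
      K2_def[symmetric] GK ..
  also have "\<dots> = c^4 * ((\<beta>^3 * N3 - 6 * \<beta>^2 * M4 - 3 * \<beta>^2 * M2 * g + 3 * \<beta> * k1 * M2 - 5/3)
    + d * (12 * \<beta> * N5 - 8 * M6 + 12 * (\<beta> * N3 - M4) * g + 2 * g^3 - 3 * \<beta> * k1 * N1^2
      + 3 * ((\<beta> * k2 - 2 * k1) * (N3 - N1 * M2) + \<beta> * (M4 - d * N1 * N3) - 2 * k2 * (M4 - M2^2)
          - 2 * d * (N5 - M2 * N3))
      - 5/3 * (4 * N1 + 6 * M2 + 4 * d * N3 + d * M4) + 20 * (1 + 3 * d * N1 + 3 * d * M2 + d^2 * N3)
      + (18 * (a - d) + 116/3 * d) * (1 + 2 * d * N1 + d * M2)
      + (- 6 * d * (a - d) - 1/3 * d^2) * (1 + d * N1) + d^2 * (a - d)))"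
    using cd by algebra
  finally show ?thesis
    unfolding folds[symmetric] T lead skew_resid_def Let_def \<beta>0_def[symmetric] \<beta>_def[symmetric] g_def[symmetric]
      k1'_def[symmetric] k1_def[symmetric] k2_def[symmetric] n1_def[symmetric] n3_def[symmetric]
      g0_def[symmetric] g'_def[symmetric] L_def[symmetric] i_def[folded a_def, symmetric]
    using cd by algebra
qed

section \<open>Size of the residuals\<close>

lemma eps_order_1_bounded:
  assumes "eps_order 1 f" shows "f \<in> O(\<lambda>_. 1)"
proof -
  obtain p where p: "f \<in> O(\<lambda>n. alpha n ^ p * eps n ^ 1)" using assms by (auto simp: eps_order_def)
  have "filterlim (\<lambda>x::real. x / 2) at_top at_top" by real_asymp
  from filterlim_compose[OF tendsto_power_div_exp_0[of p] this]
  have "((\<lambda>x::real. 2 ^ p * ((x / 2) ^ p / exp (x / 2))) \<longlongrightarrow> 2 ^ p * 0) at_top"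
    by (intro tendsto_mult tendsto_const)
  also have "(\<lambda>x::real. 2 ^ p * ((x / 2) ^ p / exp (x / 2))) = (\<lambda>x. x ^ p * exp (- x / 2))"
    by (auto simp: power_divide exp_minus field_simps)
  finally have "((\<lambda>x::real. x ^ p * exp (- x / 2)) \<longlongrightarrow> 0) at_top" by simp
  from filterlim_compose[OF this filterlim_alpha]
  have "(\<lambda>n. alpha n ^ p * eps n) \<longlonglongrightarrow> 0" by (simp add: eps_def)
  then have "(\<lambda>n. alpha n ^ p * eps n) \<in> O(\<lambda>_. 1)"
    by (intro bigoI_tendsto[where c = 0]) auto
  with p show ?thesis by (auto intro: landau_o.big_trans)
qed

text \<open>Reduces the size of a residual to the growth at infinity of one real function, evaluated
  at \<open>alpha n\<close>.\<close>

lemma eps_cong_bigo: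
  assumes "eps_cong f (\<lambda>n. \<phi> (alpha n))" "\<phi> \<in> O[at_top](\<lambda>x. x ^ p)"
  shows "f \<in> O(\<lambda>n. alpha n ^ p)"
proof -
  have "(\<lambda>_. 1) \<in> O[at_top](\<lambda>x::real. x ^ p)"
    by (rule bigoI[of _ 1]) (use eventually_ge_at_top[of 1] in \<open>eventually_elim, auto\<close>)
  then have one: "(\<lambda>n. 1) \<in> O(\<lambda>n. alpha n ^ p)"
    by (rule landau_o.big.compose[OF _ filterlim_alpha])
  have "(\<lambda>n. f n - \<phi> (alpha n)) \<in> O(\<lambda>n. alpha n ^ p)"
    using assms(1) eps_order_1_bounded one unfolding eps_cong_def by (blast intro: landau_o.big_trans)
  moreover have "(\<lambda>n. \<phi> (alpha n)) \<in> O(\<lambda>n. alpha n ^ p)"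
    by (rule landau_o.big.compose[OF assms(2) filterlim_alpha])
  ultimately have "(\<lambda>n. (f n - \<phi> (alpha n)) + \<phi> (alpha n)) \<in> O(\<lambda>n. alpha n ^ p)"
    by (rule sum_in_bigo)
  then show ?thesis by simp
qed

text \<open>As \<open>cen n\<close> is about \<open>n / alpha n\<close>, a residual multiplied by
  \<open>cen n ^ Suc k\<close> may itself grow like \<open>alpha n ^ k\<close>. This is the room
  available for the mean at \<open>k = 0\<close> and for the second and third central moments at
  \<open>k = 1\<close> and \<open>k = 2\<close>.\<close>

lemma cen_power_bigo:
  assumes "f \<in> O(\<lambda>n. alpha n ^ k)"
  shows "(\<lambda>n. cen n ^ Suc k * f n) \<in> O(\<lambda>n. real n ^ Suc k * inverse (alpha n))"
proof -
  have "(\<lambda>n. alpha n * cen n) \<in> O(\<lambda>n. real n)"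
    unfolding alpha_cen by real_asymp
  then have "(\<lambda>n. (alpha n * cen n) ^ Suc k) \<in> O(\<lambda>n. real n ^ Suc k)" by (rule landau_o.big_power)
  then have "(\<lambda>n. (alpha n * cen n) ^ Suc k * inverse (alpha n)) \<in> O(\<lambda>n. real n ^ Suc k * inverse (alpha n))"
    by (intro landau_o.big.mult) auto
  moreover have "(\<lambda>n. (alpha n * cen n) ^ Suc k * inverse (alpha n)) = (\<lambda>n. cen n ^ Suc k * alpha n ^ k)"
    using alpha_pos by (auto simp: power_mult_distrib field_simps less_imp_neq[symmetric])
  moreover have "(\<lambda>n. cen n ^ Suc k * f n) \<in> O(\<lambda>n. cen n ^ Suc k * alpha n ^ k)"
    using assms by (intro landau_o.big.mult) auto
  ultimately show ?thesis by (auto intro: landau_o.big_trans)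
qed

lemma eps_cong_power: "eps_cong f g \<Longrightarrow> eps_cong (\<lambda>n. f n ^ m) (\<lambda>n. g n ^ m)"
  by (induction m) (auto intro: eps_cong_refl[OF eps_order_const] eps_cong_mult)

lemma eps_cong_eps: "eps_cong eps (\<lambda>_. 0)"
  by (simp add: eps_cong_def eps_order_const eps_order_eps[simplified])

lemma eps_order_alpha: "eps_order 0 alpha"
  unfolding eps_order_def by (rule exI[of _ 1]) simp

lemma eps_order_inverse_alpha: "eps_order 0 (\<lambda>n. 1 / alpha n)"
proof (rule eps_order_bounded, rule bigoI[of _ 1])
  show "\<forall>\<^sub>F n in sequentially. norm (1 / alpha n) \<le> 1 * norm (1::real)"
    using eventually_alpha_large[of 1] by eventually_elim auto
qed

lemma eps_cong_eps2: "eps_cong (\<lambda>n. eps n ^ 2) (\<lambda>_. 0)"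
  using eps_cong_power[OF eps_cong_eps, of 2] by simp

lemmas eps_cong_rules = eps_cong_eps2 eps_cong_dmom_2 eps_cong_dmom_4 eps_cong_dmom_6 eps_cong_nmom_1 eps_cong_nmom_3 eps_cong_nmom_5 eps_cong_dmom2' eps_cong_dmom4'
  eps_cong_nmom1' eps_cong_nmom3' eps_cong_refl[OF eps_order_r1] eps_cong_refl[OF eps_order_inverse_alpha] eps_cong_refl[OF eps_order_alpha]
  eps_cong_add eps_cong_diff eps_cong_minus eps_cong_mult eps_cong_power eps_cong_refl[OF eps_order_const]

lemma mean_resid_bigo:
  "(\<lambda>n. mean_resid (eps n ^ 2) (alpha n) (nmom 1 n) (dmom 2 n)) \<in> O(\<lambda>n. alpha n ^ 0)" (is "?f \<in> _")
proof (rule eps_cong_bigo)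
  show "eps_cong ?f (\<lambda>n. (\<lambda>x. let r = 1 / (1 + x) in mean_resid 0 x (- 1/2 * r - 1/2 * r^2) r) (alpha n))" (is "eps_cong _ (\<lambda>n. ?g (alpha n))")
    unfolding mean_resid_def Let_def r1_def[symmetric] by (intro eps_cong_rules)
  show "?g \<in> O[at_top](\<lambda>x. x ^ 0)"
    unfolding mean_resid_def Let_def by real_asymp
qed

lemma var_resid_bigo:
  "(\<lambda>n. var_resid (eps n ^ 2) (alpha n) (r1 n) (nmom 1 n) (nmom 3 n) (dmom 2 n) (dmom 4 n) (dmom2' n))
    \<in> O(\<lambda>n. alpha n ^ 1)" (is "?f \<in> _")
proof (rule eps_cong_bigo)
  show "eps_cong ?f (\<lambda>n. (\<lambda>x. let r = 1 / (1 + x) in var_resid 0 x r (- 1/2 * r - 1/2 * r^2) (1/2 * r^2 - 5/2 * r^3) r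
       (3 * r^2) (- 1/4 * r^2 + 5/4 * r^4)) (alpha n))" (is "eps_cong _ (\<lambda>n. ?g (alpha n))")
    unfolding var_resid_def Let_def r1_def[symmetric] by (intro eps_cong_rules)
  show "?g \<in> O[at_top](\<lambda>x. x ^ 1)"
    unfolding var_resid_def Let_def by real_asymp
qed

lemma skew_resid_bigo:
  "(\<lambda>n. skew_resid (eps n ^ 2) (alpha n) (r1 n) (nmom 1 n) (nmom 3 n) (nmom 5 n)
      (dmom 2 n) (dmom 4 n) (dmom 6 n) (nmom1' n) (nmom3' n) (dmom2' n) (dmom4' n))
    \<in> O(\<lambda>n. alpha n ^ 2)" (is "?f \<in> _")
proof (rule eps_cong_bigo)
  show "eps_cong ?f (\<lambda>n. (\<lambda>x. let r = 1 / (1 + x) in skew_resid 0 x r (- 1/2 * r - 1/2 * r^2) (1/2 * r^2 - 5/2 * r^3)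
       (25/2 * r^3 - 35/2 * r^4) r (3 * r^2) (15 * r^3)
       (1/12 * r - 1/24 * r^3 - 5/12 * r^4 - 5/8 * r^5)
       (1/4 * r^2 - 3/8 * r^3 + 1/2 * r^4 + 25/8 * r^5 - 15/2 * r^6)
       (- 1/4 * r^2 + 5/4 * r^4) (1/2 * r^3 - 10 * r^4 + 25/2 * r^5)) (alpha n))" (is "eps_cong _ (\<lambda>n. ?g (alpha n))")
    unfolding skew_resid_def Let_def r1_def[symmetric] by (intro eps_cong_rules)
  show "?g \<in> O[at_top](\<lambda>x. x ^ 2)"
    unfolding skew_resid_def Let_def by real_asymp
qed

theorem theorem3p3:
  shows "((\<lambda>n. alpha n - (ln (real n) - ln (ln (real n)))) \<longlonglongrightarrow> 0) \<and>
    (\<lambda>n. expect_partitions n (\<lambda>P. real_of_int (dim_exponent n P))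
          - ((alpha n - 2) / (alpha n)^2) * (real n)^2)
      \<in> O(\<lambda>n. real n * inverse (alpha n)) \<and>
    (\<lambda>n. central_moment 2 dim_exponent n
          - (((alpha n)^2 - 7 * alpha n + 17) / ((alpha n)^3 * (alpha n + 1))) * (real n)^3)
      \<in> O(\<lambda>n. (real n)^2 * inverse (alpha n)) \<and>
    (\<lambda>n. central_moment 3 dim_exponent n
          - (- (881 / 3) - 244 * alpha n + 145 * (alpha n)^2 - (83 / 3) * (alpha n)^3
               + 2 * (alpha n)^4)
            * ((real n)^4 / ((alpha n)^4 * (alpha n + 1)^3)))
      \<in> O(\<lambda>n. (real n)^3 * inverse (alpha n))"
proof (intro conjI)
  show "(\<lambda>n. alpha n - (ln (real n) - ln (ln (real n)))) \<longlonglongrightarrow> 0"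
    by (rule alpha_asymptotics)
  show "(\<lambda>n. expect_partitions n (\<lambda>P. real_of_int (dim_exponent n P))
          - ((alpha n - 2) / (alpha n)^2) * (real n)^2) \<in> O(\<lambda>n. real n * inverse (alpha n))"
    unfolding expect_dim_exponent mean_eq using cen_power_bigo[OF mean_resid_bigo] by simp
  show "(\<lambda>n. central_moment 2 dim_exponent n
          - (((alpha n)^2 - 7 * alpha n + 17) / ((alpha n)^3 * (alpha n + 1))) * (real n)^3)
      \<in> O(\<lambda>n. (real n)^2 * inverse (alpha n))"
    unfolding variance_eq using cen_power_bigo[OF var_resid_bigo] by (simp add: numeral_2_eq_2)
  show "(\<lambda>n. central_moment 3 dim_exponent n
          - (- (881 / 3) - 244 * alpha n + 145 * (alpha n)^2 - (83 / 3) * (alpha n)^3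
               + 2 * (alpha n)^4)
            * ((real n)^4 / ((alpha n)^4 * (alpha n + 1)^3)))
      \<in> O(\<lambda>n. (real n)^3 * inverse (alpha n))"
    unfolding skewness_eq using cen_power_bigo[OF skew_resid_bigo] by (simp add: numeral_3_eq_3 numeral_2_eq_2)
qed

end
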